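(* Let $d\ge1$, $a,b>0$, $\Lambda=a\mathbb{Z}^d\times b\mathbb{Z}^d$, and $Q=[-\frac{1}{2a},\frac{1}{2a}]^d\times[-\frac{1}{2b},\frac{1}{2b}]^d$. Let $\sigma\in L^2(\mathbb{R}^{2d})$ with $\operatorname{supp}\hat\sigma\subseteq Q$ and let $g\in L^2(\mathbb{R}^d)$. Choose $\varphi\in C_c^\infty(\mathbb{R}^{2d})$ such that $\varphi=1$ on $Q$, assume that $\overline{\mathcal{U}V_gg}$ does not vanish on $\operatorname{supp}\varphi$, and define $K=\mathcal{F}^{-1}\left(\frac{\varphi}{\overline{\mathcal{U}V_gg}}\right)$. Then $\sigma$ can be reconstructed from the numbers $H_{\lambda,\lambda}=\langle\sigma^{KN}\pi(\lambda)g,\pi(\lambda)g\rangle$, $\lambda\in\Lambda$, by $$\sigma=\sum_{\lambda\in\Lambda}H_{\lambda,\lambda}\,T_\lambda(\operatorname{sinc}_\Lambda*K),$$ with convergence in $L^2(\mathbb{R}^{2d})$ and uniform convergence.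
   Context: The Fourier transform is $\mathcal{F}f(\xi)=\hat f(\xi)=\int f(x)e^{-2\pi i\xi\cdot x}\,dx$, extended to $L^2$. For $z=(x,\xi)\in\mathbb{R}^{2d}$, $\pi(z)f(t)=e^{2\pi i\xi\cdot t}f(t-x)$ for functions $f$ on $\mathbb{R}^d$. For $\lambda\in\mathbb{R}^{2d}$, $T_\lambda F(z)=F(z-\lambda)$ for functions $F$ on $\mathbb{R}^{2d}$. The short-time Fourier transform is $V_gf(x,\xi)=\int f(t)\overline{g(t-x)}e^{-2\pi i\xi\cdot t}\,dt$, and $\mathcal{U}F(\xi,x)=F(-x,\xi)$ for $x,\xi\in\mathbb{R}^d$. The Rihaczek distribution is $R(f,g)(x,\xi)=f(x)\overline{\hat g(\xi)}e^{-2\pi i x\cdot\xi}$. The pseudodifferential operator $\sigma^{KN}$ with Kohn-Nirenberg symbol $\sigma$ is defined weakly by $\langle\sigma^{KN}f,g\rangle=\langle\sigma,R(g,f)\rangle=\int_{\mathbb{R}^{2d}}\sigma(z)\overline{R(g,f)(z)}\,dz$ (brackets are conjugate-linear in the second argument). The quotient $\varphi/\overline{\mathcal{U}V_gg}$ is understood to be $0$ outside $\operatorname{supp}\varphi$; it is a bounded function, and convolution $F\mapsto F*K$ on $L^2(\mathbb{R}^{2d})$ is the Fourier multiplier with symbol $\hat K=\varphi/\overline{\mathcal{U}V_gg}$. The sinc function adapted to the lattice is $\operatorname{sinc}_\Lambda(x)=\prod_{j=1}^d\frac{\sin(\pi x_j/a)}{\pi x_j/a}\prod_{j=d+1}^{2d}\frac{\sin(\pi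 x_j/b)}{\pi x_j/b}$, $x\in\mathbb{R}^{2d}$. *)

theory Defs
  imports "HOL-Analysis.Analysis" "HOL-Probability.Sinc_Integral"
begin

text \<open>
  Elements of \<open>L\<^sup>2\<close> are given by Borel representatives \<open>f :: 'a \<Rightarrow> complex\<close>. Phase space
  \<open>\<real>\<^sup>2\<^sup>d\<close> is the product \<open>(real^'d) \<times> (real^'d)\<close>, whose first component is the position \<open>x\<close> and
  whose second component is the frequency \<open>\<xi>\<close>; the dimension is \<open>d = CARD('d) \<ge> 1\<close>.
\<close>

definition L2 :: "('a::euclidean_space \<Rightarrow> complex) set" where
  "L2 = {f \<in> borel_measurable lborel. integrable lborel (\<lambda>x. (cmod (f x))\<^sup>2)}"

definition L2_inner :: "('a::euclidean_space \<Rightarrow> complex) \<Rightarrow> ('a \<Rightarrow> complex) \<Rightarrow> complex" where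
  "L2_inner f g = (LINT x|lborel. f x * cnj (g x))"

text \<open>
  The distance is a nonnegative integral, so that a non-square-integrable difference counts
  as infinite rather than zero.
\<close>

definition L2_tendsto ::
  "('i \<Rightarrow> 'a::euclidean_space \<Rightarrow> complex) \<Rightarrow> ('a \<Rightarrow> complex) \<Rightarrow> 'i filter \<Rightarrow> bool" where
  "L2_tendsto fs f F \<longleftrightarrow>
     ((\<lambda>i. \<integral>\<^sup>+x. ennreal ((cmod (fs i x - f x))\<^sup>2) \<partial>lborel) \<longlongrightarrow> 0) F"

definition fourier_integral :: "('a::euclidean_space \<Rightarrow> complex) \<Rightarrow> 'a \<Rightarrow> complex" where
  "fourier_integral f \<xi> = (LINT x|lborel. f x * cis (- 2 * pi * (\<xi> \<bullet> x)))"

text \<open>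
  Extension of the Fourier integral from \<open>L\<^sup>1 \<inter> L\<^sup>2\<close> to \<open>L\<^sup>2\<close> by \<open>L\<^sup>2\<close>-continuity. The result is
  a representative, determined up to a null set.
\<close>

definition fourier :: "('a::euclidean_space \<Rightarrow> complex) \<Rightarrow> 'a \<Rightarrow> complex" where
  "fourier f = (SOME h. h \<in> L2 \<and>
     (\<exists>fs :: nat \<Rightarrow> 'a \<Rightarrow> complex.
        (\<forall>n. fs n \<in> L2 \<and> integrable lborel (fs n)) \<and>
        L2_tendsto fs f sequentially \<and>
        L2_tendsto (\<lambda>n. fourier_integral (fs n)) h sequentially))"

definition inv_fourier :: "('a::euclidean_space \<Rightarrow> complex) \<Rightarrow> 'a \<Rightarrow> complex" where
  "inv_fourier h = (SOME f. f \<in> L2 \<and> (AE \<xi> in lborel. fourier f \<xi> = h \<xi>))"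

text \<open>
  Convolution on \<open>L\<^sup>2\<close> by a kernel \<open>K \<in> L\<^sup>2\<close> with bounded Fourier transform, understood as the
  Fourier multiplier with symbol \<open>fourier K\<close>.
\<close>

definition conv :: "('a::euclidean_space \<Rightarrow> complex) \<Rightarrow> ('a \<Rightarrow> complex) \<Rightarrow> 'a \<Rightarrow> complex" where
  "conv F K = inv_fourier (\<lambda>\<xi>. fourier K \<xi> * fourier F \<xi>)"

text \<open>Support of an almost-everywhere class, independent of the representative.\<close>

definition ess_support :: "('a::euclidean_space \<Rightarrow> complex) \<Rightarrow> 'a set" where
  "ess_support f = - \<Union>{U. open U \<and> (AE x in lborel. x \<in> U \<longrightarrow> f x = 0)}"

definition supp :: "('a::euclidean_space \<Rightarrow> complex) \<Rightarrow> 'a set" where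
  "supp f = closure (support_on UNIV f)"

primrec C_k :: "nat \<Rightarrow> ('a::euclidean_space \<Rightarrow> complex) \<Rightarrow> bool" where
  "C_k 0 f \<longleftrightarrow> continuous_on UNIV f"
| "C_k (Suc k) f \<longleftrightarrow>
     (\<forall>x. f differentiable (at x)) \<and> (\<forall>v. C_k k (\<lambda>x. frechet_derivative f (at x) v))"

definition test_functions :: "('a::euclidean_space \<Rightarrow> complex) set" where
  "test_functions = {f. (\<forall>k. C_k k f) \<and> compact (supp f)}"

definition translate :: "'a::euclidean_space \<Rightarrow> ('a \<Rightarrow> complex) \<Rightarrow> 'a \<Rightarrow> complex" where
  "translate \<mu> F z = F (z - \<mu>)"

definition tf_shift ::
  "(real^'d) \<times> (real^'d) \<Rightarrow> (real^'d \<Rightarrow> complex) \<Rightarrow> real^'d \<Rightarrow> complex" where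
  "tf_shift z f t = cis (2 * pi * (snd z \<bullet> t)) * f (t - fst z)"

definition stft ::
  "(real^'d \<Rightarrow> complex) \<Rightarrow> (real^'d \<Rightarrow> complex) \<Rightarrow> (real^'d) \<times> (real^'d) \<Rightarrow> complex" where
  "stft g f = (\<lambda>(x, \<xi>). LINT t|lborel. f t * cnj (g (t - x)) * cis (- 2 * pi * (\<xi> \<bullet> t)))"

definition rotate_U ::
  "((real^'d) \<times> (real^'d) \<Rightarrow> complex) \<Rightarrow> (real^'d) \<times> (real^'d) \<Rightarrow> complex" where
  "rotate_U F = (\<lambda>(\<xi>, x). F (- x, \<xi>))"

definition rihaczek ::
  "(real^'d \<Rightarrow> complex) \<Rightarrow> (real^'d \<Rightarrow> complex) \<Rightarrow> (real^'d) \<times> (real^'d) \<Rightarrow> complex" where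
  "rihaczek f g = (\<lambda>(x, \<xi>). f x * cnj (fourier g \<xi>) * cis (- 2 * pi * (x \<bullet> \<xi>)))"

text \<open>The Kohn--Nirenberg operator of a symbol \<open>\<sigma> \<in> L\<^sup>2\<close>, defined weakly on \<open>L\<^sup>2\<close>.\<close>

definition kohn_nirenberg ::
  "((real^'d) \<times> (real^'d) \<Rightarrow> complex) \<Rightarrow> (real^'d \<Rightarrow> complex) \<Rightarrow> real^'d \<Rightarrow> complex" where
  "kohn_nirenberg \<sigma> f =
     (SOME h. h \<in> L2 \<and> (\<forall>u\<in>L2. L2_inner h u = L2_inner \<sigma> (rihaczek u f)))"

definition lattice :: "real \<Rightarrow> real \<Rightarrow> ((real^'d) \<times> (real^'d)) set" where
  "lattice a b = {z. (\<forall>j. \<exists>k::int. fst z $ j = a * of_int k) \<and>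
                     (\<forall>j. \<exists>l::int. snd z $ j = b * of_int l)}"

definition dual_cell :: "real \<Rightarrow> real \<Rightarrow> ((real^'d) \<times> (real^'d)) set" where
  "dual_cell a b = {z. (\<forall>j. fst z $ j \<in> {- 1 / (2 * a) .. 1 / (2 * a)}) \<and>
                       (\<forall>j. snd z $ j \<in> {- 1 / (2 * b) .. 1 / (2 * b)})}"

definition sinc_lattice :: "real \<Rightarrow> real \<Rightarrow> (real^'d) \<times> (real^'d) \<Rightarrow> complex" where
  "sinc_lattice a b z = complex_of_real
     ((\<Prod>j\<in>UNIV. sinc (pi * fst z $ j / a)) * (\<Prod>j\<in>UNIV. sinc (pi * snd z $ j / b)))"

text \<open>The quotient of \<open>\<phi>\<close> by the conjugate of \<open>\<U>V\<^sub>gg\<close>, set to \<open>0\<close> outside the support of \<open>\<phi>\<close>.\<close>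

definition quotient_symbol ::
  "((real^'d) \<times> (real^'d) \<Rightarrow> complex) \<Rightarrow> (real^'d \<Rightarrow> complex) \<Rightarrow>
   (real^'d) \<times> (real^'d) \<Rightarrow> complex" where
  "quotient_symbol \<phi> g \<zeta> =
     (if \<zeta> \<in> supp \<phi> then \<phi> \<zeta> / cnj (rotate_U (stft g g) \<zeta>) else 0)"

definition diag_coeff ::
  "((real^'d) \<times> (real^'d) \<Rightarrow> complex) \<Rightarrow> (real^'d \<Rightarrow> complex) \<Rightarrow>
   (real^'d) \<times> (real^'d) \<Rightarrow> complex" where
  "diag_coeff \<sigma> g \<mu> = L2_inner (kohn_nirenberg \<sigma> (tf_shift \<mu> g)) (tf_shift \<mu> g)"

end

theory Submission
  imports Defs "HOL-Probability.Characteristic_Functions"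
begin

text \<open>
  Write \<open>\<U>V\<close> for \<open>rotate_U (stft g g)\<close> and \<open>h\<close> for the Fourier transform of \<open>\<sigma>\<close>. The idea is that the
  numbers \<open>H\<^sub>\<mu> = diag_coeff \<sigma> g \<mu>\<close> are, up to normalisation, the Fourier coefficients on the cell
  \<open>Q = dual_cell a b\<close> of the function \<open>G = h \<cdot> cnj \<U>V\<close>. Indeed \<open>H\<^sub>\<mu>\<close> is the inner product of \<open>\<sigma>\<close> with
  the Rihaczek distribution of \<open>\<pi>(\<mu>)g\<close>, the Fourier transform of that distribution is \<open>\<U>V\<close> formed
  with \<open>\<pi>(\<mu>)g\<close> in place of \<open>g\<close>, and moving \<open>g\<close> by \<open>\<mu>\<close> only multiplies \<open>\<U>V\<close> by the character
  \<open>e\<^sub>\<mu>(\<zeta>) = cis (- 2\<pi> \<mu> \<bullet> \<zeta>)\<close>; so \<open>H\<^sub>\<mu>\<close> is the integral of \<open>G \<cdot> cnj e\<^sub>\<mu>\<close>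
  (\<open>rihaczek_pairing\<close>, \<open>rotate_stft_covariance\<close>, \<open>diag_coeff_integral\<close>).

  The characters \<open>e\<^sub>\<mu>\<close> form an orthogonal basis of \<open>L\<^sup>2(Q)\<close> (\<open>fourier_series_L2\<close>), hence
  \<open>\<Sum>\<^sub>\<mu> H\<^sub>\<mu> e\<^sub>\<mu> / |Q|\<close> converges to \<open>G\<close> in \<open>L\<^sup>2(Q)\<close>, irrespective of the order of summation. As
  \<open>cnj \<U>V\<close> is continuous and has no zero on the compact set \<open>Q\<close>, division by it is bounded, and
  \<open>\<Sum>\<^sub>\<mu> H\<^sub>\<mu> e\<^sub>\<mu> m\<close> converges to \<open>h\<close> in \<open>L\<^sup>2(Q)\<close>, where \<open>m = 1\<^sub>Q / (|Q| cnj \<U>V)\<close>. Because \<open>Q\<close> has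
  finite measure, the convergence holds in \<open>L\<^sup>1(Q)\<close> too. The inverse Fourier transform turns \<open>e\<^sub>\<mu> m\<close>
  into a translate by \<open>\<mu>\<close>; it is isometric on \<open>L\<^sup>2\<close>, which gives the convergence in \<open>L\<^sup>2\<close>, and it
  is contractive from \<open>L\<^sup>1\<close> to the supremum norm, which gives the uniform convergence
  (\<open>sampling_L2\<close>, \<open>sampling_uniform\<close>).

  It remains to see that the inverse transform of \<open>m\<close> is the kernel in the statement: the Fourier
  transform of \<open>sinc_lattice a b\<close> is \<open>1\<^sub>Q / |Q|\<close> (\<open>fourier_sinc_lattice\<close>), that of \<open>K\<close> is the quotient
  symbol, and \<open>\<phi> = 1\<close> on \<open>Q\<close>, so the product of the two is \<open>m\<close>.

  The \<open>L\<^sup>2\<close> theory of the Fourier transform is developed from the definitions. Plancherel's identity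
  on \<open>L\<^sup>1 \<inter> L\<^sup>2\<close> follows by pairing the squared modulus of the transform, which is the transform of an
  autocorrelation, with widening Gaussians (\<open>plancherel_integral\<close>); it extends to \<open>L\<^sup>2\<close> by
  completeness (\<open>L2_complete\<close>), and inversion is a Hilbert space argument from isometry and the
  adjoint relation (\<open>fourier_inversion\<close>).
\<close>


section \<open>The Hilbert space of square-integrable functions\<close>

lemma borel_measurable_cnj [measurable (raw)]:
  "f \<in> borel_measurable M \<Longrightarrow> (\<lambda>x. cnj (f x)) \<in> borel_measurable M"
  by (rule borel_measurable_continuous_on) (intro continuous_intros)

definition l2norm :: "('a::euclidean_space \<Rightarrow> complex) \<Rightarrow> real" where
  "l2norm f = sqrt (LINT x|lborel. (cmod (f x))\<^sup>2)"

lemma L2_I: "f \<in> borel_measurable lborel \<Longrightarrow> integrable lborel (\<lambda>x. (cmod (f x))\<^sup>2) \<Longrightarrow> f \<in> L2"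
  by (simp add: L2_def)

lemma L2_measurable [measurable_dest]: "f \<in> L2 \<Longrightarrow> f \<in> borel_measurable lborel"
  by (simp add: L2_def)

lemma L2_square_integrable: "f \<in> L2 \<Longrightarrow> integrable lborel (\<lambda>x. (cmod (f x))\<^sup>2)"
  by (simp add: L2_def)

lemma l2norm_nonneg [simp]: "0 \<le> l2norm f"
  by (simp add: l2norm_def)

lemma l2norm_power2: "(l2norm f)\<^sup>2 = (LINT x|lborel. (cmod (f x))\<^sup>2)"
  by (simp add: l2norm_def)

lemma L2_dominated:
  assumes "f \<in> L2" "h \<in> borel_measurable lborel" "\<And>x. cmod (h x) \<le> C * cmod (f x)"
  shows "h \<in> L2"
proof (rule L2_I)
  have "(cmod (h x))\<^sup>2 \<le> C\<^sup>2 * (cmod (f x))\<^sup>2" for x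
    using power_mono[OF assms(3), of x 2] by (simp add: power_mult_distrib)
  then show "integrable lborel (\<lambda>x. (cmod (h x))\<^sup>2)"
    using assms(2) L2_square_integrable[OF assms(1)]
    by - (rule Bochner_Integration.integrable_bound[where f="\<lambda>x. C\<^sup>2 * (cmod (f x))\<^sup>2"], auto simp: norm_mult)
qed (use assms in auto)

lemma L2_zero [simp]: "(\<lambda>x. 0) \<in> L2"
  by (simp add: L2_def)

lemma L2_add:
  assumes f: "f \<in> L2" and g: "g \<in> L2"
  shows "(\<lambda>x. f x + g x) \<in> L2"
proof (rule L2_I)
  note [measurable] = L2_measurable[OF f] L2_measurable[OF g]
  show "(\<lambda>x. f x + g x) \<in> borel_measurable lborel" by simp
  have "(cmod (f x + g x))\<^sup>2 \<le> 2 * (cmod (f x))\<^sup>2 + 2 * (cmod (g x))\<^sup>2" for x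
  proof -
    have "(cmod (f x + g x))\<^sup>2 \<le> (cmod (f x) + cmod (g x))\<^sup>2"
      by (intro power_mono norm_triangle_ineq) auto
    also have "\<dots> \<le> 2 * (cmod (f x))\<^sup>2 + 2 * (cmod (g x))\<^sup>2"
      using sum_squares_bound[of "cmod (f x)" "cmod (g x)"] by (simp add: power2_sum)
    finally show ?thesis .
  qed
  then show "integrable lborel (\<lambda>x. (cmod (f x + g x))\<^sup>2)"
    using L2_square_integrable[OF f] L2_square_integrable[OF g]
    by - (rule Bochner_Integration.integrable_bound[where f="\<lambda>x. 2 * (cmod (f x))\<^sup>2 + 2 * (cmod (g x))\<^sup>2"], auto simp: norm_mult)
qed

lemma L2_cmult: "f \<in> L2 \<Longrightarrow> (\<lambda>x. c * f x) \<in> L2"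
  by (rule L2_dominated[where C="cmod c"]) (auto simp: norm_mult dest: L2_measurable)

lemma L2_cnj: "f \<in> L2 \<Longrightarrow> (\<lambda>x. cnj (f x)) \<in> L2"
  by (rule L2_dominated[where C=1]) (auto dest!: L2_measurable)

lemma L2_diff: "f \<in> L2 \<Longrightarrow> g \<in> L2 \<Longrightarrow> (\<lambda>x. f x - g x) \<in> L2"
  using L2_add[of f "\<lambda>x. (-1) * g x"] L2_cmult[of g "-1"] by simp

lemma L2_sum: "(\<And>i. i \<in> I \<Longrightarrow> f i \<in> L2) \<Longrightarrow> (\<lambda>x. \<Sum>i\<in>I. f i x) \<in> L2"
  by (induction I rule: infinite_finite_induct) (auto intro: L2_add)

lemma L2_bounded_mult:
  assumes "f \<in> L2" "m \<in> borel_measurable lborel" "\<And>x. cmod (m x) \<le> C"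
  shows "(\<lambda>x. m x * f x) \<in> L2"
  using assms L2_measurable[OF assms(1)]
  by (intro L2_dominated[OF assms(1), where C=C]) (auto simp: norm_mult intro!: mult_right_mono)

lemma L2_mult_integrable:
  assumes f: "f \<in> L2" and g: "g \<in> L2"
  shows "integrable lborel (\<lambda>x. f x * g x)"
proof -
  note [measurable] = L2_measurable[OF f] L2_measurable[OF g]
  have "cmod (f x) * cmod (g x) \<le> (cmod (f x))\<^sup>2 + (cmod (g x))\<^sup>2" for x
  proof -
    have "2 * (cmod (f x) * cmod (g x)) \<le> (cmod (f x))\<^sup>2 + (cmod (g x))\<^sup>2"
      using sum_squares_bound[of "cmod (f x)" "cmod (g x)"] by simp
    moreover have "0 \<le> cmod (f x) * cmod (g x)" by simp
    ultimately show ?thesis by linarith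
  qed
  then show ?thesis
    using L2_square_integrable[OF f] L2_square_integrable[OF g]
    by - (rule Bochner_Integration.integrable_bound[where f="\<lambda>x. (cmod (f x))\<^sup>2 + (cmod (g x))\<^sup>2"], auto simp: norm_mult)
qed

lemma L2_inner_integrable: "f \<in> L2 \<Longrightarrow> g \<in> L2 \<Longrightarrow> integrable lborel (\<lambda>x. f x * cnj (g x))"
  by (intro L2_mult_integrable L2_cnj)

text \<open>
  The inequality is stated with the moduli inside the integral. This stronger form also bounds
  \<open>L\<^sup>1\<close> norms of products, which is how \<open>L\<^sup>2\<close> convergence on a bounded set is later turned into
  uniform convergence after an inverse Fourier transform.
\<close>

lemma cauchy_schwarz_norm:
  assumes f: "f \<in> L2" and g: "g \<in> L2"
  shows "(LINT x|lborel. cmod (f x) * cmod (g x)) \<le> l2norm f * l2norm g"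
proof -
  note [measurable] = L2_measurable[OF f] L2_measurable[OF g]
  have int: "integrable lborel (\<lambda>x. cmod (f x) * cmod (g x))"
    using integrable_norm[OF L2_mult_integrable[OF f g]] by (simp add: norm_mult)
  have "ennreal ((LINT x|lborel. cmod (f x) * cmod (g x))\<^sup>2)
      = (\<integral>\<^sup>+x. ennreal (cmod (f x)) * ennreal (cmod (g x)) \<partial>lborel)\<^sup>2"
    using int by (simp add: nn_integral_eq_integral ennreal_power flip: ennreal_mult)
  also have "\<dots> \<le> (\<integral>\<^sup>+x. (ennreal (cmod (f x)))\<^sup>2 \<partial>lborel) * (\<integral>\<^sup>+x. (ennreal (cmod (g x)))\<^sup>2 \<partial>lborel)"
    by (rule Cauchy_Schwarz_nn_integral) measurable
  also have "\<dots> = ennreal ((l2norm f)\<^sup>2 * (l2norm g)\<^sup>2)"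
    using L2_square_integrable[OF f] L2_square_integrable[OF g]
    by (simp add: ennreal_power nn_integral_eq_integral l2norm_power2 ennreal_mult)
  finally have "(LINT x|lborel. cmod (f x) * cmod (g x))\<^sup>2 \<le> (l2norm f * l2norm g)\<^sup>2"
    by (simp add: power_mult_distrib)
  then show ?thesis by (rule power2_le_imp_le) simp
qed

lemma cauchy_schwarz:
  assumes "f \<in> L2" "g \<in> L2"
  shows "cmod (L2_inner f g) \<le> l2norm f * l2norm g"
proof -
  have "cmod (L2_inner f g) \<le> (LINT x|lborel. cmod (f x * cnj (g x)))"
    unfolding L2_inner_def by (rule integral_norm_bound)
  also have "\<dots> \<le> l2norm f * l2norm g"
    using cauchy_schwarz_norm[OF assms] by (simp add: norm_mult)
  finally show ?thesis .
qed

lemma L2_inner_self: "L2_inner f f = complex_of_real ((l2norm f)\<^sup>2)"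
  unfolding L2_inner_def l2norm_power2 complex_norm_square[symmetric] by (rule integral_complex_of_real)

lemma L2_inner_cnj: "cnj (L2_inner f g) = L2_inner g f"
  unfolding L2_inner_def by (subst Bochner_Integration.integral_cnj[symmetric]) (simp add: mult.commute)

lemma L2_inner_diff_left:
  "f \<in> L2 \<Longrightarrow> g \<in> L2 \<Longrightarrow> h \<in> L2 \<Longrightarrow> L2_inner (\<lambda>x. f x - g x) h = L2_inner f h - L2_inner g h"
  unfolding L2_inner_def
  by (simp add: left_diff_distrib L2_inner_integrable Bochner_Integration.integral_diff)

lemma L2_inner_diff_right:
  "f \<in> L2 \<Longrightarrow> g \<in> L2 \<Longrightarrow> h \<in> L2 \<Longrightarrow> L2_inner h (\<lambda>x. f x - g x) = L2_inner h f - L2_inner h g"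
  unfolding L2_inner_def
  by (simp add: right_diff_distrib L2_inner_integrable Bochner_Integration.integral_diff)

lemma L2_inner_sum_left:
  "(\<And>i. i \<in> I \<Longrightarrow> f i \<in> L2) \<Longrightarrow> h \<in> L2 \<Longrightarrow>
   L2_inner (\<lambda>x. \<Sum>i\<in>I. f i x) h = (\<Sum>i\<in>I. L2_inner (f i) h)"
  unfolding L2_inner_def
  by (simp add: sum_distrib_right L2_inner_integrable Bochner_Integration.integral_sum)

lemma L2_inner_cmult_left: "L2_inner (\<lambda>x. c * f x) h = c * L2_inner f h"
  unfolding L2_inner_def by (simp add: mult.assoc)

lemma L2_inner_AE_cong:
  assumes "AE x in lborel. f x = f' x" "AE x in lborel. g x = g' x"
    "f \<in> borel_measurable lborel" "f' \<in> borel_measurable lborel"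
    "g \<in> borel_measurable lborel" "g' \<in> borel_measurable lborel"
  shows "L2_inner f g = L2_inner f' g'"
  unfolding L2_inner_def
proof (rule integral_cong_AE)
  show "AE x in lborel. f x * cnj (g x) = f' x * cnj (g' x)"
    using assms(1,2) by eventually_elim simp
qed (use assms in measurable)

lemma l2norm_diff_square:
  assumes f: "f \<in> L2" and g: "g \<in> L2"
  shows "(l2norm (\<lambda>x. f x - g x))\<^sup>2 = (l2norm f)\<^sup>2 - 2 * Re (L2_inner f g) + (l2norm g)\<^sup>2"
proof -
  have "complex_of_real ((l2norm (\<lambda>x. f x - g x))\<^sup>2)
      = L2_inner f f - L2_inner g f - (L2_inner f g - L2_inner g g)"
    using assms unfolding L2_inner_self[symmetric]
    by (simp add: L2_inner_diff_left L2_inner_diff_right L2_diff)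
  moreover have "L2_inner g f = cnj (L2_inner f g)" by (simp add: L2_inner_cnj)
  ultimately have "complex_of_real ((l2norm (\<lambda>x. f x - g x))\<^sup>2)
      = complex_of_real ((l2norm f)\<^sup>2) - (L2_inner f g + cnj (L2_inner f g)) + complex_of_real ((l2norm g)\<^sup>2)"
    by (simp add: L2_inner_self)
  then show ?thesis
    unfolding complex_add_cnj by (metis (no_types, lifting) of_real_add of_real_diff of_real_eq_iff)
qed

lemma l2norm_cmult: "l2norm (\<lambda>x. c * f x) = cmod c * l2norm f"
  by (simp add: l2norm_def norm_mult power_mult_distrib real_sqrt_mult)

lemma l2norm_uminus: "l2norm (\<lambda>x. - f x) = l2norm f"
  by (simp add: l2norm_def)

lemma l2norm_minus_commute: "l2norm (\<lambda>x. f x - g x) = l2norm (\<lambda>x. g x - f x)"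
  by (simp add: l2norm_def norm_minus_commute)

lemma l2norm_triangle_diff:
  assumes f: "f \<in> L2" and g: "g \<in> L2"
  shows "l2norm (\<lambda>x. f x - g x) \<le> l2norm f + l2norm g"
proof (rule power2_le_imp_le)
  have "- Re (L2_inner f g) \<le> l2norm f * l2norm g"
    using cauchy_schwarz[OF assms] abs_Re_le_cmod[of "L2_inner f g"] by linarith
  then show "(l2norm (\<lambda>x. f x - g x))\<^sup>2 \<le> (l2norm f + l2norm g)\<^sup>2"
    by (simp add: l2norm_diff_square[OF assms] power2_sum)
qed simp

lemma l2norm_triangle:
  assumes f: "f \<in> L2" and g: "g \<in> L2"
  shows "l2norm (\<lambda>x. f x + g x) \<le> l2norm f + l2norm g"
  using l2norm_triangle_diff[OF f L2_cmult[OF g, of "-1"]] by (simp add: l2norm_uminus)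

lemma l2norm_triangle3:
  assumes "f \<in> L2" "g \<in> L2" "h \<in> L2"
  shows "l2norm (\<lambda>x. f x - h x) \<le> l2norm (\<lambda>x. f x - g x) + l2norm (\<lambda>x. g x - h x)"
  using l2norm_triangle[OF L2_diff[OF assms(1,2)] L2_diff[OF assms(2,3)]] by simp

lemma l2norm_dist_le:
  assumes "f \<in> L2" "g \<in> L2"
  shows "\<bar>l2norm f - l2norm g\<bar> \<le> l2norm (\<lambda>x. f x - g x)"
  using l2norm_triangle[OF L2_diff[OF assms] assms(2)]
    l2norm_triangle[OF L2_diff[OF assms(2,1)] assms(1)]
  by (simp add: l2norm_minus_commute[of g f] abs_le_iff)

lemma l2norm_AE_cong:
  assumes "AE x in lborel. f x = g x" "f \<in> borel_measurable lborel" "g \<in> borel_measurable lborel"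
  shows "l2norm f = l2norm g"
proof -
  have "(LINT x|lborel. (cmod (f x))\<^sup>2) = (LINT x|lborel. (cmod (g x))\<^sup>2)"
    by (rule integral_cong_AE) (use assms in auto)
  then show ?thesis by (simp add: l2norm_def)
qed

lemma l2norm_mono:
  assumes "g \<in> L2" "f \<in> borel_measurable lborel" "\<And>x. cmod (f x) \<le> C * cmod (g x)" "0 \<le> C"
  shows "l2norm f \<le> C * l2norm g"
proof -
  have f: "f \<in> L2" using L2_dominated assms by blast
  have "(l2norm f)\<^sup>2 \<le> (LINT x|lborel. C\<^sup>2 * (cmod (g x))\<^sup>2)"
    unfolding l2norm_power2
    using L2_square_integrable[OF f] L2_square_integrable[OF assms(1)]
      power_mono[OF assms(3), where n=2]
    by (intro integral_mono) (auto simp: power_mult_distrib)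
  also have "\<dots> = (C * l2norm g)\<^sup>2"
    by (simp add: power_mult_distrib l2norm_power2)
  finally show ?thesis by (rule power2_le_imp_le) (simp add: assms)
qed

lemma l2norm_eq_0:
  assumes "f \<in> L2" "l2norm f = 0"
  shows "AE x in lborel. f x = 0"
proof -
  have "(LINT x|lborel. (cmod (f x))\<^sup>2) = 0"
    using assms(2) by (simp add: l2norm_def)
  then have "AE x in lborel. (cmod (f x))\<^sup>2 = 0"
    using integral_nonneg_eq_0_iff_AE[OF L2_square_integrable[OF assms(1)]] by simp
  then show ?thesis by simp
qed

lemma l2norm_diff_eq_0:
  assumes "f \<in> L2" "g \<in> L2" "l2norm (\<lambda>x. f x - g x) = 0"
  shows "AE x in lborel. f x = g x"
  using l2norm_eq_0[OF L2_diff[OF assms(1,2)] assms(3)] by simp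

lemma nn_integral_l2norm:
  "f \<in> L2 \<Longrightarrow> (\<integral>\<^sup>+x. ennreal ((cmod (f x))\<^sup>2) \<partial>lborel) = ennreal ((l2norm f)\<^sup>2)"
  by (simp add: nn_integral_eq_integral L2_square_integrable l2norm_power2)

lemma L2_I_nn_integral:
  assumes "f \<in> borel_measurable lborel"
    "(\<integral>\<^sup>+x. ennreal ((cmod (f x))\<^sup>2) \<partial>lborel) \<le> ennreal c"
  shows "f \<in> L2"
proof (rule L2_I)
  show "integrable lborel (\<lambda>x. (cmod (f x))\<^sup>2)"
    using assms by (intro integrableI_bounded) (auto intro: le_less_trans)
qed (rule assms)

text \<open>
  On members of \<open>L2\<close> the extended nonnegative distance used in \<open>L2_tendsto\<close> is finite, so limits can
  be computed with the real-valued \<open>l2norm\<close>.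
\<close>

lemma L2_tendsto_iff:
  assumes "\<And>i. fs i \<in> L2" "f \<in> L2"
  shows "L2_tendsto fs f F \<longleftrightarrow> ((\<lambda>i. l2norm (\<lambda>x. fs i x - f x)) \<longlongrightarrow> 0) F"
proof -
  have "L2_tendsto fs f F \<longleftrightarrow> ((\<lambda>i. ennreal ((l2norm (\<lambda>x. fs i x - f x))\<^sup>2)) \<longlongrightarrow> ennreal 0) F"
    using assms by (simp add: L2_tendsto_def nn_integral_l2norm L2_diff)
  also have "\<dots> \<longleftrightarrow> ((\<lambda>i. (l2norm (\<lambda>x. fs i x - f x))\<^sup>2) \<longlongrightarrow> 0) F"
    by (rule tendsto_ennreal_iff) auto
  also have "\<dots> \<longleftrightarrow> ((\<lambda>i. l2norm (\<lambda>x. fs i x - f x)) \<longlongrightarrow> 0) F"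
  proof
    assume "((\<lambda>i. (l2norm (\<lambda>x. fs i x - f x))\<^sup>2) \<longlongrightarrow> 0) F"
    then have "((\<lambda>i. sqrt ((l2norm (\<lambda>x. fs i x - f x))\<^sup>2)) \<longlongrightarrow> sqrt 0) F"
      by (rule tendsto_real_sqrt)
    then show "((\<lambda>i. l2norm (\<lambda>x. fs i x - f x)) \<longlongrightarrow> 0) F" by simp
  next
    assume "((\<lambda>i. l2norm (\<lambda>x. fs i x - f x)) \<longlongrightarrow> 0) F"
    then show "((\<lambda>i. (l2norm (\<lambda>x. fs i x - f x))\<^sup>2) \<longlongrightarrow> 0) F"
      by (rule tendsto_null_power) simp
  qed
  finally show ?thesis .
qed

lemma L2_tendsto_unique:
  assumes lim: "((\<lambda>n. l2norm (\<lambda>x. fs n x - f x)) \<longlongrightarrow> 0) F"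
      "((\<lambda>n. l2norm (\<lambda>x. gs n x - g x)) \<longlongrightarrow> 0) F"
      "((\<lambda>n. l2norm (\<lambda>x. fs n x - gs n x)) \<longlongrightarrow> 0) F"
    and F: "F \<noteq> bot"
    and mem: "\<And>n. fs n \<in> L2" "\<And>n. gs n \<in> L2" "f \<in> L2" "g \<in> L2"
  shows "AE x in lborel. f x = g x"
proof -
  have "l2norm (\<lambda>x. f x - g x) \<le> l2norm (\<lambda>x. fs n x - f x) + l2norm (\<lambda>x. fs n x - gs n x)
      + l2norm (\<lambda>x. gs n x - g x)" for n
    using l2norm_triangle3[OF mem(3) mem(1) mem(4), of n] l2norm_triangle3[OF mem(1) mem(2) mem(4), of n n]
    by (simp add: l2norm_minus_commute[of f])
  then have "l2norm (\<lambda>x. f x - g x) \<le> 0 + 0 + 0"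
    by (intro tendsto_le[OF F tendsto_add[OF tendsto_add[OF lim(1) lim(3)] lim(2)] tendsto_const]) auto
  then show ?thesis
    by (intro l2norm_diff_eq_0 mem) (simp add: order.antisym)
qed

lemma l2norm_tendsto:
  assumes "((\<lambda>n. l2norm (\<lambda>x. fs n x - f x)) \<longlongrightarrow> 0) F" "\<And>n. fs n \<in> L2" "f \<in> L2"
  shows "((\<lambda>n. l2norm (fs n)) \<longlongrightarrow> l2norm f) F"
proof (rule Lim_null[THEN iffD2], rule Lim_null_comparison[OF _ assms(1)])
  show "\<forall>\<^sub>F n in F. norm (l2norm (fs n) - l2norm f) \<le> l2norm (\<lambda>x. fs n x - f x)"
    using l2norm_dist_le[OF assms(2,3)] by simp
qed

lemma L2_inner_tendsto:
  assumes f: "((\<lambda>n. l2norm (\<lambda>x. fs n x - f x)) \<longlongrightarrow> 0) F" "\<And>n. fs n \<in> L2" "f \<in> L2"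
    and g: "((\<lambda>n. l2norm (\<lambda>x. gs n x - g x)) \<longlongrightarrow> 0) F" "\<And>n. gs n \<in> L2" "g \<in> L2"
  shows "((\<lambda>n. L2_inner (fs n) (gs n)) \<longlongrightarrow> L2_inner f g) F"
proof (rule Lim_null[THEN iffD2], rule Lim_null_comparison)
  show "((\<lambda>n. l2norm (\<lambda>x. fs n x - f x) * l2norm (gs n) + l2norm f * l2norm (\<lambda>x. gs n x - g x)) \<longlongrightarrow> 0) F"
    using tendsto_add[OF tendsto_mult[OF f(1) l2norm_tendsto[OF g]] tendsto_mult[OF tendsto_const g(1), of "l2norm f"]]
    by simp
  have *: "norm (L2_inner (fs n) (gs n) - L2_inner f g)
      \<le> l2norm (\<lambda>x. fs n x - f x) * l2norm (gs n) + l2norm f * l2norm (\<lambda>x. gs n x - g x)" for n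
  proof -
    have eq: "L2_inner (fs n) (gs n) - L2_inner f g
      = L2_inner (\<lambda>x. fs n x - f x) (gs n) + L2_inner f (\<lambda>x. gs n x - g x)"
      using f g by (simp add: L2_inner_diff_left L2_inner_diff_right)
    moreover have "cmod (L2_inner (\<lambda>x. fs n x - f x) (gs n)) \<le> l2norm (\<lambda>x. fs n x - f x) * l2norm (gs n)"
      using f g by (intro cauchy_schwarz L2_diff)
    moreover have "cmod (L2_inner f (\<lambda>x. gs n x - g x)) \<le> l2norm f * l2norm (\<lambda>x. gs n x - g x)"
      using f g by (intro cauchy_schwarz L2_diff)
    ultimately show ?thesis
      unfolding eq using norm_triangle_ineq[of "L2_inner (\<lambda>x. fs n x - f x) (gs n)" "L2_inner f (\<lambda>x. gs n x - g x)"]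
      by linarith
  qed
  show "\<forall>\<^sub>F n in F. norm (L2_inner (fs n) (gs n) - L2_inner f g)
      \<le> l2norm (\<lambda>x. fs n x - f x) * l2norm (gs n) + l2norm f * l2norm (\<lambda>x. gs n x - g x)"
    using * by (intro always_eventually allI)
qed

lemma L2_dominated_convergence:
  assumes f: "f \<in> L2" and w: "w \<in> L2"
    and meas: "\<And>n. fs n \<in> borel_measurable lborel"
    and lim: "AE x in lborel. (\<lambda>n. fs n x) \<longlonglongrightarrow> f x"
    and bound: "\<And>n x. cmod (fs n x) \<le> cmod (w x)"
  shows "(\<lambda>n. l2norm (\<lambda>x. fs n x - f x)) \<longlonglongrightarrow> 0"
proof -
  note [measurable] = L2_measurable[OF f] L2_measurable[OF w] meas
  have "(\<lambda>n. LINT x|lborel. (cmod (fs n x - f x))\<^sup>2) \<longlonglongrightarrow> (LINT x|(lborel::'a measure). (0::real))"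
  proof (rule integral_dominated_convergence[where w="\<lambda>x. 2 * (cmod (w x))\<^sup>2 + 2 * (cmod (f x))\<^sup>2"])
    show "integrable lborel (\<lambda>x. 2 * (cmod (w x))\<^sup>2 + 2 * (cmod (f x))\<^sup>2)"
      using L2_square_integrable[OF f] L2_square_integrable[OF w] by simp
    show "AE x in lborel. (\<lambda>n. (cmod (fs n x - f x))\<^sup>2) \<longlonglongrightarrow> 0"
      using lim
    proof eventually_elim
      case (elim x)
      then have "(\<lambda>n. (cmod (fs n x - f x))\<^sup>2) \<longlonglongrightarrow> (cmod (f x - f x))\<^sup>2"
        by (intro tendsto_intros)
      then show ?case by simp
    qed
    fix n
    show "AE x in lborel. norm ((cmod (fs n x - f x))\<^sup>2) \<le> 2 * (cmod (w x))\<^sup>2 + 2 * (cmod (f x))\<^sup>2"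
    proof (rule AE_I2)
      fix x
      have "(cmod (fs n x - f x))\<^sup>2 \<le> (cmod (w x) + cmod (f x))\<^sup>2"
        using norm_triangle_ineq4[of "fs n x" "f x"] bound[of n x] by (intro power_mono) auto
      also have "\<dots> \<le> 2 * (cmod (w x))\<^sup>2 + 2 * (cmod (f x))\<^sup>2"
        using sum_squares_bound[of "cmod (w x)" "cmod (f x)"] by (simp add: power2_sum)
      finally show "norm ((cmod (fs n x - f x))\<^sup>2) \<le> 2 * (cmod (w x))\<^sup>2 + 2 * (cmod (f x))\<^sup>2" by simp
    qed
  qed auto
  then have "(\<lambda>n. sqrt (LINT x|lborel. (cmod (fs n x - f x))\<^sup>2)) \<longlonglongrightarrow> sqrt 0"
    by (intro tendsto_real_sqrt) simp
  then show ?thesis by (simp add: l2norm_def)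
qed


text \<open>
  The Riesz--Fischer theorem. Along a subsequence \<open>F\<close> with increments below \<open>4\<^sup>-\<^sup>k\<close> the series
  \<open>\<Sum>\<^sub>k 4\<^sup>k |F\<^sub>k\<^sub>+\<^sub>1 - F\<^sub>k|\<^sup>2\<close> has finite integral, hence is finite almost everywhere. There the increments
  are of size \<open>O(2\<^sup>-\<^sup>k)\<close> and the subsequence converges pointwise. Fatou's lemma then bounds the
  distance from the whole sequence to the pointwise limit.
\<close>

theorem L2_complete:
  fixes fs :: "nat \<Rightarrow> 'a::euclidean_space \<Rightarrow> complex"
  assumes fs: "\<And>n. fs n \<in> L2"
    and cauchy: "\<And>e. e > 0 \<Longrightarrow> \<exists>N. \<forall>m\<ge>N. \<forall>n\<ge>N. l2norm (\<lambda>x. fs m x - fs n x) < e"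
  obtains h where "h \<in> L2" "(\<lambda>n. l2norm (\<lambda>x. fs n x - h x)) \<longlonglongrightarrow> 0"
proof -
  note [measurable] = L2_measurable[OF fs]
  have "\<forall>k. \<exists>N. \<forall>m\<ge>N. \<forall>n\<ge>N. l2norm (\<lambda>x. fs m x - fs n x) < (1/4)^k"
    using cauchy by simp
  then obtain N where N: "\<And>k m n. m \<ge> N k \<Longrightarrow> n \<ge> N k \<Longrightarrow> l2norm (\<lambda>x. fs m x - fs n x) < (1/4::real)^k"
    by metis
  \<comment> \<open>Any index sequence with \<open>r k \<ge> N i\<close> for all \<open>i \<le> k\<close> will do; the summand \<open>k\<close> makes it unbounded.\<close>
  define r where "r k = k + (\<Sum>i\<le>k. N i)" for k
  have rN: "N i \<le> r k" if "i \<le> k" for i k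
  proof -
    have "N i \<le> (\<Sum>i\<le>k. N i)" using that by (intro member_le_sum) auto
    then show ?thesis by (simp add: r_def)
  qed
  define F where "F k = fs (r k)" for k
  have F: "F k \<in> L2" for k by (simp add: F_def fs)
  note [measurable] = L2_measurable[OF F]
  define u where "u k x = ennreal (4^k * (cmod (F (Suc k) x - F k x))\<^sup>2)" for k x
  have int_u: "(\<integral>\<^sup>+x. u k x \<partial>lborel) \<le> ennreal ((1/4)^k)" for k
  proof -
    have "(\<integral>\<^sup>+x. u k x \<partial>lborel) = 4^k * (\<integral>\<^sup>+x. ennreal ((cmod (F (Suc k) x - F k x))\<^sup>2) \<partial>lborel)"
      unfolding u_def by (subst nn_integral_cmult[symmetric]) (simp_all add: ennreal_mult ennreal_power[symmetric])
    also have "\<dots> = ennreal (4^k * (l2norm (\<lambda>x. F (Suc k) x - F k x))\<^sup>2)"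
      unfolding nn_integral_l2norm[OF L2_diff[OF F F]] by (simp add: ennreal_mult flip: ennreal_power)
    also have "\<dots> \<le> ennreal (4^k * ((1/4)^k)\<^sup>2)"
      using N[of k "r (Suc k)" "r k"] rN[of k "Suc k"] rN[of k k]
      by (intro ennreal_leI mult_left_mono power_mono) (auto simp: F_def less_imp_le)
    also have "4^k * ((1/4)^k)\<^sup>2 = (1/4::real)^k"
      by (simp add: power2_eq_square power_divide)
    finally show ?thesis .
  qed
  have "(\<integral>\<^sup>+x. (\<Sum>k. u k x) \<partial>lborel) = (\<Sum>k. \<integral>\<^sup>+x. u k x \<partial>lborel)"
    by (rule nn_integral_suminf) (simp add: u_def)
  also have "\<dots> \<le> (\<Sum>k. ennreal ((1/4)^k))"
    by (intro suminf_le int_u summableI)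
  also have "\<dots> < top"
    by (subst suminf_ennreal2) (auto intro: summable_geometric)
  finally have "AE x in lborel. (\<Sum>k. u k x) \<noteq> \<infinity>"
    by (intro nn_integral_noteq_infinite) (auto simp: u_def)
  then have conv: "AE x in lborel. convergent (\<lambda>k. F k x)"
  proof eventually_elim
    case (elim x)
    define C where "C = enn2real (\<Sum>k. u k x)"
    have "u k x \<le> ennreal C" for k
    proof -
      have "u k x \<le> (\<Sum>k. u k x)"
        using sum_le_suminf[of "\<lambda>k. u k x" "{k}"] by (simp add: summableI)
      also have "\<dots> = ennreal C" using elim by (simp add: C_def less_top)
      finally show ?thesis .
    qed
    moreover have "0 \<le> C" by (simp add: C_def)
    ultimately have bound: "4^k * (cmod (F (Suc k) x - F k x))\<^sup>2 \<le> C" for k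
      by (simp add: u_def)
    have "norm (F (Suc k) x - F k x) \<le> sqrt C * (1/2)^k" for k
    proof -
      have "(2^k * cmod (F (Suc k) x - F k x))\<^sup>2 \<le> C"
        using bound[of k] by (simp add: power_mult_distrib power_even_eq[symmetric] power_mult[symmetric] mult.commute[of k 2] power_mult[of 2 2 k, simplified])
      then have "2^k * cmod (F (Suc k) x - F k x) \<le> sqrt C"
        by (rule real_le_rsqrt)
      then show ?thesis by (simp add: field_simps power_divide)
    qed
    then have "summable (\<lambda>k. F (Suc k) x - F k x)"
      by - (rule summable_comparison_test'[where g="\<lambda>k. sqrt C * (1/2)^k" and N=0], auto intro: summable_mult summable_geometric)
    then have "convergent (\<lambda>n. (\<Sum>k<n. F (Suc k) x - F k x) + F 0 x)"
      by (intro convergent_add convergent_const) (simp add: summable_iff_convergent)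
    moreover have "(\<lambda>n. (\<Sum>k<n. F (Suc k) x - F k x) + F 0 x) = (\<lambda>n. F n x)"
      using sum_lessThan_telescope[of "\<lambda>k. F k x"] by (intro ext) simp
    ultimately show ?case by simp
  qed
  define h where "h x = lim (\<lambda>k. F k x)" for x
  have [measurable]: "h \<in> borel_measurable lborel" unfolding h_def by measurable
  have lim: "AE x in lborel. (\<lambda>k. F k x) \<longlonglongrightarrow> h x"
    using conv by eventually_elim (simp add: h_def convergent_LIMSEQ_iff)
  have fatou: "(\<integral>\<^sup>+x. ennreal ((cmod (fs n x - h x))\<^sup>2) \<partial>lborel) \<le> ennreal (e\<^sup>2)"
    if e: "e > 0" and M: "\<forall>m\<ge>M. \<forall>n\<ge>M. l2norm (\<lambda>x. fs m x - fs n x) < e" and n: "n \<ge> M" for e M n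
  proof -
    have "(\<integral>\<^sup>+x. ennreal ((cmod (fs n x - h x))\<^sup>2) \<partial>lborel)
        = (\<integral>\<^sup>+x. liminf (\<lambda>k. ennreal ((cmod (fs n x - F k x))\<^sup>2)) \<partial>lborel)"
    proof (rule nn_integral_cong_AE)
      show "AE x in lborel. ennreal ((cmod (fs n x - h x))\<^sup>2) = liminf (\<lambda>k. ennreal ((cmod (fs n x - F k x))\<^sup>2))"
        using lim
      proof eventually_elim
        case (elim x)
        then have "(\<lambda>k. ennreal ((cmod (fs n x - F k x))\<^sup>2)) \<longlonglongrightarrow> ennreal ((cmod (fs n x - h x))\<^sup>2)"
          by (intro tendsto_intros)
        then show ?case by (intro lim_imp_Liminf[symmetric]) simp_all
      qed
    qed
    also have "\<dots> \<le> liminf (\<lambda>k. \<integral>\<^sup>+x. ennreal ((cmod (fs n x - F k x))\<^sup>2) \<partial>lborel)"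
      by (rule nn_integral_liminf) simp
    also have "\<dots> \<le> limsup (\<lambda>k. \<integral>\<^sup>+x. ennreal ((cmod (fs n x - F k x))\<^sup>2) \<partial>lborel)"
      by (rule Liminf_le_Limsup) simp
    also have "\<dots> \<le> ennreal (e\<^sup>2)"
    proof (rule Limsup_bounded)
      have "(\<integral>\<^sup>+x. ennreal ((cmod (fs n x - F k x))\<^sup>2) \<partial>lborel) \<le> ennreal (e\<^sup>2)" if "k \<ge> M" for k
      proof -
        have "M \<le> r k" using that by (simp add: r_def)
        then have "l2norm (\<lambda>x. fs n x - F k x) \<le> e" using M n by (simp add: F_def less_imp_le)
        then show ?thesis
          by (simp add: nn_integral_l2norm L2_diff fs F power_mono)
      qed
      then show "\<forall>\<^sub>F k in sequentially. (\<integral>\<^sup>+x. ennreal ((cmod (fs n x - F k x))\<^sup>2) \<partial>lborel) \<le> ennreal (e\<^sup>2)"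
        by (auto simp: eventually_sequentially)
    qed
    finally show ?thesis .
  qed
  obtain M1 where M1: "\<forall>m\<ge>M1. \<forall>n\<ge>M1. l2norm (\<lambda>x. fs m x - fs n x) < 1"
    using cauchy[of 1] by auto
  have "(\<lambda>x. fs M1 x - h x) \<in> L2"
    using fatou[OF _ M1, of M1] by (intro L2_I_nn_integral[where c=1]) auto
  then have h: "h \<in> L2"
    using L2_diff[OF fs[of M1]] by fastforce
  moreover have "(\<lambda>n. l2norm (\<lambda>x. fs n x - h x)) \<longlonglongrightarrow> 0"
  proof (rule LIMSEQ_I)
    fix e :: real assume "e > 0"
    then obtain M where M: "\<forall>m\<ge>M. \<forall>n\<ge>M. l2norm (\<lambda>x. fs m x - fs n x) < e/2"
      using cauchy[of "e/2"] by auto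
    have "norm (l2norm (\<lambda>x. fs n x - h x) - 0) < e" if "n \<ge> M" for n
    proof -
      have "(l2norm (\<lambda>x. fs n x - h x))\<^sup>2 \<le> (e/2)\<^sup>2"
        using fatou[OF _ M that] \<open>e > 0\<close> by (simp add: nn_integral_l2norm L2_diff fs h)
      then have "l2norm (\<lambda>x. fs n x - h x) \<le> e/2"
        by (rule power2_le_imp_le) (use \<open>e > 0\<close> in simp)
      then show ?thesis using \<open>e > 0\<close> by simp
    qed
    then show "\<exists>no. \<forall>n\<ge>no. norm (l2norm (\<lambda>x. fs n x - h x) - 0) < e" by blast
  qed
  ultimately show ?thesis by (rule that)
qed

lemma L2_indicator:
  assumes "A \<in> sets borel" "emeasure lborel A < top"
  shows "(\<lambda>x. indicator A x :: complex) \<in> L2"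
proof (rule L2_I)
  have "(\<lambda>x. (cmod (indicator A x))\<^sup>2) = (indicator A :: 'a \<Rightarrow> real)"
    by (auto split: split_indicator)
  then show "integrable lborel (\<lambda>x. (cmod (indicator A x))\<^sup>2)"
    using assms by (simp add: integrable_indicator_iff less_top)
qed (use assms in auto)

lemma l2norm_indicator:
  assumes "A \<in> sets borel" "emeasure lborel A < top"
  shows "(l2norm (\<lambda>x. indicator A x :: complex))\<^sup>2 = measure lborel A"
proof -
  have "(\<lambda>x. (cmod (indicator A x))\<^sup>2) = (indicator A :: 'a \<Rightarrow> real)"
    by (auto split: split_indicator)
  then show ?thesis unfolding l2norm_power2 using assms by simp
qed

lemma finite_measure_bounded: "bounded A \<Longrightarrow> emeasure lborel (A :: 'a::euclidean_space set) < top"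
  using emeasure_bounded_finite by auto

lemma bounded_imp_cball: "bounded S \<Longrightarrow> \<exists>R. S \<subseteq> cball (0 :: 'a::real_normed_vector) R"
  unfolding bounded_iff by (auto simp: subset_iff)

lemma L2_bounded_support:
  assumes "f \<in> borel_measurable lborel" "bounded {x. f x \<noteq> 0}" "\<And>x. cmod (f x) \<le> C"
  shows "f \<in> L2"
proof -
  obtain R where R: "{x. f x \<noteq> 0} \<subseteq> cball 0 R"
    using bounded_imp_cball[OF assms(2)] by blast
  have "C \<ge> 0" using assms(3)[of undefined] norm_ge_zero[of "f undefined"] by linarith
  show ?thesis
  proof (rule L2_dominated[OF L2_indicator[of "cball 0 R"] assms(1), of C])
    show "cmod (f x) \<le> C * cmod (indicator (cball 0 R) x)" for x
      using assms(3) R \<open>C \<ge> 0\<close> by (cases "f x = 0") (auto split: split_indicator)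
  qed (auto intro!: finite_measure_bounded)
qed

lemma L2_bounded_support_integrable:
  assumes f: "f \<in> L2" and b: "bounded {x. f x \<noteq> 0}"
  shows "integrable lborel f"
proof -
  obtain R where R: "{x. f x \<noteq> 0} \<subseteq> cball 0 R"
    using bounded_imp_cball[OF b] by blast
  have "integrable lborel (\<lambda>x. f x * indicator (cball 0 R) x)"
    by (intro L2_mult_integrable[OF f] L2_indicator) (auto intro!: finite_measure_bounded)
  also have "(\<lambda>x. f x * indicator (cball 0 R) x) = f"
    using R by (intro ext) (auto split: split_indicator)
  finally show ?thesis .
qed

definition truncate :: "nat \<Rightarrow> ('a::euclidean_space \<Rightarrow> complex) \<Rightarrow> 'a \<Rightarrow> complex" where
  "truncate n f x = indicator (cball 0 (real n)) x * f x"

lemma truncate_L2: "f \<in> L2 \<Longrightarrow> truncate n f \<in> L2"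
  unfolding truncate_def
  by (intro L2_bounded_mult[where C=1]) (auto simp: borel_measurable_indicator split: split_indicator)

lemma truncate_integrable: "f \<in> L2 \<Longrightarrow> integrable lborel (truncate n f)"
  by (rule L2_bounded_support_integrable, erule truncate_L2, rule bounded_subset[OF bounded_cball[of 0 "real n"]])
     (auto simp: truncate_def split: split_indicator)

lemma truncate_tendsto:
  assumes f: "f \<in> L2"
  shows "(\<lambda>n. l2norm (\<lambda>x. truncate n f x - f x)) \<longlonglongrightarrow> 0"
proof (rule L2_dominated_convergence[OF f f])
  show "truncate n f \<in> borel_measurable lborel" for n
    by (intro L2_measurable truncate_L2 f)
  show "AE x in lborel. (\<lambda>n. truncate n f x) \<longlonglongrightarrow> f x"
  proof (rule AE_I2)
    fix x :: 'a
    obtain N where "norm x \<le> real N" using real_arch_simple by blast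
    then have "\<forall>\<^sub>F n in sequentially. truncate n f x = f x"
      by (intro eventually_sequentiallyI[of N]) (auto simp: truncate_def)
    then show "(\<lambda>n. truncate n f x) \<longlonglongrightarrow> f x" by (rule tendsto_eventually)
  qed
qed (auto simp: truncate_def split: split_indicator)

lemma integrable_L2_dense:
  assumes "f \<in> L2"
  obtains fs where "\<And>n. fs n \<in> L2" "\<And>n. integrable lborel (fs n)"
    "(\<lambda>n. l2norm (\<lambda>x. fs n x - f x)) \<longlonglongrightarrow> 0"
  using that[of "\<lambda>n. truncate n f"] truncate_L2 truncate_integrable truncate_tendsto assms by blast

subsection \<open>Density of continuous functions\<close>

text \<open>
  Continuous functions that vanish off \<open>\<Omega>\<close> and have bounded support. The support may touch the
  boundary of \<open>\<Omega>\<close>: vanishing on the boundary is all that is needed to extend such a function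
  periodically when \<open>\<Omega>\<close> is an open box.
\<close>

definition continuous_in :: "'a::euclidean_space set \<Rightarrow> ('a \<Rightarrow> complex) set" where
  "continuous_in \<Omega> = {g. continuous_on UNIV g \<and> (\<forall>x. x \<notin> \<Omega> \<longrightarrow> g x = 0) \<and> bounded {x. g x \<noteq> 0}}"

lemma continuous_in_bounded:
  assumes "g \<in> continuous_in \<Omega>"
  obtains C where "\<And>x. cmod (g x) \<le> C" "0 \<le> C"
proof -
  obtain R where R: "{x. g x \<noteq> 0} \<subseteq> cball 0 R"
    using assms bounded_imp_cball[of "{x. g x \<noteq> 0}"] unfolding continuous_in_def by blast
  have "compact (g ` cball 0 R)"
    using assms by (intro compact_continuous_image) (auto simp: continuous_in_def intro: continuous_on_subset)
  then obtain C where C: "\<And>y. y \<in> g ` cball 0 R \<Longrightarrow> cmod y \<le> C"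
    using compact_imp_bounded[of "g ` cball 0 R"] bounded_iff[of "g ` cball 0 R"] by metis
  have "cmod (g x) \<le> max C 0" for x
    using C[of "g x"] R by (cases "g x = 0") auto
  then show ?thesis using that[of "max C 0"] by auto
qed

lemma continuous_in_L2: assumes "g \<in> continuous_in \<Omega>" shows "g \<in> L2"
proof -
  obtain C where "\<And>x. cmod (g x) \<le> C" using continuous_in_bounded[OF assms] by blast
  then show ?thesis
    using assms unfolding continuous_in_def
    by (intro L2_bounded_support[where C=C]) (auto intro: borel_measurable_continuous_onI)
qed

text \<open>
  The \<open>L\<^sup>2\<close>-closure of \<open>continuous_in \<Omega>\<close>. Density is proved by showing that this closure is a closed
  subspace and contains the indicators of bounded Borel subsets of \<open>\<Omega>\<close> when \<open>\<Omega>\<close> is open, then the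
  simple functions built from them, then every \<open>L\<^sup>2\<close> function vanishing off \<open>\<Omega>\<close>.
\<close>

definition continuous_approx :: "'a::euclidean_space set \<Rightarrow> ('a \<Rightarrow> complex) set" where
  "continuous_approx \<Omega> = {f\<in>L2. \<forall>e>0. \<exists>g\<in>continuous_in \<Omega>. l2norm (\<lambda>x. f x - g x) < e}"

lemma continuous_approx_zero: "(\<lambda>x. 0) \<in> continuous_approx \<Omega>"
proof -
  have "(\<lambda>x. 0) \<in> continuous_in \<Omega>" by (simp add: continuous_in_def)
  then show ?thesis unfolding continuous_approx_def
    by (auto intro!: bexI[of _ "\<lambda>x. 0"] simp: l2norm_def)
qed

lemma continuous_approx_add:
  assumes "f \<in> continuous_approx \<Omega>" "h \<in> continuous_approx \<Omega>"
  shows "(\<lambda>x. f x + h x) \<in> continuous_approx \<Omega>"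
  unfolding continuous_approx_def
proof (intro CollectI conjI allI impI)
  have fh: "f \<in> L2" "h \<in> L2" using assms by (auto simp: continuous_approx_def)
  then show "(\<lambda>x. f x + h x) \<in> L2" by (rule L2_add)
  fix e :: real assume "e > 0"
  then obtain g k where g: "g \<in> continuous_in \<Omega>" "l2norm (\<lambda>x. f x - g x) < e/2"
    and k: "k \<in> continuous_in \<Omega>" "l2norm (\<lambda>x. h x - k x) < e/2"
    using assms half_gt_zero[OF \<open>e > 0\<close>] unfolding continuous_approx_def by blast
  have "bounded {x. g x + k x \<noteq> 0}"
    by (rule bounded_subset[of "{x. g x \<noteq> 0} \<union> {x. k x \<noteq> 0}"]) (use g k in \<open>auto simp: continuous_in_def\<close>)
  then have gk: "(\<lambda>x. g x + k x) \<in> continuous_in \<Omega>"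
    using g k by (auto simp: continuous_in_def intro: continuous_intros)
  have "l2norm (\<lambda>x. f x + h x - (g x + k x)) \<le> l2norm (\<lambda>x. f x - g x) + l2norm (\<lambda>x. h x - k x)"
    using l2norm_triangle[OF L2_diff[OF fh(1) continuous_in_L2[OF g(1)]] L2_diff[OF fh(2) continuous_in_L2[OF k(1)]]]
    by (simp add: algebra_simps)
  then have "l2norm (\<lambda>x. f x + h x - (g x + k x)) < e"
    using g k by linarith
  then show "\<exists>g\<in>continuous_in \<Omega>. l2norm (\<lambda>x. f x + h x - g x) < e"
    by (intro bexI[OF _ gk]) simp
qed

lemma continuous_approx_cmult:
  assumes "f \<in> continuous_approx \<Omega>"
  shows "(\<lambda>x. c * f x) \<in> continuous_approx \<Omega>"
  unfolding continuous_approx_def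
proof (intro CollectI conjI allI impI)
  have f: "f \<in> L2" using assms by (auto simp: continuous_approx_def)
  then show "(\<lambda>x. c * f x) \<in> L2" by (rule L2_cmult)
  fix e :: real assume "e > 0"
  then have "e / (cmod c + 1) > 0"
    by (intro divide_pos_pos) (auto simp: add_nonneg_pos)
  then obtain g where g: "g \<in> continuous_in \<Omega>" "l2norm (\<lambda>x. f x - g x) < e / (cmod c + 1)"
    using assms unfolding continuous_approx_def by blast
  have "bounded {x. c * g x \<noteq> 0}"
    by (rule bounded_subset[of "{x. g x \<noteq> 0}"]) (use g in \<open>auto simp: continuous_in_def\<close>)
  then have cg: "(\<lambda>x. c * g x) \<in> continuous_in \<Omega>"
    using g by (auto simp: continuous_in_def intro: continuous_intros)
  have "l2norm (\<lambda>x. c * f x - c * g x) = cmod c * l2norm (\<lambda>x. f x - g x)"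
    using l2norm_cmult[of c "\<lambda>x. f x - g x"] by (simp add: right_diff_distrib)
  also have "\<dots> \<le> (cmod c + 1) * l2norm (\<lambda>x. f x - g x)"
    by (intro mult_right_mono) auto
  also have "\<dots> < e"
    using g(2) by (simp add: pos_less_divide_eq add_nonneg_pos mult.commute)
  finally show "\<exists>g\<in>continuous_in \<Omega>. l2norm (\<lambda>x. c * f x - g x) < e"
    by (intro bexI[OF _ cg]) simp
qed

lemma continuous_approx_sum:
  "(\<And>i. i \<in> I \<Longrightarrow> f i \<in> continuous_approx \<Omega>) \<Longrightarrow> (\<lambda>x. \<Sum>i\<in>I. f i x) \<in> continuous_approx \<Omega>"
  by (induction I rule: infinite_finite_induct) (auto intro: continuous_approx_add continuous_approx_zero)

lemma continuous_approx_limit: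
  assumes fs: "\<And>n. fs n \<in> continuous_approx \<Omega>" and f: "f \<in> L2"
    and lim: "(\<lambda>n. l2norm (\<lambda>x. fs n x - f x)) \<longlonglongrightarrow> 0"
  shows "f \<in> continuous_approx \<Omega>"
  unfolding continuous_approx_def
proof (intro CollectI conjI allI impI f)
  fix e :: real assume "e > 0"
  then have "\<forall>\<^sub>F n in sequentially. l2norm (\<lambda>x. fs n x - f x) < e/2"
    using order_tendstoD(2)[OF lim, of "e/2"] by simp
  then obtain n where n: "l2norm (\<lambda>x. fs n x - f x) < e/2"
    using eventually_happens'[OF sequentially_bot] by blast
  obtain g where g: "g \<in> continuous_in \<Omega>" "l2norm (\<lambda>x. fs n x - g x) < e/2"
    using fs[of n] half_gt_zero[OF \<open>e > 0\<close>] unfolding continuous_approx_def by blast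
  have "fs n \<in> L2" using fs by (simp add: continuous_approx_def)
  then have "l2norm (\<lambda>x. f x - g x) \<le> l2norm (\<lambda>x. f x - fs n x) + l2norm (\<lambda>x. fs n x - g x)"
    using f g(1) by (intro l2norm_triangle3) (auto intro: continuous_in_L2)
  then have "l2norm (\<lambda>x. f x - g x) < e"
    using n g by (simp add: l2norm_minus_commute[of f])
  then show "\<exists>g\<in>continuous_in \<Omega>. l2norm (\<lambda>x. f x - g x) < e" using g by blast
qed

text \<open>
  By regularity of Lebesgue measure the set can be squeezed between a closed and an open set whose
  difference is small, and Urysohn's lemma interpolates between the two.
\<close>

lemma continuous_approx_indicator:
  fixes A :: "'a::euclidean_space set"
  assumes \<Omega>: "open \<Omega>" and A: "A \<in> sets borel" "A \<subseteq> \<Omega>" "bounded A"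
  shows "(\<lambda>x. indicator A x) \<in> continuous_approx \<Omega>"
  unfolding continuous_approx_def
proof (intro CollectI conjI allI impI)
  note [measurable] = A(1)
  show "(\<lambda>x. indicator A x) \<in> L2" using A by (intro L2_indicator finite_measure_bounded)
  fix e :: real assume e: "e > 0"
  \<comment> \<open>The two regularity errors add up to \<open>e\<^sup>2 / 2\<close>, and the squared distance must be below \<open>e\<^sup>2\<close>.\<close>
  define d where "d = e\<^sup>2 / 4"
  have d: "d > 0" using e by (simp add: d_def)
  obtain U0 where U0: "open U0" "A \<subseteq> U0" "emeasure lborel (U0 - A) < d"
    using outer_regular_lborel[OF A(1) d] by blast
  obtain C where C: "closed C" "C \<subseteq> A" "A - C \<in> lmeasurable" "emeasure lebesgue (A - C) < ennreal d"
    using sets_lebesgue_inner_closed[of A d] A(1) d by auto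
  have [measurable]: "C \<in> sets borel" "U0 \<in> sets borel" using C U0 by auto
  have AC: "emeasure lborel (A - C) < d" using C(4) by simp
  obtain R where R: "A \<subseteq> ball 0 R" using A(3) bounded_subset_ballD by blast
  define U where "U = U0 \<inter> \<Omega> \<inter> ball 0 R"
  have U: "open U" "A \<subseteq> U" using U0 \<Omega> A(2) R by (auto simp: U_def)
  obtain g :: "'a \<Rightarrow> real" where g: "continuous_on UNIV g" "\<And>x. g x \<in> closed_segment 1 0"
      "\<And>x. x \<in> C \<Longrightarrow> g x = 1" "\<And>x. x \<in> - U \<Longrightarrow> g x = 0"
    using Urysohn[of C "- U" "1::real" 0] C U by auto
  have g01: "0 \<le> g x" "g x \<le> 1" for x using g(2)[of x] by (auto simp: closed_segment_eq_real_ivl)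
  have "{x. complex_of_real (g x) \<noteq> 0} \<subseteq> U" using g(4) by fastforce
  then have "bounded {x. complex_of_real (g x) \<noteq> 0}"
    by (intro bounded_subset[OF bounded_ball[of 0 R]]) (auto simp: U_def)
  moreover have "continuous_on UNIV (\<lambda>x. complex_of_real (g x))"
    using g(1) by (intro continuous_intros)
  ultimately have gc: "(\<lambda>x. complex_of_real (g x)) \<in> continuous_in \<Omega>"
    using g(4) unfolding continuous_in_def by (auto simp: U_def)
  have fin: "emeasure lborel (U0 - C) < ennreal (e\<^sup>2)"
  proof -
    have "emeasure lborel (U0 - C) \<le> emeasure lborel (U0 - A) + emeasure lborel (A - C)"
      using U0(2) C(2) by (subst plus_emeasure) (auto intro!: emeasure_mono)
    also have "\<dots> \<le> ennreal d + ennreal d"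
      using U0(3) AC by (intro add_mono less_imp_le)
    also have "\<dots> = ennreal (e\<^sup>2 / 2)" using d by (simp add: d_def flip: ennreal_plus)
    also have "\<dots> < ennreal (e\<^sup>2)" using e by (intro ennreal_lessI) auto
    finally show ?thesis .
  qed
  then have fin': "emeasure lborel (U0 - C) < top" by (rule less_trans) simp
  have le: "cmod (indicator A x - complex_of_real (g x)) \<le> 1 * cmod (indicator (U0 - C) x)" for x
  proof (cases "x \<in> U0 - C")
    case True
    have "cmod (indicator A x - complex_of_real (g x)) = \<bar>indicator A x - g x\<bar>"
      by (metis norm_of_real of_real_diff of_real_indicator)
    also have "\<dots> \<le> 1" using g01[of x] by (simp split: split_indicator)
    finally show ?thesis using True by simp
  next
    case False
    then show ?thesis using g(3,4)[of x] C(2) U0(2) by (auto split: split_indicator simp: U_def)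
  qed
  have "l2norm (\<lambda>x. indicator A x - complex_of_real (g x)) \<le> 1 * l2norm (\<lambda>x. indicator (U0 - C) x :: complex)"
  proof (rule l2norm_mono[OF L2_indicator _ le])
    show "(\<lambda>x. indicator A x - complex_of_real (g x)) \<in> borel_measurable lborel"
      using borel_measurable_continuous_onI[OF g(1)] by simp
  qed (use fin' in auto)
  also have "\<dots> < e"
  proof -
    have "(l2norm (\<lambda>x. indicator (U0 - C) x :: complex))\<^sup>2 = measure lborel (U0 - C)"
      using fin' by (intro l2norm_indicator) auto
    also have "\<dots> < e\<^sup>2"
      using fin fin' by (simp add: emeasure_eq_ennreal_measure ennreal_less_iff)
    finally show ?thesis using e by (simp add: power_less_imp_less_base)
  qed
  finally show "\<exists>g\<in>continuous_in \<Omega>. l2norm (\<lambda>x. indicator A x - g x) < e"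
    by (intro bexI[OF _ gc]) simp
qed

theorem L2_continuous_dense:
  fixes f :: "'a::euclidean_space \<Rightarrow> complex"
  assumes \<Omega>: "open \<Omega>" and f: "f \<in> L2" and supp: "\<And>x. x \<notin> \<Omega> \<Longrightarrow> f x = 0" and e: "e > 0"
  obtains g where "g \<in> continuous_in \<Omega>" "l2norm (\<lambda>x. f x - g x) < e"
proof -
  have simple: "s \<in> continuous_approx \<Omega>"
    if s: "simple_function lborel s" and sb: "bounded {x. s x \<noteq> 0}" and s\<Omega>: "\<And>x. x \<notin> \<Omega> \<Longrightarrow> s x = 0" for s :: "'a \<Rightarrow> complex"
  proof -
    have fin: "finite (range s)" using simple_functionD(1)[OF s] by simp
    have A: "s -` {y} \<in> sets borel" for y
      using simple_functionD(2)[OF s, of "{y}"] by simp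
    have "(\<lambda>x. \<Sum>y\<in>range s. y * indicator (s -` {y}) x) \<in> continuous_approx \<Omega>"
    proof (rule continuous_approx_sum)
      fix y assume "y \<in> range s"
      show "(\<lambda>x. y * indicator (s -` {y}) x) \<in> continuous_approx \<Omega>"
      proof (cases "y = 0")
        case True
        then show ?thesis by (simp add: continuous_approx_zero)
      next
        case False
        show ?thesis
        proof (intro continuous_approx_cmult continuous_approx_indicator \<Omega> A)
          show "s -` {y} \<subseteq> \<Omega>" using False s\<Omega> by auto
          show "bounded (s -` {y})" by (rule bounded_subset[OF sb]) (use False in auto)
        qed
      qed
    qed
    also have "(\<lambda>x. \<Sum>y\<in>range s. y * indicator (s -` {y}) x) = s"
    proof
      fix x
      have "(\<Sum>y\<in>range s. y * indicator (s -` {y}) x) = (\<Sum>y\<in>{s x}. y * indicator (s -` {y}) x)"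
        by (rule sum.mono_neutral_right) (use fin in \<open>auto split: split_indicator\<close>)
      then show "(\<Sum>y\<in>range s. y * indicator (s -` {y}) x) = s x" by simp
    qed
    finally show ?thesis .
  qed
  have bdd: "h \<in> continuous_approx \<Omega>"
    if h: "h \<in> L2" and hb: "bounded {x. h x \<noteq> 0}" and h\<Omega>: "\<And>x. x \<notin> \<Omega> \<Longrightarrow> h x = 0" for h :: "'a \<Rightarrow> complex"
  proof -
    obtain F where F: "\<And>i. simple_function lborel (F i)" "\<And>x. (\<lambda>i. F i x) \<longlonglongrightarrow> h x"
      "\<And>i x. dist (F i x) 0 \<le> 2 * dist (h x) 0"
      using borel_measurable_implies_sequence_metric[OF L2_measurable[OF h], of 0] by (auto simp: space_borel)
    have le: "cmod (F i x) \<le> 2 * cmod (h x)" for i x using F(3)[of i x] by simp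
    have zero: "F i x = 0" if "h x = 0" for i x using le[of i x] that by simp
    show ?thesis
    proof (rule continuous_approx_limit[OF _ h])
      fix n
      show "F n \<in> continuous_approx \<Omega>"
      proof (rule simple[OF F(1)])
        show "bounded {x. F n x \<noteq> 0}" by (rule bounded_subset[OF hb]) (use zero in auto)
      qed (use h\<Omega> zero in auto)
    next
      show "(\<lambda>n. l2norm (\<lambda>x. F n x - h x)) \<longlonglongrightarrow> 0"
      proof (rule L2_dominated_convergence[OF h L2_cmult[OF h, of 2]])
        show "F n \<in> borel_measurable lborel" for n
          by (rule borel_measurable_simple_function[OF F(1)])
      qed (use F le in \<open>auto simp: norm_mult\<close>)
    qed
  qed
  have "f \<in> continuous_approx \<Omega>"
  proof (rule continuous_approx_limit[OF bdd f truncate_tendsto[OF f]])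
    fix n
    show "truncate n f \<in> L2" by (rule truncate_L2[OF f])
    show "bounded {x. truncate n f x \<noteq> 0}"
      by (rule bounded_subset[OF bounded_cball[of 0 "real n"]]) (auto simp: truncate_def split: split_indicator)
  qed (use supp in \<open>auto simp: truncate_def\<close>)
  then show ?thesis using that e unfolding continuous_approx_def by blast
qed

subsection \<open>Translations\<close>

lemma integral_translate:
  fixes f :: "'a::euclidean_space \<Rightarrow> 'b::{banach, second_countable_topology}"
  assumes "f \<in> borel_measurable borel"
  shows "(LINT x|lborel. f (x - c)) = (LINT x|lborel. f x)"
proof -
  have "(LINT x|lborel. f x) = (LINT x|distr lborel borel ((+) (- c)). f x)"
    by (simp add: lborel_distr_plus)
  also have "\<dots> = (LINT x|lborel. f (- c + x))"
    by (rule integral_distr) (use assms in auto)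
  finally show ?thesis by simp
qed

lemma integrable_translate:
  fixes f :: "'a::euclidean_space \<Rightarrow> 'b::{banach, second_countable_topology}"
  assumes "integrable lborel f"
  shows "integrable lborel (\<lambda>x. f (x - c))"
proof -
  have "integrable (distr lborel borel ((+) (- c))) f"
    using assms by (simp add: lborel_distr_plus)
  then have "integrable lborel (\<lambda>x. f (- c + x))"
    by (subst (asm) integrable_distr_eq) (use assms in auto)
  then show ?thesis by simp
qed

lemma L2_translate: "f \<in> L2 \<Longrightarrow> (\<lambda>x. f (x - c)) \<in> L2"
  unfolding L2_def using integrable_translate[of "\<lambda>x. (cmod (f x))\<^sup>2" c]
  by (auto intro: measurable_compose[of "\<lambda>x. x - c" borel borel])

lemma l2norm_translate: "f \<in> borel_measurable borel \<Longrightarrow> l2norm (\<lambda>x. f (x - c)) = l2norm f"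
  unfolding l2norm_def using integral_translate[of "\<lambda>x. (cmod (f x))\<^sup>2" c] by simp

text \<open>
  For a continuous function with bounded support this is dominated convergence; the general case
  follows by approximation, since translations are isometries.
\<close>

theorem L2_translation_continuous:
  fixes f :: "'a::euclidean_space \<Rightarrow> complex"
  assumes f: "f \<in> L2" and u: "u \<longlonglongrightarrow> u0"
  shows "(\<lambda>n. l2norm (\<lambda>x. f (x - u n) - f (x - u0))) \<longlonglongrightarrow> 0"
proof (rule LIMSEQ_I)
  fix e :: real assume e: "e > 0"
  obtain g where g: "g \<in> continuous_in UNIV" "l2norm (\<lambda>x. f x - g x) < e/3"
    using L2_continuous_dense[of UNIV f "e/3"] f e by auto
  have gL2: "g \<in> L2" by (rule continuous_in_L2[OF g(1)])
  have [measurable]: "g \<in> borel_measurable borel" "f \<in> borel_measurable borel"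
    using L2_measurable[OF gL2] L2_measurable[OF f] by auto
  obtain C where C: "\<And>x. cmod (g x) \<le> C" "0 \<le> C" using continuous_in_bounded[OF g(1)] by blast
  obtain R where R: "{x. g x \<noteq> 0} \<subseteq> cball 0 R"
    using g(1) bounded_imp_cball[of "{x. g x \<noteq> 0}"] unfolding continuous_in_def by blast
  obtain M where M: "\<And>n. norm (u n) \<le> M"
    using convergent_imp_Bseq[of u] u unfolding convergent_def Bseq_def by blast
  have "(\<lambda>n. l2norm (\<lambda>x. g (x - u n) - g (x - u0))) \<longlonglongrightarrow> 0"
  proof (rule L2_dominated_convergence[where w="\<lambda>x. complex_of_real C * indicator (cball 0 (R + M)) x"])
    show "(\<lambda>x. g (x - u0)) \<in> L2" by (rule L2_translate[OF gL2])
    show "(\<lambda>x. complex_of_real C * indicator (cball 0 (R + M)) x) \<in> L2"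
      by (intro L2_cmult L2_indicator finite_measure_bounded) auto
    show "AE x in lborel. (\<lambda>n. g (x - u n)) \<longlonglongrightarrow> g (x - u0)"
    proof (rule AE_I2)
      fix x
      have "isCont g (x - u0)" using g(1) by (simp add: continuous_in_def continuous_on_eq_continuous_at)
      then show "(\<lambda>n. g (x - u n)) \<longlonglongrightarrow> g (x - u0)"
        by (rule isCont_tendsto_compose) (intro tendsto_intros u)
    qed
    fix n x
    show "cmod (g (x - u n)) \<le> cmod (complex_of_real C * indicator (cball 0 (R + M)) x)"
    proof (cases "g (x - u n) = 0")
      case False
      then have "norm (x - u n) \<le> R" using R by auto
      then have "norm x \<le> R + M"
        using M[of n] norm_triangle_ineq[of "x - u n" "u n"] by simp
      then show ?thesis using C by simp
    qed (use C in simp)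
  qed measurable
  then obtain N where N: "\<And>n. n \<ge> N \<Longrightarrow> l2norm (\<lambda>x. g (x - u n) - g (x - u0)) < e/3"
    using order_tendstoD(2)[of _ 0 sequentially "e/3"] e by (auto simp: eventually_sequentially)
  have shift: "l2norm (\<lambda>x. f (x - c) - g (x - c)) < e/3" for c
    using l2norm_translate[of "\<lambda>x. f x - g x" c] g(2) by simp
  have "norm (l2norm (\<lambda>x. f (x - u n) - f (x - u0)) - 0) < e" if "n \<ge> N" for n
  proof -
    have "l2norm (\<lambda>x. f (x - u n) - f (x - u0))
        \<le> l2norm (\<lambda>x. f (x - u n) - g (x - u n)) + l2norm (\<lambda>x. g (x - u n) - f (x - u0))"
      by (intro l2norm_triangle3 L2_translate f gL2)
    moreover have "l2norm (\<lambda>x. g (x - u n) - f (x - u0))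
        \<le> l2norm (\<lambda>x. g (x - u n) - g (x - u0)) + l2norm (\<lambda>x. g (x - u0) - f (x - u0))"
      by (intro l2norm_triangle3 L2_translate f gL2)
    moreover have "l2norm (\<lambda>x. g (x - u0) - f (x - u0)) < e/3"
      using shift[of u0] l2norm_minus_commute[of "\<lambda>x. f (x - u0)" "\<lambda>x. g (x - u0)"] by simp
    ultimately show ?thesis
      using shift[of "u n"] N[OF that] by simp
  qed
  then show "\<exists>no. \<forall>n\<ge>no. norm (l2norm (\<lambda>x. f (x - u n) - f (x - u0)) - 0) < e" by blast
qed


section \<open>The Fourier integral\<close>

lemma borel_measurable_cis [measurable (raw)]:
  "f \<in> borel_measurable M \<Longrightarrow> (\<lambda>x. cis (f x)) \<in> borel_measurable M"
  by (rule borel_measurable_continuous_on) (intro continuous_intros)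

subsection \<open>Affine substitutions and products over coordinates\<close>

lemma integral_affine:
  fixes f :: "'a::euclidean_space \<Rightarrow> 'b::{banach, second_countable_topology}"
  assumes [measurable]: "f \<in> borel_measurable borel" and c: "c \<noteq> 0"
  shows "(LINT x|lborel. f x) = \<bar>c\<bar> ^ DIM('a) *\<^sub>R (LINT x|lborel. f (t + c *\<^sub>R x))"
proof -
  have "(LINT x|lborel. f x)
      = (LINT x|density (distr lborel borel (\<lambda>x. t + c *\<^sub>R x)) (\<lambda>_. \<bar>c\<bar> ^ DIM('a)). f x)"
    by (rule arg_cong[where f="\<lambda>M. integral\<^sup>L M f", OF lborel_affine[OF c]])
  also have "\<dots> = (LINT x|distr lborel borel (\<lambda>x. t + c *\<^sub>R x). \<bar>c\<bar> ^ DIM('a) *\<^sub>R f x)"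
    by (subst integral_density) auto
  also have "\<dots> = (LINT x|lborel. \<bar>c\<bar> ^ DIM('a) *\<^sub>R f (t + c *\<^sub>R x))"
    by (subst integral_distr) auto
  finally show ?thesis by simp
qed

lemma integral_reflect:
  fixes f :: "'a::euclidean_space \<Rightarrow> 'b::{banach, second_countable_topology}"
  assumes "f \<in> borel_measurable borel"
  shows "(LINT x|lborel. f (t - x)) = (LINT x|lborel. f x)"
  using integral_affine[OF assms, of "-1" t] by simp

lemma integrable_reflect:
  fixes f :: "'a::euclidean_space \<Rightarrow> 'b::{banach, second_countable_topology}"
  assumes f: "integrable lborel f"
  shows "integrable lborel (\<lambda>x. f (t - x))"
proof -
  have "density (distr lborel borel (\<lambda>x. t + (-1) *\<^sub>R x)) (\<lambda>_. \<bar>-1::real\<bar> ^ DIM('a)) = (lborel :: 'a measure)"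
    by (rule lborel_affine[symmetric]) simp
  then have "distr lborel borel (\<lambda>x. t - x) = (lborel :: 'a measure)"
    by (simp add: density_1)
  then have "integrable (distr lborel borel (\<lambda>x. t - x)) f" using f by simp
  then show ?thesis
    by (subst (asm) integrable_distr_eq) (use f in auto)
qed

text \<open>
  Gaussians, indicators of boxes and characters are products of functions of one coordinate, so
  their Fourier integrals reduce to one-dimensional ones.
\<close>

lemma
  fixes f :: "'a::euclidean_space \<Rightarrow> real \<Rightarrow> complex"
  assumes f: "\<And>b. b \<in> Basis \<Longrightarrow> integrable lborel (f b)"
  shows integrable_prod_Basis: "integrable lborel (\<lambda>x. \<Prod>b\<in>Basis. f b (x \<bullet> b))"
    and integral_prod_Basis:
      "(LINT x|lborel. (\<Prod>b\<in>Basis. f b (x \<bullet> b))) = (\<Prod>b\<in>Basis. (LINT t|lborel. f b t))"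
proof -
  interpret product_sigma_finite "\<lambda>_::'a. lborel :: real measure" ..
  let ?P = "Pi\<^sub>M Basis (\<lambda>_::'a. lborel :: real measure)"
  let ?T = "\<lambda>y. \<Sum>b\<in>Basis. y b *\<^sub>R (b::'a)"
  let ?F = "\<lambda>x. \<Prod>b\<in>Basis. f b (x \<bullet> b)"
  have [measurable]: "f b \<in> borel_measurable borel" if "b \<in> Basis" for b
    using borel_measurable_integrable[OF f[OF that]] by simp
  have F [measurable]: "?F \<in> borel_measurable borel" by measurable
  have T [measurable]: "?T \<in> measurable ?P borel" by measurable
  have FT: "?F (?T y) = (\<Prod>b\<in>Basis. f b (y b))" for y
    by (intro prod.cong refl) simp
  have "integrable ?P (\<lambda>y. \<Prod>b\<in>Basis. f b (y b))"
    by (rule product_integrable_prod) (auto intro: f)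
  then have "integrable (distr ?P borel ?T) ?F"
    by (subst integrable_distr_eq[OF T F]) (simp add: FT)
  then show "integrable lborel ?F"
    by (simp flip: lborel_eq)
  have "(LINT x|lborel. ?F x) = (LINT x|distr ?P borel ?T. ?F x)"
    by (simp flip: lborel_eq)
  also have "\<dots> = (LINT y|?P. (\<Prod>b\<in>Basis. f b (y b)))"
    by (subst integral_distr[OF T F]) (simp add: FT)
  also have "\<dots> = (\<Prod>b\<in>Basis. (LINT t|lborel. f b t))"
    by (rule product_integral_prod) (auto intro: f)
  finally show "(LINT x|lborel. ?F x) = (\<Prod>b\<in>Basis. (LINT t|lborel. f b t))" .
qed

lemma cis_sum: "cis (\<Sum>i\<in>I. f i) = (\<Prod>i\<in>I. cis (f i))"
  by (induction I rule: infinite_finite_induct) (auto simp: cis_mult[symmetric])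

subsection \<open>Gaussians\<close>

lemma norm_sqr_Basis: "(norm x)\<^sup>2 = (\<Sum>b\<in>Basis. ((x::'a::euclidean_space) \<bullet> b)\<^sup>2)"
  unfolding power2_norm_eq_inner euclidean_inner[of x x] by (simp add: power2_eq_square)

text \<open>
  Left without normalisation: the summability kernel in Plancherel's identity must increase to \<open>1\<close>
  when the Gaussian is widened.
\<close>

definition gaussian :: "'a::euclidean_space \<Rightarrow> real" where
  "gaussian x = exp (- (norm x)\<^sup>2 / 2)"

lemma gaussian_prod:
  "complex_of_real (gaussian x)
     = complex_of_real (sqrt (2 * pi) ^ DIM('a)) * (\<Prod>b\<in>Basis. complex_of_real (std_normal_density ((x::'a::euclidean_space) \<bullet> b)))"
proof -
  have "gaussian x = (\<Prod>b\<in>Basis. exp (- (x \<bullet> b)\<^sup>2 / 2))"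
    unfolding gaussian_def by (subst exp_sum[symmetric]) (auto simp: norm_sqr_Basis sum_divide_distrib sum_negf)
  also have "\<dots> = (\<Prod>b\<in>Basis. sqrt (2 * pi) * std_normal_density (x \<bullet> b))"
    by (simp add: std_normal_density_def)
  also have "\<dots> = sqrt (2 * pi) ^ DIM('a) * (\<Prod>b\<in>Basis. std_normal_density (x \<bullet> b))"
    by (simp add: prod.distrib)
  finally show ?thesis by simp
qed

text \<open>
  This is the characteristic function of the standard normal distribution.
\<close>

lemma std_normal_fourier:
  "(LINT t|lborel. complex_of_real (std_normal_density t) * cis (s * t)) = complex_of_real (exp (- s\<^sup>2 / 2))"
proof -
  have "complex_of_real (exp (- s\<^sup>2 / 2)) = char std_normal_distribution s"
    by (simp add: char_std_normal_distribution)
  also have "\<dots> = (LINT t|density lborel std_normal_density. cis (s * t))"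
    by (simp add: char_def cis_conv_exp)
  also have "\<dots> = (LINT t|lborel. std_normal_density t *\<^sub>R cis (s * t))"
    by (subst integral_density) auto
  finally show ?thesis by (simp add: scaleR_conv_of_real)
qed

lemma integrable_cis_mult:
  assumes "integrable M f" "\<theta> \<in> borel_measurable M"
  shows "integrable M (\<lambda>x. f x * cis (\<theta> x))"
  by (rule Bochner_Integration.integrable_bound[OF assms(1)]) (use assms in \<open>auto simp: norm_mult\<close>)

lemma integrable_std_normal: "integrable lborel (\<lambda>t. complex_of_real (std_normal_density t))"
  using integrable_normal_density[of 1 0] by (intro integrable_of_real) simp

lemma gaussian_integrable: "integrable lborel (\<lambda>x::'a::euclidean_space. complex_of_real (gaussian x))"
  unfolding gaussian_prod
  by (intro integrable_mult_right integrable_prod_Basis[where f="\<lambda>b t. complex_of_real (std_normal_density t)"]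
      integrable_std_normal)

lemma gaussian_measurable [measurable]: "gaussian \<in> borel_measurable borel"
  unfolding gaussian_def by measurable

lemma gaussian_fourier:
  fixes s :: "'a::euclidean_space"
  shows "(LINT x|lborel. complex_of_real (gaussian x) * cis (s \<bullet> x))
      = complex_of_real (sqrt (2 * pi) ^ DIM('a) * gaussian s)"
proof -
  have "complex_of_real (gaussian x) * cis (s \<bullet> x) = complex_of_real (sqrt (2 * pi) ^ DIM('a)) *
      (\<Prod>b\<in>Basis. complex_of_real (std_normal_density (x \<bullet> b)) * cis ((s \<bullet> b) * (x \<bullet> b)))" for x
    unfolding gaussian_prod euclidean_inner[of s x] cis_sum by (simp add: prod.distrib mult.assoc)
  then have "(LINT x|lborel. complex_of_real (gaussian x) * cis (s \<bullet> x)) = complex_of_real (sqrt (2 * pi) ^ DIM('a)) *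
      (LINT x|lborel. (\<Prod>b\<in>Basis. complex_of_real (std_normal_density (x \<bullet> b)) * cis ((s \<bullet> b) * (x \<bullet> b))))"
    by simp
  also have "(LINT x|lborel. (\<Prod>b\<in>Basis. complex_of_real (std_normal_density ((x::'a) \<bullet> b)) * cis ((s \<bullet> b) * (x \<bullet> b))))
      = (\<Prod>b\<in>Basis. (LINT t|lborel. complex_of_real (std_normal_density t) * cis ((s \<bullet> b) * t)))"
    by (rule integral_prod_Basis[where f="\<lambda>b t. complex_of_real (std_normal_density t) * cis ((s \<bullet> b) * t)"])
       (intro integrable_cis_mult integrable_std_normal, simp)
  also have "\<dots> = complex_of_real (gaussian s)"
    unfolding std_normal_fourier gaussian_def
    by (simp add: norm_sqr_Basis[of s] sum_divide_distrib sum_negf flip: exp_sum of_real_prod)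
  finally show ?thesis by simp
qed

subsection \<open>Basic properties of the Fourier integral\<close>

lemma fourier_integral_integrable:
  "integrable lborel f \<Longrightarrow> integrable lborel (\<lambda>x. f x * cis (- 2 * pi * (\<xi> \<bullet> x)))"
  by (rule integrable_cis_mult) auto

lemma fourier_integral_bound: "cmod (fourier_integral f \<xi>) \<le> (LINT x|lborel. cmod (f x))"
  unfolding fourier_integral_def
  by (rule order_trans[OF integral_norm_bound]) (simp add: norm_mult)

lemma fourier_integral_diff:
  "integrable lborel f \<Longrightarrow> integrable lborel g \<Longrightarrow>
   fourier_integral (\<lambda>x. f x - g x) \<xi> = fourier_integral f \<xi> - fourier_integral g \<xi>"
  unfolding fourier_integral_def left_diff_distrib
  by (intro Bochner_Integration.integral_diff fourier_integral_integrable)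

lemma fourier_integral_continuous:
  fixes f :: "'a::euclidean_space \<Rightarrow> complex"
  assumes f: "integrable lborel f"
  shows "continuous_on UNIV (fourier_integral f)"
  unfolding continuous_on_sequentially
proof (intro allI ballI impI)
  fix u and a :: 'a assume u: "(\<forall>n. u n \<in> UNIV) \<and> u \<longlonglongrightarrow> a"
  have [measurable]: "f \<in> borel_measurable borel" using f by auto
  show "(fourier_integral f \<circ> u) \<longlonglongrightarrow> fourier_integral f a"
    unfolding o_def fourier_integral_def
  proof (rule integral_dominated_convergence[where w="\<lambda>x. cmod (f x)"])
    show "AE x in lborel. (\<lambda>n. f x * cis (- 2 * pi * (u n \<bullet> x))) \<longlonglongrightarrow> f x * cis (- 2 * pi * (a \<bullet> x))"
    proof (rule AE_I2)
      fix x
      have "continuous_on UNIV (\<lambda>y. f x * cis (- 2 * pi * (y \<bullet> x)))" by (intro continuous_intros)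
      then have *: "isCont (\<lambda>y. f x * cis (- 2 * pi * (y \<bullet> x))) a"
        by (simp add: continuous_on_eq_continuous_at)
      show "(\<lambda>n. f x * cis (- 2 * pi * (u n \<bullet> x))) \<longlonglongrightarrow> f x * cis (- 2 * pi * (a \<bullet> x))"
        using isCont_tendsto_compose[OF *, of u sequentially] u by simp
    qed
  qed (use f in \<open>auto simp: norm_mult\<close>)
qed

lemma fourier_integral_measurable [measurable]:
  "integrable lborel f \<Longrightarrow> fourier_integral f \<in> borel_measurable borel"
  by (intro borel_measurable_continuous_onI fourier_integral_continuous)

lemma integrable_bounded_mult:
  assumes "integrable M f" "m \<in> borel_measurable M" "\<And>x. cmod (m x) \<le> C"
  shows "integrable M (\<lambda>x. m x * f x :: complex)"
proof (rule Bochner_Integration.integrable_bound[where f="\<lambda>x. C * cmod (f x)"])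
  show "AE x in M. norm (m x * f x) \<le> norm (C * cmod (f x))"
  proof (rule AE_I2)
    fix x
    have "0 \<le> C" using assms(3)[of x] norm_ge_zero[of "m x"] by linarith
    then show "norm (m x * f x) \<le> norm (C * cmod (f x))"
      using assms(3)[of x] by (simp add: norm_mult abs_mult mult_right_mono)
  qed
qed (use assms in auto)

lemma integrable_tensor:
  fixes f :: "'a::euclidean_space \<Rightarrow> complex" and h :: "'b::euclidean_space \<Rightarrow> complex"
  assumes f: "integrable lborel f" and h: "integrable lborel h"
  shows "integrable (lborel \<Otimes>\<^sub>M lborel) (\<lambda>(x, y). f x * h y)"
proof (rule lborel_pair.Fubini_integrable)
  have [measurable]: "f \<in> borel_measurable borel" "h \<in> borel_measurable borel" using f h by auto
  show "(\<lambda>(x, y). f x * h y) \<in> borel_measurable (lborel \<Otimes>\<^sub>M lborel)" by measurable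
qed (use f h in \<open>auto simp: norm_mult\<close>)

text \<open>
  The multiplication formula moves the transform from one factor to the other. Plancherel's
  identity and the adjoint relation both rest on it.
\<close>

lemma fourier_integral_exchange:
  assumes f: "integrable lborel f" and h: "integrable lborel h"
  shows "(LINT \<xi>|lborel. fourier_integral f \<xi> * h \<xi>) = (LINT x|lborel. f x * fourier_integral h x)"
proof -
  let ?k = "\<lambda>x \<xi>. f x * h \<xi> * cis (- 2 * pi * (\<xi> \<bullet> x))"
  have [measurable]: "f \<in> borel_measurable borel" "h \<in> borel_measurable borel" using f h by auto
  have "integrable (lborel \<Otimes>\<^sub>M lborel) (\<lambda>z. (case z of (x, y) \<Rightarrow> f x * h y) * cis (- 2 * pi * (snd z \<bullet> fst z)))"
    by (intro integrable_cis_mult integrable_tensor f h) measurable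
  then have int: "integrable (lborel \<Otimes>\<^sub>M lborel) (case_prod ?k)"
    by (simp add: case_prod_unfold)
  have "(LINT \<xi>|lborel. fourier_integral f \<xi> * h \<xi>) = (LINT \<xi>|lborel. LINT x|lborel. ?k x \<xi>)"
    unfolding fourier_integral_def
    by (intro Bochner_Integration.integral_cong refl, subst integral_mult_left_zero[symmetric])
       (simp add: mult_ac)
  also have "\<dots> = (LINT x|lborel. LINT \<xi>|lborel. ?k x \<xi>)"
    by (rule lborel_pair.Fubini_integral[OF int])
  also have "\<dots> = (LINT x|lborel. f x * fourier_integral h x)"
    unfolding fourier_integral_def
    by (intro Bochner_Integration.integral_cong refl, subst integral_mult_right_zero[symmetric])
       (simp add: mult_ac inner_commute)
  finally show ?thesis .
qed

subsection \<open>Plancherel's identity\<close>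

text \<open>
  The convolution of \<open>f\<close> with its conjugate reflection. Its transform is the squared modulus of the
  transform of \<open>f\<close>, and its value at \<open>0\<close> is the squared norm of \<open>f\<close>.
\<close>

definition autocorrelation :: "('a::euclidean_space \<Rightarrow> complex) \<Rightarrow> 'a \<Rightarrow> complex" where
  "autocorrelation f u = (LINT x|lborel. f x * cnj (f (x - u)))"

lemma
  assumes f: "integrable lborel f"
  shows autocorrelation_integrable: "integrable lborel (autocorrelation f)"
    and fourier_autocorrelation: "fourier_integral (autocorrelation f) \<xi> = complex_of_real ((cmod (fourier_integral f \<xi>))\<^sup>2)"
proof -
  let ?k = "\<lambda>x u. f x * cnj (f (x - u))"
  have [measurable]: "f \<in> borel_measurable borel" using f by auto
  have inner: "integrable lborel (\<lambda>u. f x * cnj (f (x - u)))" for x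
    using integrable_reflect[OF f, of x] by (intro integrable_mult_right integrable_cnj)
  have int: "integrable (lborel \<Otimes>\<^sub>M lborel) (case_prod ?k)"
  proof (rule lborel_pair.Fubini_integrable)
    have "(LINT y|lborel. cmod (f (x - y))) = (LINT y|lborel. cmod (f y))" for x
      by (rule integral_reflect) simp
    then show "integrable lborel (\<lambda>x. LINT y|lborel. norm (case (x, y) of (x, u) \<Rightarrow> ?k x u))"
      using f by (simp add: norm_mult)
  qed (use inner in simp_all)
  show "integrable lborel (autocorrelation f)"
    unfolding autocorrelation_def using lborel_pair.integrable_snd[OF int] by simp
  let ?K = "\<lambda>x u. ?k x u * cis (- 2 * pi * (\<xi> \<bullet> u))"
  have "integrable (lborel \<Otimes>\<^sub>M lborel) (\<lambda>z. case_prod ?k z * cis (- 2 * pi * (\<xi> \<bullet> snd z)))"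
    by (intro integrable_cis_mult int) measurable
  then have int': "integrable (lborel \<Otimes>\<^sub>M lborel) (case_prod ?K)"
    by (simp add: case_prod_unfold)
  \<comment> \<open>The substitution \<open>y = x - u\<close> splits off the character at \<open>x\<close>.\<close>
  have inner': "(LINT u|lborel. cnj (f (x - u)) * cis (- 2 * pi * (\<xi> \<bullet> u)))
      = cis (- 2 * pi * (\<xi> \<bullet> x)) * cnj (fourier_integral f \<xi>)" for x
  proof -
    have "(LINT u|lborel. cnj (f (x - u)) * cis (- 2 * pi * (\<xi> \<bullet> u)))
        = (LINT u|lborel. cnj (f (x - u)) * cis (- 2 * pi * (\<xi> \<bullet> (x - (x - u)))))" by simp
    also have "\<dots> = (LINT y|lborel. cnj (f y) * cis (- 2 * pi * (\<xi> \<bullet> (x - y))))"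
      by (rule integral_reflect[where f="\<lambda>y. cnj (f y) * cis (- 2 * pi * (\<xi> \<bullet> (x - y)))"]) measurable
    also have "\<dots> = (LINT y|lborel. cis (- 2 * pi * (\<xi> \<bullet> x)) * cnj (f y * cis (- 2 * pi * (\<xi> \<bullet> y))))"
      by (intro Bochner_Integration.integral_cong refl)
         (simp add: cis_cnj cis_mult inner_diff_right algebra_simps)
    also have "\<dots> = cis (- 2 * pi * (\<xi> \<bullet> x)) * cnj (fourier_integral f \<xi>)"
      unfolding fourier_integral_def by (simp del: complex_cnj_mult)
    finally show ?thesis .
  qed
  have "fourier_integral (autocorrelation f) \<xi> = (LINT u|lborel. LINT x|lborel. ?K x u)"
    unfolding fourier_integral_def autocorrelation_def by simp
  also have "\<dots> = (LINT x|lborel. LINT u|lborel. ?K x u)"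
    by (rule lborel_pair.Fubini_integral[OF int'])
  also have "\<dots> = (LINT x|lborel. f x * (cis (- 2 * pi * (\<xi> \<bullet> x)) * cnj (fourier_integral f \<xi>)))"
    unfolding inner'[symmetric] by (simp add: mult.assoc)
  also have "\<dots> = fourier_integral f \<xi> * cnj (fourier_integral f \<xi>)"
    unfolding fourier_integral_def by (simp flip: mult.assoc)
  finally show "fourier_integral (autocorrelation f) \<xi> = complex_of_real ((cmod (fourier_integral f \<xi>))\<^sup>2)"
    by (simp only: complex_norm_square)
qed

lemma fourier_integral_gaussian:
  fixes u :: "'a::euclidean_space"
  assumes e: "e > 0"
  shows "fourier_integral (\<lambda>\<xi>. complex_of_real (gaussian (e *\<^sub>R \<xi>))) u
    = complex_of_real ((sqrt (2 * pi) / e) ^ DIM('a) * gaussian ((2 * pi / e) *\<^sub>R u))"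
proof -
  let ?s = "(- 2 * pi / e) *\<^sub>R u"
  have "complex_of_real (sqrt (2 * pi) ^ DIM('a) * gaussian ?s)
      = e ^ DIM('a) *\<^sub>R (LINT x|lborel. complex_of_real (gaussian (0 + e *\<^sub>R x)) * cis (?s \<bullet> (0 + e *\<^sub>R x)))"
    unfolding gaussian_fourier[symmetric]
    using integral_affine[of "\<lambda>x. complex_of_real (gaussian x) * cis (?s \<bullet> x)" e 0] e by simp
  also have "(LINT x|lborel. complex_of_real (gaussian (0 + e *\<^sub>R x)) * cis (?s \<bullet> (0 + e *\<^sub>R x)))
      = fourier_integral (\<lambda>\<xi>. complex_of_real (gaussian (e *\<^sub>R \<xi>))) u"
    unfolding fourier_integral_def using e by simp
  finally have "complex_of_real (e ^ DIM('a)) * fourier_integral (\<lambda>\<xi>. complex_of_real (gaussian (e *\<^sub>R \<xi>))) u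
      = complex_of_real (sqrt (2 * pi) ^ DIM('a) * gaussian ((2 * pi / e) *\<^sub>R u))"
    by (simp add: scaleR_conv_of_real gaussian_def)
  then show ?thesis using e by (simp add: field_simps power_divide)
qed

lemma gaussian_mass: "(LINT x|lborel. complex_of_real (gaussian (x::'a::euclidean_space)))
    = complex_of_real (sqrt (2 * pi) ^ DIM('a))"
  using gaussian_fourier[of "0::'a"] by (simp add: gaussian_def)

lemma gaussian_scaled_integrable:
  assumes e: "e > 0"
  shows "integrable lborel (\<lambda>x::'a::euclidean_space. complex_of_real (gaussian (e *\<^sub>R x)))"
proof -
  have "lborel = density (distr lborel borel (\<lambda>x::'a. 0 + (1/e) *\<^sub>R x)) (\<lambda>_. \<bar>1/e\<bar> ^ DIM('a))"
    using e by (intro lborel_affine) auto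
  moreover have "integrable (density (distr lborel borel (\<lambda>x::'a. 0 + (1/e) *\<^sub>R x)) (\<lambda>_. \<bar>1/e\<bar> ^ DIM('a)))
     (\<lambda>x::'a. complex_of_real (gaussian (e *\<^sub>R x)))"
    using e gaussian_integrable[where 'a='a]
    by (simp add: integrable_density integrable_distr_eq integrable_scaleR_right)
  ultimately show ?thesis by simp
qed

text \<open>
  The multiplication formula moves the transform from the autocorrelation to the Gaussian weight.
  The transform of the weight is a Gaussian of width proportional to \<open>e\<close>, which is rescaled here to a
  fixed probability density so that \<open>e\<close> occurs only in the argument of the autocorrelation.
\<close>

lemma gaussian_regularised_norm:
  fixes f :: "'a::euclidean_space \<Rightarrow> complex"
  assumes f: "integrable lborel f" and e: "e > 0"
  shows "(LINT \<xi>|lborel. complex_of_real ((cmod (fourier_integral f \<xi>))\<^sup>2 * gaussian (e *\<^sub>R \<xi>)))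
    = (LINT v|lborel. autocorrelation f ((e / (2 * pi)) *\<^sub>R v) * complex_of_real (gaussian v / sqrt (2 * pi) ^ DIM('a)))"
proof -
  note A = autocorrelation_integrable[OF f]
  have [measurable]: "autocorrelation f \<in> borel_measurable borel" using A by auto
  have "(LINT \<xi>|lborel. complex_of_real ((cmod (fourier_integral f \<xi>))\<^sup>2 * gaussian (e *\<^sub>R \<xi>)))
      = (LINT \<xi>|lborel. fourier_integral (autocorrelation f) \<xi> * complex_of_real (gaussian (e *\<^sub>R \<xi>)))"
    by (simp add: fourier_autocorrelation[OF f])
  also have "\<dots> = (LINT u|lborel. autocorrelation f u * fourier_integral (\<lambda>\<xi>. complex_of_real (gaussian (e *\<^sub>R \<xi>))) u)"
    by (rule fourier_integral_exchange[OF A gaussian_scaled_integrable[OF e]])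
  also have "\<dots> = (LINT u|lborel. autocorrelation f u * complex_of_real ((sqrt (2 * pi) / e) ^ DIM('a) * gaussian ((2 * pi / e) *\<^sub>R u)))"
    unfolding fourier_integral_gaussian[OF e] ..
  also have "\<dots> = \<bar>e / (2 * pi)\<bar> ^ DIM('a) *\<^sub>R (LINT v|lborel. autocorrelation f (0 + (e / (2 * pi)) *\<^sub>R v)
      * complex_of_real ((sqrt (2 * pi) / e) ^ DIM('a) * gaussian ((2 * pi / e) *\<^sub>R (0 + (e / (2 * pi)) *\<^sub>R v))))"
    using e by (intro integral_affine) auto
  also have "\<dots> = (LINT v|lborel. \<bar>e / (2 * pi)\<bar> ^ DIM('a) *\<^sub>R (autocorrelation f (0 + (e / (2 * pi)) *\<^sub>R v)
      * complex_of_real ((sqrt (2 * pi) / e) ^ DIM('a) * gaussian ((2 * pi / e) *\<^sub>R (0 + (e / (2 * pi)) *\<^sub>R v)))))"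
    by (rule integral_scaleR_right[symmetric])
  also have "\<dots> = (LINT v|lborel. autocorrelation f ((e / (2 * pi)) *\<^sub>R v) * complex_of_real (gaussian v / sqrt (2 * pi) ^ DIM('a)))"
  proof (intro Bochner_Integration.integral_cong refl)
    fix v :: 'a
    have "(e / (2 * pi)) ^ DIM('a) * (sqrt (2 * pi) / e) ^ DIM('a) = ((e / (2 * pi)) * (sqrt (2 * pi) / e)) ^ DIM('a)"
      by (simp only: power_mult_distrib)
    also have "(e / (2 * pi)) * (sqrt (2 * pi) / e) = 1 / sqrt (2 * pi)"
      using e real_sqrt_mult_self[of "2 * pi"] by (simp add: field_simps)
    finally have c: "(e / (2 * pi)) ^ DIM('a) * (sqrt (2 * pi) / e) ^ DIM('a) = 1 / sqrt (2 * pi) ^ DIM('a)"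
      by (simp add: power_one_over)
    have "\<bar>e / (2 * pi)\<bar> = e / (2 * pi)" using e by simp
    moreover have "(2 * pi / e) *\<^sub>R (0 + (e / (2 * pi)) *\<^sub>R v) = v" using e by simp
    ultimately show "\<bar>e / (2 * pi)\<bar> ^ DIM('a) *\<^sub>R (autocorrelation f (0 + (e / (2 * pi)) *\<^sub>R v)
      * complex_of_real ((sqrt (2 * pi) / e) ^ DIM('a) * gaussian ((2 * pi / e) *\<^sub>R (0 + (e / (2 * pi)) *\<^sub>R v))))
      = autocorrelation f ((e / (2 * pi)) *\<^sub>R v) * complex_of_real (gaussian v / sqrt (2 * pi) ^ DIM('a))"
      using arg_cong[OF c, of "\<lambda>r. complex_of_real r * autocorrelation f ((e / (2 * pi)) *\<^sub>R v) * complex_of_real (gaussian v)"]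
      by (simp add: scaleR_conv_of_real mult_ac)
  qed
  finally show ?thesis .
qed

lemma autocorrelation_inner: "autocorrelation f u = L2_inner f (\<lambda>x. f (x - u))"
  by (simp add: autocorrelation_def L2_inner_def)

lemma autocorrelation_bound:
  assumes "f \<in> L2"
  shows "cmod (autocorrelation f u) \<le> (l2norm f)\<^sup>2"
  using cauchy_schwarz[OF assms L2_translate[OF assms, of u]] L2_measurable[OF assms]
  by (simp add: autocorrelation_inner l2norm_translate power2_eq_square)

text \<open>
  Continuity at \<open>0\<close> is continuity of translation in \<open>L\<^sup>2\<close>.
\<close>

lemma autocorrelation_tendsto_0:
  assumes f: "f \<in> L2" and u: "u \<longlonglongrightarrow> 0"
  shows "(\<lambda>n. autocorrelation f (u n)) \<longlonglongrightarrow> complex_of_real ((l2norm f)\<^sup>2)"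
  unfolding autocorrelation_inner L2_inner_self[symmetric]
proof (rule L2_inner_tendsto)
  show "(\<lambda>n. l2norm (\<lambda>x. f (x - u n) - f x)) \<longlonglongrightarrow> 0"
    using L2_translation_continuous[OF f u] by simp
qed (auto simp: l2norm_def intro: f L2_translate)

lemma gaussian_regularised_limit:
  fixes f :: "'a::euclidean_space \<Rightarrow> complex"
  assumes f: "f \<in> L2" and A [measurable]: "autocorrelation f \<in> borel_measurable borel" and u: "u \<longlonglongrightarrow> 0"
  shows "(\<lambda>n. LINT v|lborel. autocorrelation f (u n *\<^sub>R v) * complex_of_real (gaussian v / sqrt (2 * pi) ^ DIM('a)))
    \<longlonglongrightarrow> complex_of_real ((l2norm f)\<^sup>2)"
proof -
  let ?N = "\<lambda>v::'a. complex_of_real (gaussian v / sqrt (2 * pi) ^ DIM('a))"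
  have N: "integrable lborel ?N"
    using gaussian_integrable[where 'a='a] by simp
  have "(\<lambda>n. LINT v|lborel. autocorrelation f (u n *\<^sub>R v) * ?N v)
      \<longlonglongrightarrow> (LINT v|lborel. complex_of_real ((l2norm f)\<^sup>2) * ?N v)"
  proof (rule integral_dominated_convergence[where w="\<lambda>v. (l2norm f)\<^sup>2 * cmod (?N v)"])
    show "AE v in lborel. (\<lambda>n. autocorrelation f (u n *\<^sub>R v) * ?N v) \<longlonglongrightarrow> complex_of_real ((l2norm f)\<^sup>2) * ?N v"
    proof (rule AE_I2)
      fix v :: 'a
      have "(\<lambda>n. u n *\<^sub>R v) \<longlonglongrightarrow> 0 *\<^sub>R v" by (intro tendsto_intros u)
      then show "(\<lambda>n. autocorrelation f (u n *\<^sub>R v) * ?N v) \<longlonglongrightarrow> complex_of_real ((l2norm f)\<^sup>2) * ?N v"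
        by (intro tendsto_mult tendsto_const autocorrelation_tendsto_0[OF f]) simp
    qed
    show "AE v in lborel. norm (autocorrelation f (u n *\<^sub>R v) * ?N v) \<le> (l2norm f)\<^sup>2 * cmod (?N v)" for n
      unfolding norm_mult by (intro AE_I2 mult_right_mono autocorrelation_bound f) simp
    show "integrable lborel (\<lambda>v. (l2norm f)\<^sup>2 * cmod (?N v))"
      by (intro integrable_mult_right integrable_norm N)
  qed measurable
  also have "(LINT v|lborel. complex_of_real ((l2norm f)\<^sup>2) * ?N v) = complex_of_real ((l2norm f)\<^sup>2)"
    using gaussian_mass[where 'a='a] by simp
  finally show ?thesis .
qed

text \<open>
  The weights \<open>gaussian (e *\<^sub>R \<xi>)\<close> increase to \<open>1\<close> as \<open>e\<close> decreases to \<open>0\<close>. By monotone convergence the weighted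
  integrals of \<open>|fourier_integral f|\<^sup>2\<close> tend to the full integral, which is not known to be
  finite beforehand; by continuity of the autocorrelation at \<open>0\<close> they tend to the squared norm of \<open>f\<close>.
\<close>

theorem plancherel_integral:
  fixes f :: "'a::euclidean_space \<Rightarrow> complex"
  assumes f: "f \<in> L2" and f1: "integrable lborel f"
  shows "fourier_integral f \<in> L2" and "l2norm (fourier_integral f) = l2norm f"
proof -
  let ?F = "fourier_integral f"
  let ?e = "\<lambda>n. 1 / real (Suc n)"
  have [measurable]: "?F \<in> borel_measurable borel" by (rule fourier_integral_measurable[OF f1])
  have [measurable]: "autocorrelation f \<in> borel_measurable borel"
    using autocorrelation_integrable[OF f1] by auto
  let ?I = "\<lambda>n. LINT \<xi>|lborel. (cmod (?F \<xi>))\<^sup>2 * gaussian (?e n *\<^sub>R \<xi>)"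
  have "integrable lborel (\<lambda>\<xi>. (complex_of_real ((cmod (?F \<xi>))\<^sup>2)) * complex_of_real (gaussian (?e n *\<^sub>R \<xi>)))" for n
    by (rule integrable_bounded_mult[where C="(LINT x|lborel. cmod (f x))\<^sup>2"])
       (auto intro!: gaussian_scaled_integrable power_mono fourier_integral_bound simp: norm_power)
  then have int: "integrable lborel (\<lambda>\<xi>. (cmod (?F \<xi>))\<^sup>2 * gaussian (?e n *\<^sub>R \<xi>))" for n
    by (subst complex_of_real_integrable_eq[symmetric]) simp
  have "(\<lambda>n. ?e n / (2 * pi)) \<longlonglongrightarrow> 0 / (2 * pi)"
    by (intro tendsto_intros LIMSEQ_Suc lim_1_over_n) auto
  then have "(\<lambda>n. LINT v|lborel. autocorrelation f ((?e n / (2 * pi)) *\<^sub>R v) * complex_of_real (gaussian v / sqrt (2 * pi) ^ DIM('a)))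
    \<longlonglongrightarrow> complex_of_real ((l2norm f)\<^sup>2)"
    by (intro gaussian_regularised_limit[OF f]) simp_all
  moreover have "(LINT v|lborel. autocorrelation f ((?e n / (2 * pi)) *\<^sub>R v) * complex_of_real (gaussian v / sqrt (2 * pi) ^ DIM('a)))
      = complex_of_real (?I n)" for n
    unfolding integral_complex_of_real[symmetric]
    by (rule gaussian_regularised_norm[OF f1, symmetric]) simp
  ultimately have "(\<lambda>n. complex_of_real (?I n)) \<longlonglongrightarrow> complex_of_real ((l2norm f)\<^sup>2)"
    by simp
  then have lim: "(\<lambda>n. ennreal (?I n)) \<longlonglongrightarrow> ennreal ((l2norm f)\<^sup>2)"
    by (intro tendsto_ennrealI) (simp only: tendsto_of_real_iff)
  have "(\<lambda>n. \<integral>\<^sup>+\<xi>. ennreal ((cmod (?F \<xi>))\<^sup>2 * gaussian (?e n *\<^sub>R \<xi>)) \<partial>lborel)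
      \<longlonglongrightarrow> (\<integral>\<^sup>+\<xi>. ennreal ((cmod (?F \<xi>))\<^sup>2) \<partial>lborel)"
  proof (rule nn_integral_LIMSEQ)
    show "incseq (\<lambda>n \<xi>. ennreal ((cmod (?F \<xi>))\<^sup>2 * gaussian (?e n *\<^sub>R \<xi>)))"
    proof (intro incseq_SucI le_funI ennreal_leI mult_left_mono)
      fix n and \<xi> :: 'a
      have "norm (?e (Suc n) *\<^sub>R \<xi>) \<le> norm (?e n *\<^sub>R \<xi>)"
        by (auto intro!: mult_right_mono simp: frac_le)
      then show "gaussian (?e n *\<^sub>R \<xi>) \<le> gaussian (?e (Suc n) *\<^sub>R \<xi>)"
        unfolding gaussian_def by (auto intro!: power_mono simp del: norm_scaleR)
    qed simp
    fix \<xi> :: 'a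
    have "(\<lambda>n. gaussian (?e n *\<^sub>R \<xi>)) \<longlonglongrightarrow> gaussian (0 *\<^sub>R \<xi>)"
      unfolding gaussian_def by (intro tendsto_intros LIMSEQ_Suc lim_1_over_n) auto
    then have "(\<lambda>n. ennreal ((cmod (?F \<xi>))\<^sup>2 * gaussian (?e n *\<^sub>R \<xi>))) \<longlonglongrightarrow> ennreal ((cmod (?F \<xi>))\<^sup>2 * gaussian (0 *\<^sub>R \<xi>))"
      by (intro tendsto_intros)
    then show "(\<lambda>n. ennreal ((cmod (?F \<xi>))\<^sup>2 * gaussian (?e n *\<^sub>R \<xi>))) \<longlonglongrightarrow> ennreal ((cmod (?F \<xi>))\<^sup>2)"
      by (simp add: gaussian_def)
  qed measurable
  also have "(\<lambda>n. \<integral>\<^sup>+\<xi>. ennreal ((cmod (?F \<xi>))\<^sup>2 * gaussian (?e n *\<^sub>R \<xi>)) \<partial>lborel) = (\<lambda>n. ennreal (?I n))"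
    using int by (intro ext nn_integral_eq_integral) (auto simp: gaussian_def)
  finally have eq: "(\<integral>\<^sup>+\<xi>. ennreal ((cmod (?F \<xi>))\<^sup>2) \<partial>lborel) = ennreal ((l2norm f)\<^sup>2)"
    using lim LIMSEQ_unique by blast
  show F: "?F \<in> L2"
    by (rule L2_I_nn_integral[where c="(l2norm f)\<^sup>2"]) (simp_all add: eq)
  have "(l2norm ?F)\<^sup>2 = (l2norm f)\<^sup>2"
    using eq unfolding nn_integral_l2norm[OF F] by simp
  then show "l2norm ?F = l2norm f" by simp
qed


section \<open>The Fourier transform on square-integrable functions\<close>

lemma fourier_integral_isometry:
  assumes "f \<in> L2" "integrable lborel f" "g \<in> L2" "integrable lborel g"
  shows "l2norm (\<lambda>x. fourier_integral f x - fourier_integral g x) = l2norm (\<lambda>x. f x - g x)"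
proof -
  have "fourier_integral (\<lambda>x. f x - g x) = (\<lambda>x. fourier_integral f x - fourier_integral g x)"
    using assms by (intro ext fourier_integral_diff)
  then show ?thesis
    using plancherel_integral(2)[OF L2_diff[OF assms(1,3)]] assms by simp
qed

text \<open>
  This shows that the choice in the definition of \<open>fourier\<close> is made from a nonempty set: by
  Plancherel's identity, the Fourier integrals of an approximating sequence in \<open>L\<^sup>1 \<inter> L\<^sup>2\<close> are Cauchy.
\<close>

lemma fourier_spec:
  assumes f: "f \<in> L2"
  shows "fourier f \<in> L2 \<and> (\<exists>fs :: nat \<Rightarrow> 'a::euclidean_space \<Rightarrow> complex.
        (\<forall>n. fs n \<in> L2 \<and> integrable lborel (fs n)) \<and> L2_tendsto fs f sequentially \<and>
        L2_tendsto (\<lambda>n. fourier_integral (fs n)) (fourier f) sequentially)"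
proof -
  obtain fs where fs: "\<And>n. fs n \<in> L2" "\<And>n. integrable lborel (fs n)"
    "(\<lambda>n. l2norm (\<lambda>x. fs n x - f x)) \<longlonglongrightarrow> 0"
    using integrable_L2_dense[OF f] by blast
  note F = plancherel_integral(1)[OF fs(1,2)]
  obtain h where h: "h \<in> L2" "(\<lambda>n. l2norm (\<lambda>x. fourier_integral (fs n) x - h x)) \<longlonglongrightarrow> 0"
  proof (rule L2_complete[OF F])
    fix e :: real assume "e > 0"
    then obtain N where N: "\<And>n. n \<ge> N \<Longrightarrow> l2norm (\<lambda>x. fs n x - f x) < e/2"
      using order_tendstoD(2)[OF fs(3), of "e/2"] by (auto simp: eventually_sequentially)
    have "l2norm (\<lambda>x. fourier_integral (fs m) x - fourier_integral (fs n) x) < e" if "m \<ge> N" "n \<ge> N" for m n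
    proof -
      have "l2norm (\<lambda>x. fs m x - fs n x) \<le> l2norm (\<lambda>x. fs m x - f x) + l2norm (\<lambda>x. f x - fs n x)"
        by (rule l2norm_triangle3[OF fs(1) f fs(1)])
      also have "\<dots> < e" using N[OF that(1)] N[OF that(2)] l2norm_minus_commute[of f "fs n"] by linarith
      finally show ?thesis by (simp add: fourier_integral_isometry fs)
    qed
    then show "\<exists>N. \<forall>m\<ge>N. \<forall>n\<ge>N. l2norm (\<lambda>x. fourier_integral (fs m) x - fourier_integral (fs n) x) < e"
      by blast
  qed
  have "\<exists>h. h \<in> L2 \<and> (\<exists>fs :: nat \<Rightarrow> 'a \<Rightarrow> complex. (\<forall>n. fs n \<in> L2 \<and> integrable lborel (fs n)) \<and> L2_tendsto fs f sequentially \<and>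
      L2_tendsto (\<lambda>n. fourier_integral (fs n)) h sequentially)"
    using h fs F f by (intro exI[of _ h] conjI exI[of _ fs]) (simp_all add: L2_tendsto_iff)
  from someI_ex[OF this] show ?thesis unfolding fourier_def .
qed

lemma fourier_L2: "f \<in> L2 \<Longrightarrow> fourier f \<in> L2"
  using fourier_spec by blast

text \<open>
  The sequence hidden in the definition of \<open>fourier\<close> may be replaced by any other one with the same
  limit. The remaining properties of \<open>fourier\<close> are derived from this lemma.
\<close>

lemma fourier_tendsto:
  assumes f: "f \<in> L2" and fs: "\<And>n. fs n \<in> L2" "\<And>n. integrable lborel (fs n)"
    and lim: "(\<lambda>n. l2norm (\<lambda>x. fs n x - f x)) \<longlonglongrightarrow> 0"
  shows "(\<lambda>n. l2norm (\<lambda>x. fourier_integral (fs n) x - fourier f x)) \<longlonglongrightarrow> 0"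
proof -
  obtain gs where gs: "\<And>n. gs n \<in> L2" "\<And>n. integrable lborel (gs n)"
    and glim: "L2_tendsto gs f sequentially"
      "L2_tendsto (\<lambda>n. fourier_integral (gs n)) (fourier f) sequentially"
    using fourier_spec[OF f] by blast
  note F = plancherel_integral(1)[OF fs] plancherel_integral(1)[OF gs] fourier_L2[OF f]
  have glim': "(\<lambda>n. l2norm (\<lambda>x. gs n x - f x)) \<longlonglongrightarrow> 0"
    "(\<lambda>n. l2norm (\<lambda>x. fourier_integral (gs n) x - fourier f x)) \<longlonglongrightarrow> 0"
    using glim gs F f by (simp_all add: L2_tendsto_iff)
  have le: "l2norm (\<lambda>x. fourier_integral (fs n) x - fourier f x)
      \<le> l2norm (\<lambda>x. fs n x - f x) + l2norm (\<lambda>x. gs n x - f x)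
        + l2norm (\<lambda>x. fourier_integral (gs n) x - fourier f x)" for n
    using l2norm_triangle3[OF F(1) F(2) F(3), of n n] l2norm_triangle3[OF fs(1) f gs(1), of n n]
    by (simp add: fourier_integral_isometry fs gs l2norm_minus_commute[of f])
  show ?thesis
  proof (rule tendsto_sandwich[OF _ _ tendsto_const])
    show "(\<lambda>n. l2norm (\<lambda>x. fs n x - f x) + l2norm (\<lambda>x. gs n x - f x)
        + l2norm (\<lambda>x. fourier_integral (gs n) x - fourier f x)) \<longlonglongrightarrow> 0"
      using tendsto_add[OF tendsto_add[OF lim glim'(1)] glim'(2)] by simp
  qed (use le in auto)
qed

theorem plancherel:
  assumes f: "f \<in> L2"
  shows "l2norm (fourier f) = l2norm f"
proof -
  obtain fs where fs: "\<And>n. fs n \<in> L2" "\<And>n. integrable lborel (fs n)"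
    "(\<lambda>n. l2norm (\<lambda>x. fs n x - f x)) \<longlonglongrightarrow> 0"
    using integrable_L2_dense[OF f] by blast
  have "(\<lambda>n. l2norm (fourier_integral (fs n))) \<longlonglongrightarrow> l2norm (fourier f)"
    by (rule l2norm_tendsto[OF fourier_tendsto[OF f fs] plancherel_integral(1)[OF fs(1,2)] fourier_L2[OF f]])
  then have "(\<lambda>n. l2norm (fs n)) \<longlonglongrightarrow> l2norm (fourier f)"
    by (simp add: plancherel_integral(2) fs)
  then show ?thesis
    using l2norm_tendsto[OF fs(3,1) f] LIMSEQ_unique by blast
qed

lemma fourier_diff:
  assumes f: "f \<in> L2" and g: "g \<in> L2"
  shows "AE x in lborel. fourier (\<lambda>x. f x - g x) x = fourier f x - fourier g x"
proof -
  obtain fs where fs: "\<And>n. fs n \<in> L2" "\<And>n. integrable lborel (fs n)"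
    "(\<lambda>n. l2norm (\<lambda>x. fs n x - f x)) \<longlonglongrightarrow> 0"
    using integrable_L2_dense[OF f] by blast
  obtain gs where gs: "\<And>n. gs n \<in> L2" "\<And>n. integrable lborel (gs n)"
    "(\<lambda>n. l2norm (\<lambda>x. gs n x - g x)) \<longlonglongrightarrow> 0"
    using integrable_L2_dense[OF g] by blast
  note F = plancherel_integral(1)[OF fs(1,2)] plancherel_integral(1)[OF gs(1,2)]
  have sandwich: "(\<lambda>n. l2norm (\<lambda>x. as n x - bs n x - (a x - b x))) \<longlonglongrightarrow> 0"
    if "\<And>n. as n \<in> L2" "\<And>n. bs n \<in> L2" "a \<in> L2" "b \<in> L2"
      "(\<lambda>n. l2norm (\<lambda>x. as n x - a x)) \<longlonglongrightarrow> 0" "(\<lambda>n. l2norm (\<lambda>x. bs n x - b x)) \<longlonglongrightarrow> 0"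
    for as bs :: "nat \<Rightarrow> 'a \<Rightarrow> complex" and a b
  proof (rule tendsto_sandwich[OF _ _ tendsto_const])
    have "l2norm (\<lambda>x. as n x - bs n x - (a x - b x)) \<le> l2norm (\<lambda>x. as n x - a x) + l2norm (\<lambda>x. bs n x - b x)" for n
      using l2norm_triangle_diff[OF L2_diff[OF that(1,3)] L2_diff[OF that(2,4)], of n n] by (simp add: algebra_simps)
    then show "\<forall>\<^sub>F n in sequentially. l2norm (\<lambda>x. as n x - bs n x - (a x - b x))
        \<le> l2norm (\<lambda>x. as n x - a x) + l2norm (\<lambda>x. bs n x - b x)" by simp
    show "(\<lambda>n. l2norm (\<lambda>x. as n x - a x) + l2norm (\<lambda>x. bs n x - b x)) \<longlonglongrightarrow> 0"
      using tendsto_add[OF that(5,6)] by simp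
  qed simp
  have "(\<lambda>n. l2norm (\<lambda>x. fourier_integral (\<lambda>x. fs n x - gs n x) x - fourier (\<lambda>x. f x - g x) x)) \<longlonglongrightarrow> 0"
    by (intro fourier_tendsto L2_diff f g fs(1) gs(1) Bochner_Integration.integrable_diff fs(2) gs(2)
        sandwich[OF fs(1) gs(1) f g fs(3) gs(3)])
  then have "(\<lambda>n. l2norm (\<lambda>x. fourier_integral (fs n) x - fourier_integral (gs n) x - fourier (\<lambda>x. f x - g x) x)) \<longlonglongrightarrow> 0"
    by (simp add: fourier_integral_diff fs gs)
  moreover have "(\<lambda>n. l2norm (\<lambda>x. fourier_integral (fs n) x - fourier_integral (gs n) x - (fourier f x - fourier g x))) \<longlonglongrightarrow> 0"
    by (intro sandwich F fourier_L2 f g fourier_tendsto fs gs)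
  ultimately show ?thesis
    by (rule L2_tendsto_unique) (auto simp: l2norm_def intro: L2_diff F fourier_L2 f g)
qed

lemma fourier_isometry:
  assumes f: "f \<in> L2" and g: "g \<in> L2"
  shows "l2norm (\<lambda>x. fourier f x - fourier g x) = l2norm (\<lambda>x. f x - g x)"
proof -
  have "l2norm (\<lambda>x. fourier f x - fourier g x) = l2norm (fourier (\<lambda>x. f x - g x))"
    using fourier_diff[OF f g]
    by (intro l2norm_AE_cong L2_measurable L2_diff fourier_L2 f g) (auto elim: AE_mp)
  then show ?thesis by (simp add: plancherel L2_diff f g)
qed

lemma fourier_inj:
  fixes f g :: "'a::euclidean_space \<Rightarrow> complex"
  assumes f: "f \<in> L2" and g: "g \<in> L2" and eq: "AE x in lborel. fourier f x = fourier g x"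
  shows "AE x in lborel. f x = g x"
proof -
  have "l2norm (\<lambda>x. fourier f x - fourier g x) = l2norm (\<lambda>x::'a. 0)"
    using eq by (intro l2norm_AE_cong L2_measurable L2_diff fourier_L2 f g) auto
  then have "l2norm (\<lambda>x. f x - g x) = 0"
    by (simp add: fourier_isometry f g) (simp add: l2norm_def)
  then show ?thesis by (rule l2norm_diff_eq_0[OF f g])
qed

subsection \<open>Inversion\<close>

definition inv_fourier_integral :: "('a::euclidean_space \<Rightarrow> complex) \<Rightarrow> 'a \<Rightarrow> complex" where
  "inv_fourier_integral h x = fourier_integral h (- x)"

lemma inv_fourier_integral_eq:
  "inv_fourier_integral h x = (LINT \<xi>|lborel. h \<xi> * cis (2 * pi * (x \<bullet> \<xi>)))"
  by (simp add: inv_fourier_integral_def fourier_integral_def)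

lemma L2_reflect: "f \<in> L2 \<Longrightarrow> (\<lambda>x. f (- x)) \<in> L2"
  unfolding L2_def using integrable_reflect[of "\<lambda>x. (cmod (f x))\<^sup>2" 0]
  by (auto intro: measurable_compose[of uminus borel borel])

lemma l2norm_reflect: "f \<in> borel_measurable borel \<Longrightarrow> l2norm (\<lambda>x. f (- x)) = l2norm f"
  unfolding l2norm_def using integral_reflect[of "\<lambda>x. (cmod (f x))\<^sup>2" 0] by simp

lemma inv_fourier_integral_continuous:
  assumes "integrable lborel h"
  shows "continuous_on UNIV (inv_fourier_integral h)"
proof -
  have "continuous_on UNIV (fourier_integral h \<circ> uminus)"
    by (intro continuous_on_compose continuous_intros continuous_on_subset[OF fourier_integral_continuous[OF assms]]) auto
  then show ?thesis by (simp add: inv_fourier_integral_def o_def cong: continuous_on_cong)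
qed

lemma
  assumes "h \<in> L2" "integrable lborel h"
  shows inv_fourier_integral_L2: "inv_fourier_integral h \<in> L2"
    and l2norm_inv_fourier_integral: "l2norm (inv_fourier_integral h) = l2norm h"
proof -
  have eq: "inv_fourier_integral h = (\<lambda>x. fourier_integral h (- x))"
    by (simp add: inv_fourier_integral_def fun_eq_iff)
  show "inv_fourier_integral h \<in> L2"
    unfolding eq by (rule L2_reflect[OF plancherel_integral(1)[OF assms]])
  show "l2norm (inv_fourier_integral h) = l2norm h"
    unfolding eq using plancherel_integral(2)[OF assms] assms
    by (subst l2norm_reflect) (auto intro: fourier_integral_measurable)
qed

lemma fourier_integral_cnj: "fourier_integral (\<lambda>x. cnj (h x)) x = cnj (inv_fourier_integral h x)"
  unfolding inv_fourier_integral_def fourier_integral_def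
  by (subst Bochner_Integration.integral_cnj[symmetric]) (simp add: cis_cnj)

lemma fourier_adjoint:
  assumes f: "f \<in> L2" and h: "h \<in> L2" "integrable lborel h"
  shows "L2_inner (fourier f) h = L2_inner f (inv_fourier_integral h)"
proof -
  obtain fs where fs: "\<And>n. fs n \<in> L2" "\<And>n. integrable lborel (fs n)"
    "(\<lambda>n. l2norm (\<lambda>x. fs n x - f x)) \<longlonglongrightarrow> 0"
    using integrable_L2_dense[OF f] by blast
  have c: "(\<lambda>n::nat. l2norm (\<lambda>x. k x - k x)) \<longlonglongrightarrow> 0" for k :: "'a \<Rightarrow> complex"
    by (simp add: l2norm_def)
  have "L2_inner (fourier_integral (fs n)) h = L2_inner (fs n) (inv_fourier_integral h)" for n
    unfolding L2_inner_def
    using fourier_integral_exchange[OF fs(2)[of n] integrable_cnj[OF h(2)]]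
    by (simp add: fourier_integral_cnj)
  moreover have "(\<lambda>n. L2_inner (fourier_integral (fs n)) h) \<longlonglongrightarrow> L2_inner (fourier f) h"
    by (rule L2_inner_tendsto[OF fourier_tendsto[OF f fs] plancherel_integral(1)[OF fs(1,2)] fourier_L2[OF f] c h(1) h(1)])
  moreover have "(\<lambda>n. L2_inner (fs n) (inv_fourier_integral h)) \<longlonglongrightarrow> L2_inner f (inv_fourier_integral h)"
    by (rule L2_inner_tendsto[OF fs(3,1) f c inv_fourier_integral_L2[OF h] inv_fourier_integral_L2[OF h]])
  ultimately show ?thesis using LIMSEQ_unique by auto
qed

text \<open>
  With \<open>v = inv_fourier_integral h\<close>, the adjoint relation gives
  \<open>\<langle>fourier v, h\<rangle> = \<langle>v, v\<rangle> = \<parallel>h\<parallel>\<^sup>2\<close>, while both \<open>fourier v\<close> and \<open>h\<close> have norm \<open>\<parallel>h\<parallel>\<close>. Expanding the square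
  of the distance between the two gives \<open>0\<close>.
\<close>

theorem fourier_inversion:
  assumes h: "h \<in> L2" "integrable lborel h"
  shows "AE \<xi> in lborel. fourier (inv_fourier_integral h) \<xi> = h \<xi>"
proof -
  note I = inv_fourier_integral_L2[OF h]
  note F = fourier_L2[OF I]
  have "L2_inner (fourier (inv_fourier_integral h)) h = complex_of_real ((l2norm h)\<^sup>2)"
    by (simp only: fourier_adjoint[OF I h] L2_inner_self l2norm_inv_fourier_integral[OF h])
  then have "(l2norm (\<lambda>x. fourier (inv_fourier_integral h) x - h x))\<^sup>2 = 0"
    unfolding l2norm_diff_square[OF F h(1)]
    by (simp add: plancherel I l2norm_inv_fourier_integral[OF h])
  then show ?thesis by (intro l2norm_diff_eq_0 F h) simp
qed

text \<open>
  The function \<open>h'\<close> is only assumed to agree with \<open>h\<close> almost everywhere because \<open>inv_fourier\<close> is applied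
  to products of chosen representatives of Fourier transforms.
\<close>

lemma inv_fourier_eq_integral:
  assumes h: "h \<in> L2" "integrable lborel h" and h': "AE \<xi> in lborel. h' \<xi> = h \<xi>"
  shows "inv_fourier h' \<in> L2" "AE x in lborel. inv_fourier h' x = inv_fourier_integral h x"
    "AE \<xi> in lborel. fourier (inv_fourier h') \<xi> = h \<xi>"
proof -
  have "inv_fourier h' \<in> L2 \<and> (AE \<xi> in lborel. fourier (inv_fourier h') \<xi> = h' \<xi>)"
    unfolding inv_fourier_def
  proof (rule someI[of _ "inv_fourier_integral h"], intro conjI inv_fourier_integral_L2 h)
    show "AE \<xi> in lborel. fourier (inv_fourier_integral h) \<xi> = h' \<xi>"
      using fourier_inversion[OF h] h' by eventually_elim simp
  qed
  then show L2: "inv_fourier h' \<in> L2" and F: "AE \<xi> in lborel. fourier (inv_fourier h') \<xi> = h \<xi>"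
    using h' by (auto elim: eventually_elim2)
  have "AE \<xi> in lborel. fourier (inv_fourier h') \<xi> = fourier (inv_fourier_integral h) \<xi>"
    using F fourier_inversion[OF h] by eventually_elim simp
  then show "AE x in lborel. inv_fourier h' x = inv_fourier_integral h x"
    by (rule fourier_inj[OF L2 inv_fourier_integral_L2[OF h]])
qed


section \<open>Fourier series on a box\<close>

subsection \<open>The box, the lattice, and the product of sincs\<close>

text \<open>
  A box and its dual lattice are described by one edge length for each coordinate direction:
  \<open>period_lattice l\<close> has period \<open>l b\<close> in the direction \<open>b\<close>, and the box \<open>cell l\<close> has edge \<open>1 / l b\<close>.
  This treats the position and frequency coordinates of phase space uniformly.
\<close>

definition cell :: "('a::euclidean_space \<Rightarrow> real) \<Rightarrow> 'a set" where
  "cell l = {z. \<forall>b\<in>Basis. \<bar>z \<bullet> b\<bar> \<le> 1 / (2 * l b)}"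

definition period_lattice :: "('a::euclidean_space \<Rightarrow> real) \<Rightarrow> 'a set" where
  "period_lattice l = {\<mu>. \<forall>b\<in>Basis. \<exists>k::int. \<mu> \<bullet> b = l b * of_int k}"

definition sinc_prod :: "('a::euclidean_space \<Rightarrow> real) \<Rightarrow> 'a \<Rightarrow> real" where
  "sinc_prod l z = (\<Prod>b\<in>Basis. sinc (pi * (z \<bullet> b) / l b))"

definition cell_volume :: "('a::euclidean_space \<Rightarrow> real) \<Rightarrow> real" where
  "cell_volume l = (\<Prod>b\<in>Basis. 1 / l b)"

lemma cell_cbox:
  "cell l = cbox (- (\<Sum>b\<in>Basis. (1 / (2 * l b)) *\<^sub>R b)) (\<Sum>b\<in>Basis. (1 / (2 * l b)) *\<^sub>R b)"
  by (fastforce simp: cell_def cbox_def abs_le_iff)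

lemma cell_compact: "compact (cell l)" and cell_borel [measurable]: "cell l \<in> sets borel"
  and cell_bounded: "bounded (cell l)" and cell_finite: "emeasure lborel (cell l) < top"
  unfolding cell_cbox by (auto intro: finite_measure_bounded)

lemma
  assumes "A \<in> sets M" "emeasure M A < top"
  shows integrable_complex_indicator: "integrable M (\<lambda>x. indicator A x :: complex)"
    and integral_complex_indicator: "(LINT x|M. indicator A x :: complex) = complex_of_real (measure M A)"
proof -
  have eq: "(\<lambda>x. indicator A x :: complex) = (\<lambda>x. complex_of_real (indicator A x))"
    by (simp add: of_real_indicator)
  show "integrable M (\<lambda>x. indicator A x :: complex)"
    unfolding eq using assms by (intro integrable_of_real integrable_real_indicator) auto
  have "A \<inter> space M = A" using sets.sets_into_space[OF assms(1)] by blast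
  then show "(LINT x|M. indicator A x :: complex) = complex_of_real (measure M A)"
    unfolding eq integral_complex_of_real using assms by simp
qed

lemma integral_interval_cis:
  assumes r: "r > 0"
  shows "(LINT t|lborel. indicator {-r..r} t * cis (s * t)) = complex_of_real (2 * r * sinc (s * r))"
proof (cases "s = 0")
  case True
  have "(LINT t|lborel. indicator {-r..r} t :: complex) = complex_of_real (measure lborel {-r..r})"
    by (intro integral_complex_indicator) (use r in auto)
  then show ?thesis using r True by simp
next
  case False
  have "(LINT t|lborel. indicator {-r..r} t * cis (s * t)) = (LINT t|lborel. indicator {-r..r} t *\<^sub>R cis (s * t))"
    by (intro Bochner_Integration.integral_cong refl) (simp split: split_indicator)
  also have "\<dots> = (- \<i> / s) * cis (s * r) - (- \<i> / s) * cis (s * (- r))"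
  proof (rule integral_FTC_atLeastAtMost)
    show "((\<lambda>t. (- \<i> / s) * cis (s * t)) has_vector_derivative cis (s * x)) (at x within {-r..r})" for x
      unfolding cis_conv_exp using False
      by (auto intro!: derivative_eq_intros has_vector_derivative_real_field simp: field_simps)
    show "continuous_on {-r..r} (\<lambda>t. cis (s * t))" by (intro continuous_intros)
  qed (use r in simp)
  also have "\<dots> = complex_of_real (2 * sin (s * r) / s)"
    using False by (simp add: complex_eq_iff cis.ctr field_simps)
  also have "\<dots> = complex_of_real (2 * r * sinc (s * r))"
    using False r by simp
  finally show ?thesis .
qed

lemma indicator_cell_prod:
  "(indicator (cell l) z :: complex) = (\<Prod>b\<in>Basis. indicator {- (1 / (2 * l b)) .. 1 / (2 * l b)} (z \<bullet> b))"
proof (cases "z \<in> cell l")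
  case True
  then have "(\<Prod>b\<in>Basis. indicator {- (1 / (2 * l b)) .. 1 / (2 * l b)} (z \<bullet> b)) = (\<Prod>b\<in>(Basis::'a set). (1::complex))"
    by (intro prod.cong refl) (auto simp: cell_def abs_le_iff indicator_def)
  then show ?thesis using True by simp
next
  case False
  then obtain b where "b \<in> Basis" "\<not> \<bar>z \<bullet> b\<bar> \<le> 1 / (2 * l b)" by (auto simp: cell_def)
  then have "\<exists>b\<in>Basis. (indicator {- (1 / (2 * l b)) .. 1 / (2 * l b)} (z \<bullet> b) :: complex) = 0"
    by (intro bexI[of _ b]) (auto simp: indicator_def)
  then have "(\<Prod>b\<in>Basis. indicator {- (1 / (2 * l b)) .. 1 / (2 * l b)} (z \<bullet> b)) = (0::complex)"
    by (rule prod_zero[OF finite_Basis])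
  then show ?thesis using False by simp
qed

lemma cell_inv_fourier:
  assumes l: "\<forall>b\<in>Basis. l b > 0"
  shows "inv_fourier_integral (indicator (cell l)) z = complex_of_real (cell_volume l * sinc_prod l z)"
proof -
  let ?f = "\<lambda>b t. indicator {- (1 / (2 * l b)) .. 1 / (2 * l b)} t * cis (2 * pi * (z \<bullet> b) * t)"
  have "inv_fourier_integral (indicator (cell l)) z = (LINT \<xi>|lborel. (\<Prod>b\<in>Basis. ?f b (\<xi> \<bullet> b)))"
    unfolding inv_fourier_integral_eq
  proof (intro Bochner_Integration.integral_cong refl)
    fix \<xi> :: 'a
    show "indicator (cell l) \<xi> * cis (2 * pi * (z \<bullet> \<xi>)) = (\<Prod>b\<in>Basis. ?f b (\<xi> \<bullet> b))"
      unfolding indicator_cell_prod euclidean_inner[of z \<xi>] sum_distrib_left cis_sum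
      by (simp only: prod.distrib mult.assoc)
  qed
  also have "\<dots> = (\<Prod>b\<in>Basis. (LINT t|lborel. ?f b t))"
  proof (rule integral_prod_Basis)
    fix b :: 'a assume "b \<in> Basis"
    show "integrable lborel (?f b)"
      using bspec[OF l \<open>b \<in> Basis\<close>] by (intro integrable_cis_mult integrable_complex_indicator) auto
  qed
  also have "\<dots> = (\<Prod>b\<in>Basis. complex_of_real ((1 / l b) * sinc (pi * (z \<bullet> b) / l b)))"
  proof (intro prod.cong refl)
    fix b :: 'a assume "b \<in> Basis"
    then have "l b > 0" using l by blast
    then show "(LINT t|lborel. ?f b t) = complex_of_real ((1 / l b) * sinc (pi * (z \<bullet> b) / l b))"
      using integral_interval_cis[of "1 / (2 * l b)" "2 * pi * (z \<bullet> b)"] by (simp add: mult_ac)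
  qed
  also have "\<dots> = complex_of_real (cell_volume l * sinc_prod l z)"
    by (simp only: cell_volume_def sinc_prod_def prod.distrib of_real_prod[symmetric] of_real_mult)
  finally show ?thesis .
qed

lemma cell_volume_pos: "\<forall>b\<in>Basis. l b > 0 \<Longrightarrow> cell_volume l > 0"
  unfolding cell_volume_def by (intro prod_pos) simp

lemma sinc_prod_lattice:
  assumes l: "\<forall>b\<in>Basis. l b > 0" and \<mu>: "\<mu> \<in> period_lattice l"
  shows "sinc_prod l \<mu> = (if \<mu> = 0 then 1 else 0)"
proof (cases "\<mu> = 0")
  case True
  then show ?thesis by (simp add: sinc_prod_def)
next
  case False
  then obtain b where b: "b \<in> Basis" "\<mu> \<bullet> b \<noteq> 0" using euclidean_all_zero_iff by blast
  then obtain k :: int where k: "\<mu> \<bullet> b = l b * of_int k" using \<mu> by (auto simp: period_lattice_def)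
  have "sinc (pi * (\<mu> \<bullet> b) / l b) = 0"
    using b k bspec[OF l b(1)] sin_zero_iff_int2[of "pi * of_int k"] by (simp add: mult.commute)
  then have "\<exists>b\<in>Basis. sinc (pi * (\<mu> \<bullet> b) / l b) = 0" using b(1) by blast
  then show ?thesis using False prod_zero[OF finite_Basis] unfolding sinc_prod_def by simp
qed

lemma period_lattice_diff: "\<mu> \<in> period_lattice l \<Longrightarrow> \<nu> \<in> period_lattice l \<Longrightarrow> \<mu> - \<nu> \<in> period_lattice l"
  unfolding period_lattice_def by (fastforce simp: inner_diff_left simp flip: right_diff_distrib of_int_diff)

lemma period_lattice_add: "\<mu> \<in> period_lattice l \<Longrightarrow> \<nu> \<in> period_lattice l \<Longrightarrow> \<mu> + \<nu> \<in> period_lattice l"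
  unfolding period_lattice_def by (fastforce simp: inner_add_left simp flip: distrib_left of_int_add)

lemma period_lattice_zero: "0 \<in> period_lattice l"
  unfolding period_lattice_def by (auto intro: exI[of _ 0])

lemma period_lattice_basis: "b \<in> Basis \<Longrightarrow> (l b * of_int k) *\<^sub>R b \<in> period_lattice l"
  unfolding period_lattice_def
  by (auto simp: inner_Basis intro: exI[of _ k] exI[of _ 0])

subsection \<open>Orthogonality of the exponentials\<close>

text \<open>
  The sign matches the factor that appears when a function is translated before its Fourier
  transform is taken. The indicator makes these global \<open>L\<^sup>2\<close> functions, so that no separate Hilbert
  space on the box is needed.
\<close>

definition cell_exp :: "('a::euclidean_space \<Rightarrow> real) \<Rightarrow> 'a \<Rightarrow> 'a \<Rightarrow> complex" where
  "cell_exp l \<mu> \<zeta> = indicator (cell l) \<zeta> * cis (- 2 * pi * (\<mu> \<bullet> \<zeta>))"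

lemma cell_exp_L2: "cell_exp l \<mu> \<in> L2"
proof -
  have "(\<lambda>\<zeta>. cis (- 2 * pi * (\<mu> \<bullet> \<zeta>)) * indicator (cell l) \<zeta>) \<in> L2"
    by (rule L2_bounded_mult[OF L2_indicator, where C=1]) (auto simp: cell_finite)
  then show ?thesis by (simp add: cell_exp_def[abs_def] mult.commute)
qed

lemma cell_exp_inner:
  assumes l: "\<forall>b\<in>Basis. l b > 0" and "\<mu> \<in> period_lattice l" "\<nu> \<in> period_lattice l"
  shows "L2_inner (cell_exp l \<mu>) (cell_exp l \<nu>) = (if \<mu> = \<nu> then complex_of_real (cell_volume l) else 0)"
proof -
  have "L2_inner (cell_exp l \<mu>) (cell_exp l \<nu>) = inv_fourier_integral (indicator (cell l)) (\<nu> - \<mu>)"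
    unfolding L2_inner_def inv_fourier_integral_eq cell_exp_def
    by (intro Bochner_Integration.integral_cong refl)
       (auto simp: indicator_def cis_cnj cis_mult inner_diff_left algebra_simps)
  also have "\<dots> = complex_of_real (cell_volume l * sinc_prod l (\<nu> - \<mu>))"
    by (rule cell_inv_fourier[OF l])
  also have "\<dots> = (if \<mu> = \<nu> then complex_of_real (cell_volume l) else 0)"
    using sinc_prod_lattice[OF l period_lattice_diff[OF assms(3,2)]] by auto
  finally show ?thesis .
qed

definition cell_projection :: "('a::euclidean_space \<Rightarrow> real) \<Rightarrow> ('a \<Rightarrow> complex) \<Rightarrow> 'a set \<Rightarrow> 'a \<Rightarrow> complex" where
  "cell_projection l G S \<zeta> = (\<Sum>\<mu>\<in>S. (L2_inner G (cell_exp l \<mu>) / cell_volume l) * cell_exp l \<mu> \<zeta>)"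

lemma cell_projection_L2: "cell_projection l G S \<in> L2"
  unfolding cell_projection_def by (intro L2_sum L2_cmult cell_exp_L2)

text \<open>
  The orthogonal projection onto the span of finitely many exponentials minimises the distance,
  because the error is orthogonal to that span.
\<close>

lemma cell_projection_best:
  fixes l :: "'a::euclidean_space \<Rightarrow> real"
  assumes l: "\<forall>b\<in>Basis. l b > 0" and G: "G \<in> L2" and S: "finite S" "S \<subseteq> period_lattice l"
  shows "l2norm (\<lambda>\<zeta>. cell_projection l G S \<zeta> - G \<zeta>) \<le> l2norm (\<lambda>\<zeta>. (\<Sum>\<mu>\<in>S. t \<mu> * cell_exp l \<mu> \<zeta>) - G \<zeta>)"
proof -
  let ?P = "cell_projection l G S" and ?T = "\<lambda>\<zeta>. \<Sum>\<mu>\<in>S. t \<mu> * cell_exp l \<mu> \<zeta>"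
  let ?R = "\<lambda>\<zeta>. ?P \<zeta> - G \<zeta>" and ?D = "\<lambda>\<zeta>. \<Sum>\<mu>\<in>S. (L2_inner G (cell_exp l \<mu>) / cell_volume l - t \<mu>) * cell_exp l \<mu> \<zeta>"
  have P: "?P \<in> L2" by (rule cell_projection_L2)
  have D: "?D \<in> L2" by (intro L2_sum L2_cmult cell_exp_L2)
  have R: "?R \<in> L2" by (intro L2_diff P G)
  have vol: "cell_volume l \<noteq> 0" using cell_volume_pos[OF l] by simp
  have orth: "L2_inner (cell_exp l \<nu>) ?R = 0" if "\<nu> \<in> S" for \<nu>
  proof -
    have "L2_inner ?P (cell_exp l \<nu>) = (\<Sum>\<mu>\<in>S. (L2_inner G (cell_exp l \<mu>) / cell_volume l) * L2_inner (cell_exp l \<mu>) (cell_exp l \<nu>))"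
      unfolding cell_projection_def
      by (simp only: L2_inner_sum_left[OF L2_cmult[OF cell_exp_L2] cell_exp_L2] L2_inner_cmult_left)
    also have "\<dots> = (\<Sum>\<mu>\<in>S. if \<mu> = \<nu> then L2_inner G (cell_exp l \<nu>) else 0)"
    proof (intro sum.cong refl)
      fix \<mu> assume "\<mu> \<in> S"
      then have "L2_inner (cell_exp l \<mu>) (cell_exp l \<nu>) = (if \<mu> = \<nu> then complex_of_real (cell_volume l) else 0)"
        using S that by (intro cell_exp_inner[OF l]) auto
      then show "(L2_inner G (cell_exp l \<mu>) / cell_volume l) * L2_inner (cell_exp l \<mu>) (cell_exp l \<nu>)
          = (if \<mu> = \<nu> then L2_inner G (cell_exp l \<nu>) else 0)"
        using vol by simp
    qed
    also have "\<dots> = L2_inner G (cell_exp l \<nu>)" using S(1) that by simp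
    finally have "L2_inner ?R (cell_exp l \<nu>) = 0"
      by (simp add: L2_inner_diff_left P G cell_exp_L2)
    then show ?thesis using L2_inner_cnj[of ?R "cell_exp l \<nu>"] by simp
  qed
  have "L2_inner ?D ?R = (\<Sum>\<mu>\<in>S. (L2_inner G (cell_exp l \<mu>) / cell_volume l - t \<mu>) * L2_inner (cell_exp l \<mu>) ?R)"
    by (simp only: L2_inner_sum_left[OF L2_cmult[OF cell_exp_L2] R] L2_inner_cmult_left)
  then have DR: "L2_inner ?D ?R = 0" by (simp add: orth)
  have "(\<lambda>\<zeta>. ?D \<zeta> - ?R \<zeta>) = (\<lambda>\<zeta>. G \<zeta> - ?T \<zeta>)"
    by (simp add: cell_projection_def left_diff_distrib sum_subtractf fun_eq_iff)
  then have "(l2norm (\<lambda>\<zeta>. G \<zeta> - ?T \<zeta>))\<^sup>2 = (l2norm ?D)\<^sup>2 + (l2norm ?R)\<^sup>2"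
    using l2norm_diff_square[OF D R] DR by simp
  then have "(l2norm ?R)\<^sup>2 \<le> (l2norm (\<lambda>\<zeta>. ?T \<zeta> - G \<zeta>))\<^sup>2"
    by (simp add: l2norm_minus_commute[of G])
  then show ?thesis by (rule power2_le_imp_le) simp
qed

subsection \<open>Density of trigonometric polynomials\<close>

text \<open>
  Closure under products is easy to prove from these two rules; the expansion over a finite set
  of distinct frequencies is recovered afterwards.
\<close>

inductive trig_poly :: "('a::euclidean_space \<Rightarrow> real) \<Rightarrow> ('a \<Rightarrow> complex) \<Rightarrow> bool" for l where
  exp: "\<mu> \<in> period_lattice l \<Longrightarrow> trig_poly l (\<lambda>\<zeta>. c * cis (- 2 * pi * (\<mu> \<bullet> \<zeta>)))"
| add: "trig_poly l f \<Longrightarrow> trig_poly l g \<Longrightarrow> trig_poly l (\<lambda>\<zeta>. f \<zeta> + g \<zeta>)"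

lemma trig_poly_const: "trig_poly l (\<lambda>\<zeta>. c)"
  using trig_poly.exp[OF period_lattice_zero, of l c] by simp

lemma trig_poly_sum: "(\<And>i. i \<in> I \<Longrightarrow> trig_poly l (f i)) \<Longrightarrow> trig_poly l (\<lambda>\<zeta>. \<Sum>i\<in>I. f i \<zeta>)"
  by (induction I rule: infinite_finite_induct) (auto intro: trig_poly_const trig_poly.add)

lemma trig_poly_mult:
  assumes "trig_poly l f" "trig_poly l g"
  shows "trig_poly l (\<lambda>\<zeta>. f \<zeta> * g \<zeta>)"
  using assms(1)
proof induction
  case (exp \<mu> c)
  from assms(2) show ?case
  proof induction
    case (exp \<nu> d)
    have "(\<lambda>\<zeta>. c * cis (- 2 * pi * (\<mu> \<bullet> \<zeta>)) * (d * cis (- 2 * pi * (\<nu> \<bullet> \<zeta>))))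
        = (\<lambda>\<zeta>. (c * d) * cis (- 2 * pi * ((\<mu> + \<nu>) \<bullet> \<zeta>)))"
    proof
      fix \<zeta>
      have "- 2 * pi * ((\<mu> + \<nu>) \<bullet> \<zeta>) = - 2 * pi * (\<mu> \<bullet> \<zeta>) + - 2 * pi * (\<nu> \<bullet> \<zeta>)"
        by (simp add: inner_add_left algebra_simps)
      then show "c * cis (- 2 * pi * (\<mu> \<bullet> \<zeta>)) * (d * cis (- 2 * pi * (\<nu> \<bullet> \<zeta>)))
          = (c * d) * cis (- 2 * pi * ((\<mu> + \<nu>) \<bullet> \<zeta>))"
        by (simp only: cis_mult[symmetric] mult_ac)
    qed
    then show ?case
      using trig_poly.exp[OF period_lattice_add[OF \<open>\<mu> \<in> _\<close> \<open>\<nu> \<in> _\<close>], of "c * d"] by simp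
  next
    case (add g h)
    then show ?case using trig_poly.add by (simp add: distrib_left)
  qed
next
  case (add f h)
  then show ?case using trig_poly.add by (simp add: distrib_right)
qed

lemma trig_poly_expansion:
  assumes "trig_poly l f"
  shows "\<exists>S t. finite S \<and> S \<subseteq> period_lattice l \<and> (\<forall>\<zeta>. f \<zeta> = (\<Sum>\<mu>\<in>S. t \<mu> * cis (- 2 * pi * (\<mu> \<bullet> \<zeta>))))"
  using assms
proof induction
  case (exp \<mu> c)
  then show ?case by (intro exI[of _ "{\<mu>}"] exI[of _ "\<lambda>_. c"]) simp
next
  case (add f g)
  from add.IH obtain S t S' t' where S: "finite S" "S \<subseteq> period_lattice l" "\<And>\<zeta>. f \<zeta> = (\<Sum>\<mu>\<in>S. t \<mu> * cis (- 2 * pi * (\<mu> \<bullet> \<zeta>)))"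
    and S': "finite S'" "S' \<subseteq> period_lattice l" "\<And>\<zeta>. g \<zeta> = (\<Sum>\<mu>\<in>S'. t' \<mu> * cis (- 2 * pi * (\<mu> \<bullet> \<zeta>)))"
    by (elim exE conjE) blast
  let ?t = "\<lambda>\<mu>. (if \<mu> \<in> S then t \<mu> else 0) + (if \<mu> \<in> S' then t' \<mu> else 0)"
  have "f \<zeta> + g \<zeta> = (\<Sum>\<mu>\<in>S \<union> S'. ?t \<mu> * cis (- 2 * pi * (\<mu> \<bullet> \<zeta>)))" for \<zeta>
  proof -
    have "f \<zeta> = (\<Sum>\<mu>\<in>S \<union> S'. (if \<mu> \<in> S then t \<mu> else 0) * cis (- 2 * pi * (\<mu> \<bullet> \<zeta>)))"
      unfolding S(3) by (rule sum.mono_neutral_cong_left) (use S S' in auto)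
    moreover have "g \<zeta> = (\<Sum>\<mu>\<in>S \<union> S'. (if \<mu> \<in> S' then t' \<mu> else 0) * cis (- 2 * pi * (\<mu> \<bullet> \<zeta>)))"
      unfolding S'(3) by (rule sum.mono_neutral_cong_left) (use S S' in auto)
    ultimately show ?thesis by (simp only: sum.distrib distrib_right)
  qed
  then show ?case using S S' by (intro exI[of _ "S \<union> S'"] exI[of _ ?t]) auto
qed

lemma trig_poly_cos_sin:
  assumes "b \<in> Basis"
  shows "trig_poly l (\<lambda>\<zeta>. complex_of_real (cos (2 * pi * (l b * (\<zeta> \<bullet> b)))))"
    and "trig_poly l (\<lambda>\<zeta>. complex_of_real (sin (2 * pi * (l b * (\<zeta> \<bullet> b)))))"
proof -
  note m = period_lattice_basis[OF assms, where l=l]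
  have p: "trig_poly l (\<lambda>\<zeta>. c * cis (- 2 * pi * (l b * (\<zeta> \<bullet> b))))" for c
    using trig_poly.exp[OF m[of 1], of c] by (simp add: inner_commute)
  have q: "trig_poly l (\<lambda>\<zeta>. c * cis (2 * pi * (l b * (\<zeta> \<bullet> b))))" for c
    using trig_poly.exp[OF m[of "-1"], of c] by (simp add: inner_commute)
  have "(\<lambda>\<zeta>. complex_of_real (cos (2 * pi * (l b * (\<zeta> \<bullet> b)))))
      = (\<lambda>\<zeta>. 1/2 * cis (- 2 * pi * (l b * (\<zeta> \<bullet> b))) + 1/2 * cis (2 * pi * (l b * (\<zeta> \<bullet> b))))"
    by (simp add: fun_eq_iff complex_eq_iff)
  then show "trig_poly l (\<lambda>\<zeta>. complex_of_real (cos (2 * pi * (l b * (\<zeta> \<bullet> b)))))"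
    using trig_poly.add[OF p q] by presburger
  have "(\<lambda>\<zeta>. complex_of_real (sin (2 * pi * (l b * (\<zeta> \<bullet> b)))))
      = (\<lambda>\<zeta>. (\<i>/2) * cis (- 2 * pi * (l b * (\<zeta> \<bullet> b))) + (- \<i>/2) * cis (2 * pi * (l b * (\<zeta> \<bullet> b))))"
    by (simp add: fun_eq_iff complex_eq_iff)
  then show "trig_poly l (\<lambda>\<zeta>. complex_of_real (sin (2 * pi * (l b * (\<zeta> \<bullet> b)))))"
    using trig_poly.add[OF p q] by presburger
qed

text \<open>
  The box with opposite faces identified, realised as a compact subset of Euclidean space. The
  coordinates are the cosines and sines of the angles, so that polynomials in them are
  trigonometric polynomials.
\<close>

definition torus_map :: "('a::euclidean_space \<Rightarrow> real) \<Rightarrow> 'a \<Rightarrow> 'a \<times> 'a" where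
  "torus_map l \<zeta> = ((\<Sum>b\<in>Basis. cos (2 * pi * (l b * (\<zeta> \<bullet> b))) *\<^sub>R b),
                    (\<Sum>b\<in>Basis. sin (2 * pi * (l b * (\<zeta> \<bullet> b))) *\<^sub>R b))"

lemma torus_map_continuous: "continuous_on A (torus_map l)"
  unfolding torus_map_def by (intro continuous_intros)

lemma real_polynomial_torus_map:
  assumes "real_polynomial_function p"
  shows "trig_poly l (\<lambda>\<zeta>. complex_of_real (p (torus_map l \<zeta>)))"
  using assms
proof induction
  case (linear f)
  interpret bounded_linear f by fact
  have split: "f (u, v) = f (u, 0) + f (0, v)" for u v
    using add[of "(u, 0)" "(0, v)"] by simp
  have fst_sum: "f (\<Sum>b\<in>Basis. c b *\<^sub>R b, 0) = (\<Sum>b\<in>Basis. c b * f (b, 0))" for c :: "'a \<Rightarrow> real"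
  proof -
    have "(\<Sum>b\<in>Basis. c b *\<^sub>R b, 0::'a) = (\<Sum>b\<in>Basis. c b *\<^sub>R (b, 0))"
      by (simp add: sum_prod)
    then show ?thesis by (simp only: sum scaleR) simp
  qed
  have snd_sum: "f (0, \<Sum>b\<in>Basis. c b *\<^sub>R b) = (\<Sum>b\<in>Basis. c b * f (0, b))" for c :: "'a \<Rightarrow> real"
  proof -
    have "(0::'a, \<Sum>b\<in>Basis. c b *\<^sub>R b) = (\<Sum>b\<in>Basis. c b *\<^sub>R (0, b))"
      by (simp add: sum_prod)
    then show ?thesis by (simp only: sum scaleR) simp
  qed
  have "complex_of_real (f (torus_map l \<zeta>))
     = (\<Sum>b\<in>Basis. complex_of_real (cos (2 * pi * (l b * (\<zeta> \<bullet> b)))) * complex_of_real (f (b, 0)))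
     + (\<Sum>b\<in>Basis. complex_of_real (sin (2 * pi * (l b * (\<zeta> \<bullet> b)))) * complex_of_real (f (0, b)))" for \<zeta>
    unfolding torus_map_def by (subst split) (simp add: fst_sum snd_sum)
  then show ?case
    by (auto intro!: trig_poly.add trig_poly_sum trig_poly_mult trig_poly_const trig_poly_cos_sin)
next
  case (const c)
  then show ?case by (rule trig_poly_const)
next
  case (add f g)
  then show ?case using trig_poly.add by simp
next
  case (mult f g)
  then show ?case using trig_poly_mult by simp
qed

definition open_cell :: "('a::euclidean_space \<Rightarrow> real) \<Rightarrow> 'a set" where
  "open_cell l = box (- (\<Sum>b\<in>Basis. (1 / (2 * l b)) *\<^sub>R b)) (\<Sum>b\<in>Basis. (1 / (2 * l b)) *\<^sub>R b)"

lemma open_cell_mem: "z \<in> open_cell l \<longleftrightarrow> (\<forall>b\<in>Basis. \<bar>z \<bullet> b\<bar> < 1 / (2 * l b))"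
  by (fastforce simp: open_cell_def box_def abs_less_iff)

text \<open>
  Two different points with the same image differ by an integer multiple of the edge in some
  coordinate; as both lie in the box, the difference is a full edge and both lie on the boundary.
\<close>

lemma torus_map_inj:
  assumes l: "\<forall>b\<in>Basis. l b > 0"
    and z: "z \<in> cell l" "w \<in> cell l" and eq: "torus_map l z = torus_map l w" and ne: "z \<noteq> w"
  shows "z \<notin> open_cell l"
proof -
  obtain b where b: "b \<in> Basis" "z \<bullet> b \<noteq> w \<bullet> b" using ne euclidean_eqI by blast
  have comp: "(\<Sum>b\<in>Basis. f b *\<^sub>R b) \<bullet> b = f b" for f :: "'a \<Rightarrow> real" using b(1) by simp
  have "sin (2 * pi * (l b * (z \<bullet> b))) = sin (2 * pi * (l b * (w \<bullet> b)))"
    "cos (2 * pi * (l b * (z \<bullet> b))) = cos (2 * pi * (l b * (w \<bullet> b)))"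
    using arg_cong[OF eq, of "\<lambda>p. snd p \<bullet> b"] arg_cong[OF eq, of "\<lambda>p. fst p \<bullet> b"]
    unfolding torus_map_def fst_conv snd_conv comp by auto
  then obtain n :: int where "2 * pi * (l b * (z \<bullet> b)) = 2 * pi * (l b * (w \<bullet> b)) + 2 * pi * of_int n"
    using sin_cos_eq_iff by blast
  then have "2 * pi * (l b * (z \<bullet> b)) = 2 * pi * (l b * (w \<bullet> b) + of_int n)" by (simp add: distrib_left)
  then have n: "l b * (z \<bullet> b) = l b * (w \<bullet> b) + of_int n" by simp
  have "n \<noteq> 0" using n b(2) bspec[OF l b(1)] by auto
  have zw: "\<bar>l b * (z \<bullet> b)\<bar> \<le> 1/2" "\<bar>l b * (w \<bullet> b)\<bar> \<le> 1/2"
    using z b(1) bspec[OF l b(1)] unfolding cell_def by (auto simp: abs_mult field_simps)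
  have "\<bar>of_int n :: real\<bar> \<ge> 1" using \<open>n \<noteq> 0\<close> by linarith
  then have "\<bar>l b * (z \<bullet> b)\<bar> = 1/2" using n zw by linarith
  then have "\<bar>z \<bullet> b\<bar> = 1 / (2 * l b)" using bspec[OF l b(1)] by (simp add: abs_mult field_simps)
  then show ?thesis unfolding open_cell_mem using b(1) by (metis less_irrefl)
qed

text \<open>
  A continuous function on the box that vanishes on the boundary descends to a function on the image
  of \<open>torus_map\<close>. The descended function is continuous because the box is compact: the preimage of
  a closed set is the image of a compact set. The polynomial form of the Stone--Weierstrass theorem
  on this image then provides the approximation.
\<close>

lemma trig_poly_uniform_dense:
  fixes g :: "'a::euclidean_space \<Rightarrow> complex"
  assumes l: "\<forall>b\<in>Basis. l b > 0" and g: "continuous_on UNIV g" "\<And>x. x \<notin> open_cell l \<Longrightarrow> g x = 0"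
    and e: "e > 0"
  shows "\<exists>p. trig_poly l p \<and> (\<forall>\<zeta>\<in>cell l. cmod (g \<zeta> - p \<zeta>) < e)"
proof -
  define T where "T = torus_map l ` cell l"
  define h where "h y = g (SOME \<zeta>. \<zeta> \<in> cell l \<and> torus_map l \<zeta> = y)" for y
  have h: "h (torus_map l \<zeta>) = g \<zeta>" if "\<zeta> \<in> cell l" for \<zeta>
  proof -
    define w where "w = (SOME v. v \<in> cell l \<and> torus_map l v = torus_map l \<zeta>)"
    have w: "w \<in> cell l \<and> torus_map l w = torus_map l \<zeta>"
      unfolding w_def by (rule someI[of _ \<zeta>]) (use that in simp)
    have "g w = g \<zeta>"
    proof (cases "w = \<zeta>")
      case False
      then show ?thesis
        using g(2)[OF torus_map_inj[OF l, of w \<zeta>]] g(2)[OF torus_map_inj[OF l, of \<zeta> w]] w that by simp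
    qed simp
    then show ?thesis by (simp add: h_def w_def)
  qed
  have T: "compact T"
    unfolding T_def by (intro compact_continuous_image torus_map_continuous cell_compact)
  have "continuous_on T h"
    unfolding continuous_on_closed_invariant
  proof (intro allI impI)
    fix B :: "complex set" assume B: "closed B"
    have "closed (g -` B)"
      using g(1) B by (auto simp: continuous_on_closed_vimage)
    then have "compact (cell l \<inter> g -` B)"
      by (intro compact_Int_closed cell_compact)
    then have "closed (torus_map l ` (cell l \<inter> g -` B))"
      by (intro compact_imp_closed compact_continuous_image torus_map_continuous)
    moreover have "torus_map l ` (cell l \<inter> g -` B) \<inter> T = h -` B \<inter> T"
      using h by (auto simp: T_def)
    ultimately show "\<exists>A. closed A \<and> A \<inter> T = h -` B \<inter> T" by blast
  qed
  then obtain p where p: "polynomial_function p" "\<And>y. y \<in> T \<Longrightarrow> cmod (h y - p y) < e"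
    using Stone_Weierstrass_polynomial_function[OF T _ e, of h] by blast
  have rp: "real_polynomial_function (Re \<circ> p)" "real_polynomial_function (Im \<circ> p)"
    using p(1) bounded_linear_Re bounded_linear_Im unfolding polynomial_function_def by auto
  have "trig_poly l (\<lambda>\<zeta>. complex_of_real ((Re \<circ> p) (torus_map l \<zeta>)) + \<i> * complex_of_real ((Im \<circ> p) (torus_map l \<zeta>)))"
    by (intro trig_poly.add trig_poly_mult trig_poly_const real_polynomial_torus_map[OF rp(1)] real_polynomial_torus_map[OF rp(2)])
  also have "(\<lambda>\<zeta>. complex_of_real ((Re \<circ> p) (torus_map l \<zeta>)) + \<i> * complex_of_real ((Im \<circ> p) (torus_map l \<zeta>)))
      = (\<lambda>\<zeta>. p (torus_map l \<zeta>))"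
    by (auto simp flip: complex_eq)
  finally have "trig_poly l (\<lambda>\<zeta>. p (torus_map l \<zeta>))" .
  moreover have "cmod (g \<zeta> - p (torus_map l \<zeta>)) < e" if "\<zeta> \<in> cell l" for \<zeta>
    using p(2)[of "torus_map l \<zeta>"] h[OF that] that by (simp add: T_def)
  ultimately show ?thesis by blast
qed

lemma AE_open_cell: "AE z in lborel. z \<in> cell l \<longrightarrow> z \<in> open_cell l"
proof -
  have "AE z in lborel. \<forall>b\<in>(Basis::'a set). z \<bullet> b \<noteq> 1 / (2 * l b) \<and> z \<bullet> b \<noteq> - (1 / (2 * l b))"
    by (intro AE_finite_allI finite_Basis AE_conjI AE_lborel_inner_neq)
  then show ?thesis
  proof eventually_elim
    case (elim z)
    then show ?case by (auto simp: cell_def open_cell_mem abs_le_iff abs_less_iff less_le minus_equation_iff)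
  qed
qed

text \<open>
  The faces of the box have measure zero, so \<open>G\<close> may be replaced by a function vanishing off the open
  box, then by a continuous one, and uniform approximation on the box implies approximation in
  \<open>L\<^sup>2\<close> since the box has finite measure.
\<close>

theorem trig_poly_dense:
  fixes G :: "'a::euclidean_space \<Rightarrow> complex"
  assumes l: "\<forall>b\<in>Basis. l b > 0" and G: "G \<in> L2" "\<And>\<zeta>. \<zeta> \<notin> cell l \<Longrightarrow> G \<zeta> = 0" and e: "e > 0"
  shows "\<exists>S t. finite S \<and> S \<subseteq> period_lattice l \<and> l2norm (\<lambda>\<zeta>. (\<Sum>\<mu>\<in>S. t \<mu> * cell_exp l \<mu> \<zeta>) - G \<zeta>) < e"
proof -
  define G' where "G' \<zeta> = indicator (open_cell l) \<zeta> * G \<zeta>" for \<zeta>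
  have oc: "open (open_cell l)" unfolding open_cell_def by (rule open_box)
  have G': "G' \<in> L2"
    unfolding G'_def using oc by (intro L2_bounded_mult[OF G(1), where C=1]) (auto simp: borel_measurable_indicator split: split_indicator)
  have GG': "AE \<zeta> in lborel. G' \<zeta> = G \<zeta>"
    using AE_open_cell[of l] by eventually_elim (use G(2) in \<open>auto simp: G'_def split: split_indicator\<close>)
  obtain g where g: "g \<in> continuous_in (open_cell l)" "l2norm (\<lambda>x. G' x - g x) < e/2"
    using L2_continuous_dense[OF oc G', of "e/2"] e by (auto simp: G'_def)
  have gc: "continuous_on UNIV g" "\<And>x. x \<notin> open_cell l \<Longrightarrow> g x = 0"
    using g(1) by (auto simp: continuous_in_def)
  have gL2: "g \<in> L2" by (rule continuous_in_L2[OF g(1)])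
  define V where "V = l2norm (\<lambda>x::'a. indicator (cell l) x :: complex)"
  have V: "V \<ge> 0" by (simp add: V_def)
  \<comment> \<open>Uniform distance \<open>d\<close> on the box costs at most \<open>d * V < e / 2\<close> in \<open>L\<^sup>2\<close>; the \<open>+ 1\<close> avoids dividing by zero.\<close>
  define d where "d = e / (2 * (V + 1))"
  have d: "d > 0" using e V by (simp add: d_def)
  obtain p where p: "trig_poly l p" "\<And>\<zeta>. \<zeta> \<in> cell l \<Longrightarrow> cmod (g \<zeta> - p \<zeta>) < d"
    using trig_poly_uniform_dense[OF l gc d] by blast
  obtain S t where S: "finite S" "S \<subseteq> period_lattice l" "\<And>\<zeta>. p \<zeta> = (\<Sum>\<mu>\<in>S. t \<mu> * cis (- 2 * pi * (\<mu> \<bullet> \<zeta>)))"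
    using trig_poly_expansion[OF p(1)] by blast
  let ?P = "\<lambda>\<zeta>. \<Sum>\<mu>\<in>S. t \<mu> * cell_exp l \<mu> \<zeta>"
  have P: "?P \<in> L2" by (intro L2_sum L2_cmult cell_exp_L2)
  have Pp: "?P \<zeta> = indicator (cell l) \<zeta> * p \<zeta>" for \<zeta>
    by (simp add: S(3) cell_exp_def sum_distrib_left mult_ac)
  have g0: "g \<zeta> = 0" if "\<zeta> \<notin> cell l" for \<zeta>
    using gc(2)[of \<zeta>] that by (force simp: open_cell_mem cell_def)
  have "l2norm (\<lambda>\<zeta>. ?P \<zeta> - g \<zeta>) \<le> d * V"
    unfolding V_def
  proof (rule l2norm_mono[OF L2_indicator])
    show "(\<lambda>\<zeta>. ?P \<zeta> - g \<zeta>) \<in> borel_measurable lborel" by (intro L2_measurable L2_diff P gL2)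
    show "cmod (?P \<zeta> - g \<zeta>) \<le> d * cmod (indicator (cell l) \<zeta>)" for \<zeta>
      using p(2)[of \<zeta>] g0[of \<zeta>] unfolding Pp by (cases "\<zeta> \<in> cell l") (auto simp: norm_minus_commute)
  qed (use d cell_finite in auto)
  also have "\<dots> < e / 2" using e V unfolding d_def by (simp add: field_simps add_pos_nonneg)
  finally have Pg: "l2norm (\<lambda>\<zeta>. ?P \<zeta> - g \<zeta>) < e / 2" .
  have "l2norm (\<lambda>\<zeta>. ?P \<zeta> - G \<zeta>) = l2norm (\<lambda>\<zeta>. ?P \<zeta> - G' \<zeta>)"
    using GG' by (intro l2norm_AE_cong L2_measurable L2_diff P G G') (auto elim: AE_mp)
  also have "\<dots> \<le> l2norm (\<lambda>\<zeta>. ?P \<zeta> - g \<zeta>) + l2norm (\<lambda>\<zeta>. g \<zeta> - G' \<zeta>)"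
    by (rule l2norm_triangle3[OF P gL2 G'])
  also have "\<dots> < e" using Pg g(2) l2norm_minus_commute[of g G'] by linarith
  finally show ?thesis using S by blast
qed

text \<open>
  Convergence along the net of finite subsets: once a set contains the frequencies of a good
  trigonometric polynomial, its projection is at least as good.
\<close>

theorem fourier_series_L2:
  fixes G :: "'a::euclidean_space \<Rightarrow> complex"
  assumes l: "\<forall>b\<in>Basis. l b > 0" and G: "G \<in> L2" "\<And>\<zeta>. \<zeta> \<notin> cell l \<Longrightarrow> G \<zeta> = 0"
  shows "((\<lambda>S. l2norm (\<lambda>\<zeta>. cell_projection l G S \<zeta> - G \<zeta>)) \<longlongrightarrow> 0) (finite_subsets_at_top (period_lattice l))"
proof (rule tendstoI)
  fix e :: real assume e: "e > 0"
  obtain S0 t where S0: "finite S0" "S0 \<subseteq> period_lattice l"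
    "l2norm (\<lambda>\<zeta>. (\<Sum>\<mu>\<in>S0. t \<mu> * cell_exp l \<mu> \<zeta>) - G \<zeta>) < e"
    using trig_poly_dense[OF l G(1) _ e] G(2) by blast
  have "l2norm (\<lambda>\<zeta>. cell_projection l G S \<zeta> - G \<zeta>) < e" if S: "finite S" "S0 \<subseteq> S" "S \<subseteq> period_lattice l" for S
  proof -
    have "(\<Sum>\<mu>\<in>S. (if \<mu> \<in> S0 then t \<mu> else 0) * cell_exp l \<mu> \<zeta>) = (\<Sum>\<mu>\<in>S0. t \<mu> * cell_exp l \<mu> \<zeta>)" for \<zeta>
      by (rule sum.mono_neutral_cong_right) (use S in auto)
    then show ?thesis
      using cell_projection_best[OF l G(1) S(1,3), of "\<lambda>\<mu>. if \<mu> \<in> S0 then t \<mu> else 0"] S0(3) by simp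
  qed
  then show "\<forall>\<^sub>F S in finite_subsets_at_top (period_lattice l).
      dist (l2norm (\<lambda>\<zeta>. cell_projection l G S \<zeta> - G \<zeta>)) 0 < e"
    unfolding eventually_finite_subsets_at_top using S0(1,2) by (intro exI[of _ S0]) auto
qed


section \<open>Time-frequency analysis\<close>

subsection \<open>The short-time Fourier transform\<close>

lemma stft_fourier: "stft g f (x, \<xi>) = fourier_integral (\<lambda>t. f t * cnj (g (t - x))) \<xi>"
  by (simp add: stft_def fourier_integral_def)

text \<open>
  After the rotation, the short-time Fourier transform at \<open>\<zeta>\<close> has frequency \<open>fst \<zeta>\<close>
  and shift \<open>- snd \<zeta>\<close>; it is in this form that it appears as a Fourier transform.
\<close>

lemma rotate_stft: "rotate_U (stft g f) \<zeta> = fourier_integral (\<lambda>t. f t * cnj (g (t + snd \<zeta>))) (fst \<zeta>)"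
  by (cases \<zeta>) (simp add: rotate_U_def stft_fourier)

lemma stft_integrand_integrable:
  "f \<in> L2 \<Longrightarrow> g \<in> L2 \<Longrightarrow> integrable lborel (\<lambda>t. f t * cnj (g (t - x)))"
  by (intro L2_inner_integrable L2_translate)

lemma integral_norm_L2_mult:
  assumes "f \<in> L2" "g \<in> L2"
  shows "(LINT t|lborel. cmod (f t * cnj (g t))) \<le> l2norm f * l2norm g"
  using cauchy_schwarz_norm[OF assms] by (simp add: norm_mult)

lemma stft_bound:
  assumes "f \<in> L2" "g \<in> L2"
  shows "cmod (stft g f z) \<le> l2norm f * l2norm g"
proof (cases z)
  case (Pair x \<xi>)
  have "cmod (stft g f z) \<le> (LINT t|lborel. cmod (f t * cnj (g (t - x))))"
    unfolding Pair stft_fourier by (rule fourier_integral_bound)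
  also have "\<dots> \<le> l2norm f * l2norm (\<lambda>t. g (t - x))"
    by (intro integral_norm_L2_mult L2_translate assms)
  also have "l2norm (\<lambda>t. g (t - x)) = l2norm g"
    using L2_measurable[OF assms(2)] by (intro l2norm_translate) simp
  finally show ?thesis .
qed

lemma stft_diff_left:
  assumes "f \<in> L2" "f' \<in> L2" "g \<in> L2"
  shows "stft g (\<lambda>t. f t - f' t) z = stft g f z - stft g f' z"
  using fourier_integral_diff[OF stft_integrand_integrable[OF assms(1,3), of "fst z"] stft_integrand_integrable[OF assms(2,3), of "fst z"], of "snd z"]
  by (cases z) (simp add: stft_fourier left_diff_distrib)

lemma stft_diff_right:
  assumes "f \<in> L2" "g \<in> L2" "g' \<in> L2"
  shows "stft (\<lambda>t. g t - g' t) f z = stft g f z - stft g' f z"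
  using fourier_integral_diff[OF stft_integrand_integrable[OF assms(1,2), of "fst z"] stft_integrand_integrable[OF assms(1,3), of "fst z"], of "snd z"]
  by (cases z) (simp add: stft_fourier right_diff_distrib)

text \<open>
  The time variable is handled by continuity of translation in \<open>L\<^sup>2\<close>, uniformly in the frequency; for a
  fixed time the frequency variable is the argument of the Fourier integral of an \<open>L\<^sup>1\<close> function.
\<close>

lemma stft_continuous:
  fixes f g :: "real^'d \<Rightarrow> complex"
  assumes f: "f \<in> L2" and g: "g \<in> L2"
  shows "continuous_on UNIV (stft g f)"
  unfolding continuous_on_sequentially
proof (intro allI ballI impI)
  fix z :: "nat \<Rightarrow> (real^'d) \<times> (real^'d)" and a :: "(real^'d) \<times> (real^'d)"
  assume "(\<forall>n. z n \<in> UNIV) \<and> z \<longlonglongrightarrow> a"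
  then have z: "z \<longlonglongrightarrow> a" by simp
  let ?F = "\<lambda>x t. f t * cnj (g (t - x))"
  have int: "integrable lborel (?F x)" for x by (rule stft_integrand_integrable[OF f g])
  have bound: "norm (stft g f (z n) - fourier_integral (?F (fst a)) (snd (z n)))
      \<le> l2norm f * l2norm (\<lambda>t. g (t - fst (z n)) - g (t - fst a))" for n
  proof -
    have "stft g f (z n) - fourier_integral (?F (fst a)) (snd (z n))
        = fourier_integral (\<lambda>t. f t * cnj (g (t - fst (z n)) - g (t - fst a))) (snd (z n))"
      using fourier_integral_diff[OF int int, of "fst (z n)" "fst a" "snd (z n)"]
      by (cases "z n") (simp add: stft_fourier right_diff_distrib)
    also have "cmod \<dots> \<le> (LINT t|lborel. cmod (f t * cnj (g (t - fst (z n)) - g (t - fst a))))"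
      by (rule fourier_integral_bound)
    also have "\<dots> \<le> l2norm f * l2norm (\<lambda>t. g (t - fst (z n)) - g (t - fst a))"
      by (intro integral_norm_L2_mult L2_diff L2_translate f g)
    finally show ?thesis .
  qed
  have lim0: "(\<lambda>n. l2norm f * l2norm (\<lambda>t. g (t - fst (z n)) - g (t - fst a))) \<longlonglongrightarrow> l2norm f * 0"
    by (intro tendsto_mult tendsto_const L2_translation_continuous[OF g] tendsto_fst z)
  have lim1: "(\<lambda>n. stft g f (z n) - fourier_integral (?F (fst a)) (snd (z n))) \<longlonglongrightarrow> 0"
    by (rule Lim_null_comparison[OF always_eventually lim0[unfolded mult_zero_right]]) (intro allI bound)
  have lim2: "(\<lambda>n. fourier_integral (?F (fst a)) (snd (z n))) \<longlonglongrightarrow> fourier_integral (?F (fst a)) (snd a)"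
    using fourier_integral_continuous[OF int[of "fst a"]]
    by (intro isCont_tendsto_compose[where g="fourier_integral (?F (fst a))"] tendsto_snd z)
       (simp add: continuous_on_eq_continuous_at)
  have "(\<lambda>n. stft g f (z n)) \<longlonglongrightarrow> 0 + fourier_integral (?F (fst a)) (snd a)"
    using tendsto_add[OF lim1 lim2] by simp
  then show "(stft g f \<circ> z) \<longlonglongrightarrow> stft g f a"
    by (cases a) (simp add: o_def stft_fourier)
qed

lemma rotate_stft_continuous:
  assumes "f \<in> L2" "g \<in> L2"
  shows "continuous_on UNIV (rotate_U (stft g f))"
proof -
  have "rotate_U (stft g f) = stft g f \<circ> (\<lambda>\<zeta>. (- snd \<zeta>, fst \<zeta>))"
    by (auto simp: rotate_U_def fun_eq_iff)
  then show ?thesis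
    unfolding o_def
    by (auto intro!: continuous_on_compose2[OF stft_continuous[OF assms]] continuous_intros)
qed

lemma rotate_stft_bound:
  assumes "f \<in> L2" "g \<in> L2"
  shows "cmod (rotate_U (stft g f) \<zeta>) \<le> l2norm f * l2norm g"
  by (cases \<zeta>) (simp add: rotate_U_def stft_bound[OF assms])

lemma tf_shift_L2: "g \<in> L2 \<Longrightarrow> tf_shift \<mu> g \<in> L2"
  unfolding tf_shift_def
  by (rule L2_bounded_mult[OF L2_translate, where C=1]) auto

text \<open>
  A time-frequency shift of \<open>g\<close> is a translation followed by a modulation. The translation
  multiplies the integral by a character in \<open>fst \<zeta>\<close>, and the modulation, which occurs once with and
  once without conjugation at points differing by \<open>snd \<zeta>\<close>, by one in \<open>snd \<zeta>\<close>.
\<close>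

lemma rotate_stft_covariance:
  assumes "g \<in> L2"
  shows "rotate_U (stft (tf_shift \<mu> g) (tf_shift \<mu> g)) \<zeta> = cis (- 2 * pi * (\<mu> \<bullet> \<zeta>)) * rotate_U (stft g g) \<zeta>"
proof -
  obtain \<mu>1 \<mu>2 where \<mu>: "\<mu> = (\<mu>1, \<mu>2)" by (cases \<mu>)
  obtain \<zeta>1 \<zeta>2 where \<zeta>: "\<zeta> = (\<zeta>1, \<zeta>2)" by (cases \<zeta>)
  have [measurable]: "g \<in> borel_measurable borel" using L2_measurable[OF assms] by simp
  let ?k = "\<lambda>s. g s * cnj (g (s + \<zeta>2)) * cis (- 2 * pi * (\<zeta>1 \<bullet> s))"
  have "rotate_U (stft (tf_shift \<mu> g) (tf_shift \<mu> g)) \<zeta> = (LINT t|lborel. cis (- 2 * pi * (\<mu> \<bullet> \<zeta>)) * ?k (t - \<mu>1))"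
    unfolding rotate_stft fourier_integral_def
  proof (intro Bochner_Integration.integral_cong refl)
    fix t
    have "cis (2 * pi * (\<mu>2 \<bullet> t)) * cnj (cis (2 * pi * (\<mu>2 \<bullet> (t + \<zeta>2)))) * cis (- 2 * pi * (\<zeta>1 \<bullet> t))
        = cis (- 2 * pi * (\<mu> \<bullet> \<zeta>)) * cis (- 2 * pi * (\<zeta>1 \<bullet> (t - \<mu>1)))"
      unfolding \<mu> \<zeta> cis_cnj cis_mult
      by (intro arg_cong[where f=cis]) (simp add: inner_add_right inner_diff_right algebra_simps inner_commute)
    moreover have "t + \<zeta>2 - \<mu>1 = t - \<mu>1 + \<zeta>2" by simp
    ultimately show "tf_shift \<mu> g t * cnj (tf_shift \<mu> g (t + snd \<zeta>)) * cis (- 2 * pi * (fst \<zeta> \<bullet> t))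
        = cis (- 2 * pi * (\<mu> \<bullet> \<zeta>)) * ?k (t - \<mu>1)"
      unfolding tf_shift_def \<mu> \<zeta> fst_conv snd_conv complex_cnj_mult
      by (simp only: mult_ac)
  qed
  also have "\<dots> = cis (- 2 * pi * (\<mu> \<bullet> \<zeta>)) * (LINT t|lborel. ?k (t - \<mu>1))" by simp
  also have "(LINT t|lborel. ?k (t - \<mu>1)) = (LINT s|lborel. ?k s)"
    by (rule integral_translate) measurable
  also have "\<dots> = rotate_U (stft g g) \<zeta>"
    unfolding rotate_stft fourier_integral_def by (simp add: \<zeta>)
  finally show ?thesis .
qed

subsection \<open>The Rihaczek distribution and its Fourier transform\<close>

text \<open>
  The Rihaczek distribution with the second argument given on the Fourier side. Approximation is
  done in \<open>u\<close> and \<open>k\<close> separately, and it is \<open>k\<close>, not its inverse transform, that must be integrable for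
  Fubini's theorem.
\<close>

definition twisted_tensor ::
  "(real^'d \<Rightarrow> complex) \<Rightarrow> (real^'d \<Rightarrow> complex) \<Rightarrow> (real^'d) \<times> (real^'d) \<Rightarrow> complex" where
  "twisted_tensor u k z = u (fst z) * cnj (k (snd z)) * cis (- 2 * pi * (fst z \<bullet> snd z))"

lemma rihaczek_twisted: "rihaczek u f = twisted_tensor u (fourier f)"
  by (auto simp: rihaczek_def twisted_tensor_def fun_eq_iff)

lemma measurable_lborel_pair:
  fixes f :: "'a::euclidean_space \<times> 'b::euclidean_space \<Rightarrow> 'c::topological_space"
  shows "f \<in> borel_measurable (lborel \<Otimes>\<^sub>M lborel) \<longleftrightarrow> f \<in> borel_measurable borel"
  by (simp add: lborel_prod)

lemma twisted_tensor_measurable: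
  assumes "u \<in> borel_measurable borel" "k \<in> borel_measurable borel"
  shows "twisted_tensor u k \<in> borel_measurable borel"
proof -
  note [measurable] = assms
  have "twisted_tensor u k \<in> borel_measurable (lborel \<Otimes>\<^sub>M lborel)"
    unfolding twisted_tensor_def[abs_def] by measurable
  then show ?thesis by (simp only: measurable_lborel_pair)
qed

lemma
  assumes u: "u \<in> L2" and k: "k \<in> L2"
  shows twisted_tensor_L2: "twisted_tensor u k \<in> L2"
    and l2norm_twisted_tensor: "l2norm (twisted_tensor u k) = l2norm u * l2norm k"
proof -
  have [measurable]: "u \<in> borel_measurable borel" "k \<in> borel_measurable borel"
    using u k by (auto dest: L2_measurable)
  note [measurable] = twisted_tensor_measurable[of u k]
  have "(\<integral>\<^sup>+z. ennreal ((cmod (twisted_tensor u k z))\<^sup>2) \<partial>lborel)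
      = (\<integral>\<^sup>+z. ennreal ((cmod (u (fst z)))\<^sup>2) * ennreal ((cmod (k (snd z)))\<^sup>2) \<partial>(lborel \<Otimes>\<^sub>M lborel))"
    unfolding lborel_prod
    by (intro nn_integral_cong) (simp add: twisted_tensor_def norm_mult power_mult_distrib ennreal_mult)
  also have "\<dots> = (\<integral>\<^sup>+x. \<integral>\<^sup>+\<xi>. ennreal ((cmod (u x))\<^sup>2) * ennreal ((cmod (k \<xi>))\<^sup>2) \<partial>lborel \<partial>lborel)"
    by (subst lborel.nn_integral_fst[symmetric]) auto
  also have "\<dots> = (\<integral>\<^sup>+x. ennreal ((cmod (u x))\<^sup>2) \<partial>lborel) * (\<integral>\<^sup>+\<xi>. ennreal ((cmod (k \<xi>))\<^sup>2) \<partial>lborel)"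
    by (simp add: nn_integral_cmult nn_integral_multc)
  also have "\<dots> = ennreal ((l2norm u * l2norm k)\<^sup>2)"
    by (simp only: nn_integral_l2norm[OF u] nn_integral_l2norm[OF k] power_mult_distrib)
       (simp add: ennreal_mult)
  finally have eq: "(\<integral>\<^sup>+z. ennreal ((cmod (twisted_tensor u k z))\<^sup>2) \<partial>lborel) = ennreal ((l2norm u * l2norm k)\<^sup>2)" .
  show L2: "twisted_tensor u k \<in> L2"
    by (rule L2_I_nn_integral[where c="(l2norm u * l2norm k)\<^sup>2"]) (simp_all add: eq twisted_tensor_measurable)
  have "(l2norm (twisted_tensor u k))\<^sup>2 = (l2norm u * l2norm k)\<^sup>2"
    using eq unfolding nn_integral_l2norm[OF L2] by simp
  then show "l2norm (twisted_tensor u k) = l2norm u * l2norm k"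
    by (rule power2_eq_imp_eq) auto
qed

lemma twisted_tensor_integrable:
  assumes u: "integrable lborel u" and k: "integrable lborel k"
  shows "integrable lborel (twisted_tensor u k)"
proof -
  have "integrable (lborel \<Otimes>\<^sub>M lborel) (\<lambda>z. (case z of (x, y) \<Rightarrow> u x * cnj (k y)) * cis (- 2 * pi * (fst z \<bullet> snd z)))"
    by (intro integrable_cis_mult integrable_tensor u integrable_cnj k) measurable
  then show ?thesis
    unfolding lborel_prod by (simp add: twisted_tensor_def[abs_def] case_prod_unfold)
qed

text \<open>
  Integrating first in the frequency variable produces the inverse transform of \<open>k\<close>, evaluated at
  \<open>x + snd \<zeta>\<close>.
\<close>

lemma fourier_twisted_tensor:
  assumes u: "integrable lborel u" and k: "integrable lborel k"
  shows "fourier_integral (twisted_tensor u k) \<zeta> = rotate_U (stft (inv_fourier_integral k) u) \<zeta>"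
proof -
  obtain \<zeta>1 \<zeta>2 where \<zeta>: "\<zeta> = (\<zeta>1, \<zeta>2)" by (cases \<zeta>)
  let ?K = "\<lambda>z. twisted_tensor u k z * cis (- 2 * pi * (\<zeta> \<bullet> z))"
  have int: "integrable (lborel \<Otimes>\<^sub>M lborel) ?K"
    unfolding lborel_prod by (intro fourier_integral_integrable twisted_tensor_integrable u k)
  have "fourier_integral (twisted_tensor u k) \<zeta> = (LINT z|(lborel \<Otimes>\<^sub>M lborel). ?K z)"
    unfolding lborel_prod fourier_integral_def ..
  also have "\<dots> = (LINT x|lborel. LINT \<xi>|lborel. ?K (x, \<xi>))"
    by (rule lborel_pair.integral_fst'[OF int, symmetric])
  also have "\<dots> = (LINT x|lborel. u x * cnj (inv_fourier_integral k (x + \<zeta>2)) * cis (- 2 * pi * (\<zeta>1 \<bullet> x)))"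
  proof (intro Bochner_Integration.integral_cong refl)
    fix x
    have "(LINT \<xi>|lborel. ?K (x, \<xi>))
        = (LINT \<xi>|lborel. (u x * cis (- 2 * pi * (\<zeta>1 \<bullet> x))) * cnj (k \<xi> * cis (2 * pi * ((x + \<zeta>2) \<bullet> \<xi>))))"
    proof (intro Bochner_Integration.integral_cong refl)
      fix \<xi>
      have "cis (- 2 * pi * (x \<bullet> \<xi>)) * cis (- 2 * pi * ((\<zeta>1, \<zeta>2) \<bullet> (x, \<xi>)))
          = cis (- 2 * pi * (\<zeta>1 \<bullet> x)) * cnj (cis (2 * pi * ((x + \<zeta>2) \<bullet> \<xi>)))"
        unfolding cis_cnj cis_mult by (simp add: inner_add_left algebra_simps)
      then show "?K (x, \<xi>) = (u x * cis (- 2 * pi * (\<zeta>1 \<bullet> x))) * cnj (k \<xi> * cis (2 * pi * ((x + \<zeta>2) \<bullet> \<xi>)))"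
        unfolding twisted_tensor_def \<zeta> fst_conv snd_conv complex_cnj_mult
        by (metis (no_types, opaque_lifting) mult.assoc mult.left_commute)
    qed
    also have "\<dots> = (u x * cis (- 2 * pi * (\<zeta>1 \<bullet> x))) * cnj (inv_fourier_integral k (x + \<zeta>2))"
      unfolding inv_fourier_integral_eq Bochner_Integration.integral_cnj[symmetric] by simp
    finally show "(LINT \<xi>|lborel. ?K (x, \<xi>))
        = u x * cnj (inv_fourier_integral k (x + \<zeta>2)) * cis (- 2 * pi * (\<zeta>1 \<bullet> x))"
      by (simp add: mult_ac)
  qed
  also have "\<dots> = rotate_U (stft (inv_fourier_integral k) u) \<zeta>"
    unfolding rotate_stft fourier_integral_def by (simp add: \<zeta>)
  finally show ?thesis .
qed

lemma inv_fourier_integral_inner: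
  assumes h: "integrable lborel h" and w: "integrable lborel w"
  shows "L2_inner (inv_fourier_integral h) w = (LINT \<zeta>|lborel. h \<zeta> * cnj (fourier_integral w \<zeta>))"
proof -
  have "L2_inner (inv_fourier_integral h) w = (LINT x|lborel. cnj (fourier_integral (\<lambda>\<zeta>. cnj (h \<zeta>)) x * w x))"
    unfolding L2_inner_def fourier_integral_cnj by simp
  also have "\<dots> = cnj (LINT x|lborel. fourier_integral (\<lambda>\<zeta>. cnj (h \<zeta>)) x * w x)"
    by (rule Bochner_Integration.integral_cnj)
  also have "\<dots> = cnj (LINT \<zeta>|lborel. cnj (h \<zeta>) * fourier_integral w \<zeta>)"
    by (simp only: fourier_integral_exchange[OF integrable_cnj[OF h] w])
  also have "\<dots> = (LINT \<zeta>|lborel. cnj (cnj (h \<zeta>) * fourier_integral w \<zeta>))"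
    by (rule Bochner_Integration.integral_cnj[symmetric])
  finally show ?thesis by simp
qed

text \<open>
  For integrable \<open>u\<close> and integrable transform of \<open>f\<close> this is Fubini's theorem together with the formula for
  the Fourier integral of the twisted tensor product. Both sides are continuous in \<open>u\<close> and \<open>f\<close> for the
  \<open>L\<^sup>2\<close> norm: the left side because the tensor product multiplies norms, the right side because the
  short-time Fourier transform is bounded by the product of the norms and \<open>h\<close> is integrable. Truncating
  \<open>u\<close> and the transform of \<open>f\<close> therefore gives the general case.
\<close>

theorem rihaczek_pairing:
  fixes u f :: "real^'d \<Rightarrow> complex"
  assumes h: "h \<in> L2" "integrable lborel h" and u: "u \<in> L2" and f: "f \<in> L2"
  shows "L2_inner (inv_fourier_integral h) (rihaczek u f)
    = (LINT \<zeta>|lborel. h \<zeta> * cnj (rotate_U (stft f u) \<zeta>))"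
proof -
  define k where "k = fourier f"
  have k: "k \<in> L2" unfolding k_def by (rule fourier_L2[OF f])
  define un where "un n = truncate n u" for n
  define kn where "kn n = truncate n k" for n
  define fn where "fn n = inv_fourier_integral (kn n)" for n
  have un: "un n \<in> L2" "integrable lborel (un n)" for n
    by (simp_all add: un_def truncate_L2 truncate_integrable u)
  have kn: "kn n \<in> L2" "integrable lborel (kn n)" for n
    by (simp_all add: kn_def truncate_L2 truncate_integrable k)
  have fn: "fn n \<in> L2" for n unfolding fn_def by (rule inv_fourier_integral_L2[OF kn])
  have ulim: "(\<lambda>n. l2norm (\<lambda>x. un n x - u x)) \<longlonglongrightarrow> 0" unfolding un_def by (rule truncate_tendsto[OF u])
  have klim: "(\<lambda>n. l2norm (\<lambda>x. kn n x - k x)) \<longlonglongrightarrow> 0" unfolding kn_def by (rule truncate_tendsto[OF k])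
  have flim: "(\<lambda>n. l2norm (\<lambda>x. fn n x - f x)) \<longlonglongrightarrow> 0"
  proof -
    have "l2norm (\<lambda>x. fn n x - f x) = l2norm (\<lambda>x. kn n x - k x)" for n
    proof -
      have "AE \<xi> in lborel. fourier (fn n) \<xi> = kn n \<xi>"
        unfolding fn_def by (rule fourier_inversion[OF kn])
      then have "l2norm (\<lambda>x. fourier (fn n) x - fourier f x) = l2norm (\<lambda>x. kn n x - k x)"
        unfolding k_def[symmetric]
        by (intro l2norm_AE_cong L2_measurable L2_diff fourier_L2 fn kn k) (auto elim: AE_mp)
      then show ?thesis by (simp add: fourier_isometry fn f)
    qed
    then show ?thesis using klim by simp
  qed
  have unorm: "(\<lambda>n. l2norm (un n)) \<longlonglongrightarrow> l2norm u" by (rule l2norm_tendsto[OF ulim un(1) u])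
  have approx: "L2_inner (inv_fourier_integral h) (twisted_tensor (un n) (kn n))
      = (LINT \<zeta>|lborel. h \<zeta> * cnj (rotate_U (stft (fn n) (un n)) \<zeta>))" for n
    unfolding fn_def fourier_twisted_tensor[OF un(2) kn(2), symmetric]
    by (rule inv_fourier_integral_inner[OF h(2) twisted_tensor_integrable[OF un(2) kn(2)]])
  have "(\<lambda>n. l2norm (\<lambda>z. twisted_tensor (un n) (kn n) z - twisted_tensor u k z)) \<longlonglongrightarrow> 0"
  proof (rule tendsto_sandwich[OF _ _ tendsto_const])
    show "\<forall>\<^sub>F n in sequentially. l2norm (\<lambda>z. twisted_tensor (un n) (kn n) z - twisted_tensor u k z)
        \<le> l2norm (un n) * l2norm (\<lambda>x. kn n x - k x) + l2norm (\<lambda>x. un n x - u x) * l2norm k"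
    proof (rule always_eventually, rule allI)
      fix n
      have "(\<lambda>z. twisted_tensor (un n) (kn n) z - twisted_tensor u k z)
          = (\<lambda>z. twisted_tensor (un n) (\<lambda>x. kn n x - k x) z + twisted_tensor (\<lambda>x. un n x - u x) k z)"
        by (simp add: twisted_tensor_def fun_eq_iff algebra_simps)
      then have "l2norm (\<lambda>z. twisted_tensor (un n) (kn n) z - twisted_tensor u k z)
          \<le> l2norm (twisted_tensor (un n) (\<lambda>x. kn n x - k x)) + l2norm (twisted_tensor (\<lambda>x. un n x - u x) k)"
        using l2norm_triangle[OF twisted_tensor_L2[OF un(1) L2_diff[OF kn(1) k]] twisted_tensor_L2[OF L2_diff[OF un(1) u] k]]
        by simp
      then show "l2norm (\<lambda>z. twisted_tensor (un n) (kn n) z - twisted_tensor u k z)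
        \<le> l2norm (un n) * l2norm (\<lambda>x. kn n x - k x) + l2norm (\<lambda>x. un n x - u x) * l2norm k"
        by (simp add: l2norm_twisted_tensor L2_diff un kn u k)
    qed
    show "(\<lambda>n. l2norm (un n) * l2norm (\<lambda>x. kn n x - k x) + l2norm (\<lambda>x. un n x - u x) * l2norm k) \<longlonglongrightarrow> 0"
      using tendsto_add[OF tendsto_mult[OF unorm klim] tendsto_mult[OF ulim tendsto_const[of "l2norm k"]]] by simp
  qed simp
  then have lhs: "(\<lambda>n. L2_inner (inv_fourier_integral h) (twisted_tensor (un n) (kn n)))
      \<longlonglongrightarrow> L2_inner (inv_fourier_integral h) (twisted_tensor u k)"
    by (intro L2_inner_tendsto twisted_tensor_L2 un kn u k inv_fourier_integral_L2 h) (simp add: l2norm_def)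
  have stft_int: "integrable lborel (\<lambda>\<zeta>. h \<zeta> * cnj (rotate_U (stft q p) \<zeta>))" if "p \<in> L2" "q \<in> L2"
    for p q :: "real^'d \<Rightarrow> complex"
  proof -
    have "integrable lborel (\<lambda>\<zeta>. cnj (rotate_U (stft q p) \<zeta>) * h \<zeta>)"
    proof (rule integrable_bounded_mult[OF h(2), where C="l2norm p * l2norm q"])
      show "(\<lambda>\<zeta>. cnj (rotate_U (stft q p) \<zeta>)) \<in> borel_measurable lborel"
        using borel_measurable_continuous_onI[OF rotate_stft_continuous[OF that]] by simp
    qed (simp add: rotate_stft_bound that)
    then show ?thesis by (simp add: mult.commute)
  qed
  let ?I = "LINT \<zeta>|lborel. cmod (h \<zeta>)"
  have rhs: "(\<lambda>n. LINT \<zeta>|lborel. h \<zeta> * cnj (rotate_U (stft (fn n) (un n)) \<zeta>))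
      \<longlonglongrightarrow> (LINT \<zeta>|lborel. h \<zeta> * cnj (rotate_U (stft f u) \<zeta>))"
  proof (rule Lim_null[THEN iffD2], rule Lim_null_comparison)
    let ?b = "\<lambda>n. l2norm (un n) * l2norm (\<lambda>x. fn n x - f x) + l2norm (\<lambda>x. un n x - u x) * l2norm f"
    show "(\<lambda>n. ?I * ?b n) \<longlonglongrightarrow> 0"
      using tendsto_mult[OF tendsto_const[of ?I] tendsto_add[OF tendsto_mult[OF unorm flim] tendsto_mult[OF ulim tendsto_const[of "l2norm f"]]]]
      by simp
    show "\<forall>\<^sub>F n in sequentially. norm ((LINT \<zeta>|lborel. h \<zeta> * cnj (rotate_U (stft (fn n) (un n)) \<zeta>))
        - (LINT \<zeta>|lborel. h \<zeta> * cnj (rotate_U (stft f u) \<zeta>))) \<le> ?I * ?b n"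
    proof (rule always_eventually, rule allI)
      fix n
      have pt: "cmod (rotate_U (stft (fn n) (un n)) \<zeta> - rotate_U (stft f u) \<zeta>) \<le> ?b n" for \<zeta>
      proof -
        have "rotate_U (stft (fn n) (un n)) \<zeta> - rotate_U (stft f u) \<zeta>
            = rotate_U (stft (\<lambda>x. fn n x - f x) (un n)) \<zeta> + rotate_U (stft f (\<lambda>x. un n x - u x)) \<zeta>"
          by (cases \<zeta>) (simp add: rotate_U_def stft_diff_left stft_diff_right un fn u f)
        also have "cmod \<dots> \<le> cmod (rotate_U (stft (\<lambda>x. fn n x - f x) (un n)) \<zeta>) + cmod (rotate_U (stft f (\<lambda>x. un n x - u x)) \<zeta>)"
          by (rule norm_triangle_ineq)
        also have "\<dots> \<le> ?b n"
          by (intro add_mono rotate_stft_bound L2_diff un fn u f)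
        finally show ?thesis .
      qed
      have "(LINT \<zeta>|lborel. h \<zeta> * cnj (rotate_U (stft (fn n) (un n)) \<zeta>))
          - (LINT \<zeta>|lborel. h \<zeta> * cnj (rotate_U (stft f u) \<zeta>))
          = (LINT \<zeta>|lborel. h \<zeta> * cnj (rotate_U (stft (fn n) (un n)) \<zeta> - rotate_U (stft f u) \<zeta>))"
        by (subst Bochner_Integration.integral_diff[symmetric]) (simp_all add: stft_int un fn u f right_diff_distrib)
      also have "cmod \<dots> \<le> (LINT \<zeta>|lborel. cmod (h \<zeta> * cnj (rotate_U (stft (fn n) (un n)) \<zeta> - rotate_U (stft f u) \<zeta>)))"
        by (rule integral_norm_bound)
      also have "\<dots> \<le> (LINT \<zeta>|lborel. cmod (h \<zeta>) * ?b n)"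
      proof (rule integral_mono)
        show "integrable lborel (\<lambda>\<zeta>. cmod (h \<zeta> * cnj (rotate_U (stft (fn n) (un n)) \<zeta> - rotate_U (stft f u) \<zeta>)))"
          using Bochner_Integration.integrable_diff[OF stft_int[OF un(1) fn, of n n] stft_int[OF u f]]
          by (intro integrable_norm) (simp add: right_diff_distrib)
        show "integrable lborel (\<lambda>\<zeta>. cmod (h \<zeta>) * ?b n)"
          by (intro integrable_mult_left integrable_norm h)
        show "cmod (h \<zeta> * cnj (rotate_U (stft (fn n) (un n)) \<zeta> - rotate_U (stft f u) \<zeta>)) \<le> cmod (h \<zeta>) * ?b n" for \<zeta>
          unfolding norm_mult complex_mod_cnj by (intro mult_left_mono pt) simp
      qed
      also have "\<dots> = ?I * ?b n" by simp
      finally show "norm ((LINT \<zeta>|lborel. h \<zeta> * cnj (rotate_U (stft (fn n) (un n)) \<zeta>))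
        - (LINT \<zeta>|lborel. h \<zeta> * cnj (rotate_U (stft f u) \<zeta>))) \<le> ?I * ?b n" .
    qed
  qed
  show ?thesis
    unfolding rihaczek_twisted k_def[symmetric]
    using LIMSEQ_unique[OF lhs] rhs unfolding approx by blast
qed

subsection \<open>The Kohn--Nirenberg operator\<close>

lemma ennreal_norm_integral_le:
  fixes f :: "'a \<Rightarrow> complex"
  shows "ennreal (cmod (LINT x|M. f x)) \<le> (\<integral>\<^sup>+x. ennreal (cmod (f x)) \<partial>M)"
proof (cases "integrable M f")
  case True
  then show ?thesis by (rule integral_norm_bound_ennreal)
qed (simp add: not_integrable_integral_eq)

text \<open>
  The weak definition determines the operator only if some \<open>L\<^sup>2\<close> function satisfies it. The function
  \<open>w x = \<integral> \<sigma>(x, \<xi>) fourier f \<xi> cis (2\<pi> x \<bullet> \<xi>) d\<xi>\<close> does: the Cauchy--Schwarz inequality in \<open>\<xi>\<close> shows that it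
  is square-integrable, and Fubini's theorem gives the identity.
\<close>

lemma kohn_nirenberg_spec:
  fixes f :: "real^'d \<Rightarrow> complex"
  assumes \<sigma>: "\<sigma> \<in> L2" and f: "f \<in> L2" and u: "u \<in> L2"
  shows "L2_inner (kohn_nirenberg \<sigma> f) u = L2_inner \<sigma> (rihaczek u f)"
proof -
  define k where "k = fourier f"
  have k: "k \<in> L2" unfolding k_def by (rule fourier_L2[OF f])
  have [measurable]: "k \<in> borel_measurable borel" using L2_measurable[OF k] by simp
  have [measurable]: "\<sigma> \<in> borel_measurable (lborel \<Otimes>\<^sub>M lborel)"
    unfolding measurable_lborel_pair using L2_measurable[OF \<sigma>] by simp
  define w where "w x = (LINT \<xi>|lborel. \<sigma> (x, \<xi>) * (k \<xi> * cis (2 * pi * (x \<bullet> \<xi>))))" for x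
  have [measurable]: "w \<in> borel_measurable lborel" unfolding w_def by measurable
  \<comment> \<open>Working with nonnegative integrals makes the bound valid for every \<open>x\<close>, including those where the
    integral defining \<open>w x\<close> diverges and \<open>w x\<close> is \<open>0\<close> by convention.\<close>
  have pt: "ennreal ((cmod (w x))\<^sup>2) \<le> (\<integral>\<^sup>+\<xi>. ennreal ((cmod (\<sigma> (x, \<xi>)))\<^sup>2) \<partial>lborel) * ennreal ((l2norm k)\<^sup>2)" for x
  proof -
    have "ennreal ((cmod (w x))\<^sup>2) = (ennreal (cmod (w x)))\<^sup>2" by (simp add: ennreal_power)
    also have "\<dots> \<le> (\<integral>\<^sup>+\<xi>. ennreal (cmod (\<sigma> (x, \<xi>) * (k \<xi> * cis (2 * pi * (x \<bullet> \<xi>))))) \<partial>lborel)\<^sup>2"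
      unfolding w_def by (intro power_mono ennreal_norm_integral_le) simp
    also have "\<dots> = (\<integral>\<^sup>+\<xi>. ennreal (cmod (\<sigma> (x, \<xi>))) * ennreal (cmod (k \<xi>)) \<partial>lborel)\<^sup>2"
      by (simp add: norm_mult ennreal_mult)
    also have "\<dots> \<le> (\<integral>\<^sup>+\<xi>. (ennreal (cmod (\<sigma> (x, \<xi>))))\<^sup>2 \<partial>lborel) * (\<integral>\<^sup>+\<xi>. (ennreal (cmod (k \<xi>)))\<^sup>2 \<partial>lborel)"
      by (rule Cauchy_Schwarz_nn_integral) measurable
    also have "(\<integral>\<^sup>+\<xi>. (ennreal (cmod (k \<xi>)))\<^sup>2 \<partial>lborel) = ennreal ((l2norm k)\<^sup>2)"
      using nn_integral_l2norm[OF k] by (simp add: ennreal_power)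
    finally show ?thesis by (simp add: ennreal_power)
  qed
  have "(\<integral>\<^sup>+x. ennreal ((cmod (w x))\<^sup>2) \<partial>lborel)
      \<le> (\<integral>\<^sup>+x. (\<integral>\<^sup>+\<xi>. ennreal ((cmod (\<sigma> (x, \<xi>)))\<^sup>2) \<partial>lborel) * ennreal ((l2norm k)\<^sup>2) \<partial>lborel)"
    by (intro nn_integral_mono pt)
  also have "\<dots> = (\<integral>\<^sup>+x. (\<integral>\<^sup>+\<xi>. ennreal ((cmod (\<sigma> (x, \<xi>)))\<^sup>2) \<partial>lborel) \<partial>lborel) * ennreal ((l2norm k)\<^sup>2)"
    by (rule nn_integral_multc) measurable
  also have "(\<integral>\<^sup>+x. (\<integral>\<^sup>+\<xi>. ennreal ((cmod (\<sigma> (x, \<xi>)))\<^sup>2) \<partial>lborel) \<partial>lborel)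
      = (\<integral>\<^sup>+z. ennreal ((cmod (\<sigma> z))\<^sup>2) \<partial>(lborel \<Otimes>\<^sub>M lborel))"
    by (rule lborel.nn_integral_fst) measurable
  also have "\<dots> = ennreal ((l2norm \<sigma>)\<^sup>2)"
    unfolding lborel_prod by (rule nn_integral_l2norm[OF \<sigma>])
  finally have w: "w \<in> L2"
    by (intro L2_I_nn_integral[where c="(l2norm \<sigma>)\<^sup>2 * (l2norm k)\<^sup>2"]) (simp_all add: ennreal_mult)
  have inner: "L2_inner w v = L2_inner \<sigma> (rihaczek v f)" if v: "v \<in> L2" for v
  proof -
    let ?K = "\<lambda>z. \<sigma> z * cnj (twisted_tensor v k z)"
    have int: "integrable (lborel \<Otimes>\<^sub>M lborel) ?K"
      unfolding lborel_prod by (intro L2_inner_integrable \<sigma> twisted_tensor_L2 v k)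
    have "L2_inner \<sigma> (rihaczek v f) = (LINT z|(lborel \<Otimes>\<^sub>M lborel). ?K z)"
      unfolding lborel_prod L2_inner_def rihaczek_twisted k_def[symmetric] ..
    also have "\<dots> = (LINT x|lborel. LINT \<xi>|lborel. ?K (x, \<xi>))"
      by (rule lborel_pair.integral_fst'[OF int, symmetric])
    also have "\<dots> = (LINT x|lborel. w x * cnj (v x))"
    proof (intro Bochner_Integration.integral_cong refl)
      fix x
      have eq: "?K (x, \<xi>) = \<sigma> (x, \<xi>) * (k \<xi> * cis (2 * pi * (x \<bullet> \<xi>))) * cnj (v x)" for \<xi>
        by (simp add: twisted_tensor_def cis_cnj mult_ac)
      then show "(LINT \<xi>|lborel. ?K (x, \<xi>)) = w x * cnj (v x)"
        unfolding w_def eq by simp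
    qed
    finally show ?thesis by (simp add: L2_inner_def)
  qed
  have "kohn_nirenberg \<sigma> f \<in> L2 \<and> (\<forall>u\<in>L2. L2_inner (kohn_nirenberg \<sigma> f) u = L2_inner \<sigma> (rihaczek u f))"
    unfolding kohn_nirenberg_def
    by (rule someI[of "\<lambda>h. h \<in> L2 \<and> (\<forall>u\<in>L2. L2_inner h u = L2_inner \<sigma> (rihaczek u f))" w]) (use w inner in blast)
  then show ?thesis using u by blast
qed

theorem diag_coeff_integral:
  fixes g :: "real^'d \<Rightarrow> complex"
  assumes \<sigma>: "\<sigma> \<in> L2" "AE z in lborel. \<sigma> z = inv_fourier_integral h z"
    and h: "h \<in> L2" "integrable lborel h" and g: "g \<in> L2"
  shows "diag_coeff \<sigma> g \<mu> = (LINT \<zeta>|lborel. h \<zeta> * cnj (rotate_U (stft g g) \<zeta>) * cis (2 * pi * (\<mu> \<bullet> \<zeta>)))"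
proof -
  note s = tf_shift_L2[OF g, of \<mu>]
  have R: "rihaczek (tf_shift \<mu> g) (tf_shift \<mu> g) \<in> L2"
    unfolding rihaczek_twisted by (intro twisted_tensor_L2 fourier_L2 s)
  have "diag_coeff \<sigma> g \<mu> = L2_inner \<sigma> (rihaczek (tf_shift \<mu> g) (tf_shift \<mu> g))"
    unfolding diag_coeff_def by (rule kohn_nirenberg_spec[OF \<sigma>(1) s s])
  also have "\<dots> = L2_inner (inv_fourier_integral h) (rihaczek (tf_shift \<mu> g) (tf_shift \<mu> g))"
    by (intro L2_inner_AE_cong \<sigma>(2) L2_measurable \<sigma>(1) inv_fourier_integral_L2 h R) simp
  also have "\<dots> = (LINT \<zeta>|lborel. h \<zeta> * cnj (rotate_U (stft (tf_shift \<mu> g) (tf_shift \<mu> g)) \<zeta>))"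
    by (rule rihaczek_pairing[OF h s s])
  also have "\<dots> = (LINT \<zeta>|lborel. h \<zeta> * cnj (rotate_U (stft g g) \<zeta>) * cis (2 * pi * (\<mu> \<bullet> \<zeta>)))"
    by (intro Bochner_Integration.integral_cong refl)
       (simp add: rotate_stft_covariance[OF g] cis_cnj mult_ac)
  finally show ?thesis .
qed


section \<open>Reconstruction from samples\<close>

lemma quotient_bounded_on_compact:
  fixes U :: "'a::euclidean_space \<Rightarrow> complex"
  assumes "compact A" "continuous_on A f" "continuous_on A U" "\<And>x. x \<in> A \<Longrightarrow> U x \<noteq> 0"
  obtains C where "C \<ge> 0" "\<And>x. x \<in> A \<Longrightarrow> cmod (f x / U x) \<le> C"
proof -
  have "compact ((\<lambda>x. f x / U x) ` A)"
    using assms by (intro compact_continuous_image continuous_intros) auto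
  then obtain C where "\<And>y. y \<in> (\<lambda>x. f x / U x) ` A \<Longrightarrow> cmod y \<le> C"
    using compact_imp_bounded[of "(\<lambda>x. f x / U x) ` A"] bounded_iff[of "(\<lambda>x. f x / U x) ` A"] by metis
  then show ?thesis using that[of "max C 0"] by (auto simp: le_max_iff_disj)
qed

lemma inv_fourier_integral_integrand:
  "integrable lborel h \<Longrightarrow> integrable lborel (\<lambda>\<zeta>. h \<zeta> * cis (2 * pi * (z \<bullet> \<zeta>)))"
  by (rule integrable_cis_mult) auto

lemma inv_fourier_integral_diff:
  "integrable lborel f \<Longrightarrow> integrable lborel g \<Longrightarrow>
   inv_fourier_integral (\<lambda>x. f x - g x) z = inv_fourier_integral f z - inv_fourier_integral g z"
  by (simp add: inv_fourier_integral_def fourier_integral_diff)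

text \<open>
  Modulation in frequency becomes translation, which is how the lattice translates of the kernel
  arise.
\<close>

lemma inv_fourier_integral_modulate:
  "inv_fourier_integral (\<lambda>\<zeta>. c * cis (- 2 * pi * (\<mu> \<bullet> \<zeta>)) * m \<zeta>) z = c * inv_fourier_integral m (z - \<mu>)"
proof -
  have eq: "c * cis (- 2 * pi * (\<mu> \<bullet> \<zeta>)) * m \<zeta> * cis (2 * pi * (z \<bullet> \<zeta>))
      = c * (m \<zeta> * cis (2 * pi * ((z - \<mu>) \<bullet> \<zeta>)))" for \<zeta>
  proof -
    have "2 * pi * ((z - \<mu>) \<bullet> \<zeta>) = - 2 * pi * (\<mu> \<bullet> \<zeta>) + 2 * pi * (z \<bullet> \<zeta>)"
      by (simp add: inner_diff_left algebra_simps)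
    then show ?thesis by (simp only: cis_mult[symmetric] mult_ac)
  qed
  show ?thesis unfolding inv_fourier_integral_eq eq by simp
qed

text \<open>
  The coefficients \<open>c \<mu>\<close> are those of \<open>h U\<close> with respect to the characters of the lattice, and \<open>m\<close> divides
  by \<open>U\<close> again. The error of a partial sum is the inverse transform of \<open>D S\<close>, which equals
  \<open>1 / U\<close> times the error of the corresponding partial Fourier series of \<open>h U\<close> on the box. Its \<open>L\<^sup>2\<close> norm
  controls the error in \<open>L\<^sup>2\<close> by Plancherel's identity, and also, since \<open>D S\<close> lives on a set of finite
  measure, the error in the supremum norm.
\<close>

theorem
  fixes h U :: "'a::euclidean_space \<Rightarrow> complex"
  assumes l: "\<forall>b\<in>Basis. l b > 0" and h: "h \<in> L2" and h_supp: "\<forall>\<zeta>. \<zeta> \<notin> cell l \<longrightarrow> h \<zeta> = 0"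
    and U: "continuous_on UNIV U" and U_nz: "\<forall>\<zeta>\<in>cell l. U \<zeta> \<noteq> 0"
  defines "c \<equiv> \<lambda>\<mu>. LINT \<zeta>|lborel. h \<zeta> * U \<zeta> * cis (2 * pi * (\<mu> \<bullet> \<zeta>))"
    and "m \<equiv> \<lambda>\<zeta>. indicator (cell l) \<zeta> / (cell_volume l * U \<zeta>)"
  shows sampling_kernel_L2: "m \<in> L2" "integrable lborel m"
    and sampling_L2: "((\<lambda>S. l2norm (\<lambda>z. (\<Sum>\<mu>\<in>S. c \<mu> * inv_fourier_integral m (z - \<mu>)) - inv_fourier_integral h z))
            \<longlongrightarrow> 0) (finite_subsets_at_top (period_lattice l))"
    and sampling_uniform: "uniform_limit UNIV (\<lambda>S z. \<Sum>\<mu>\<in>S. c \<mu> * inv_fourier_integral m (z - \<mu>))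
            (inv_fourier_integral h) (finite_subsets_at_top (period_lattice l))"
proof -
  have h0: "h \<zeta> = 0" if "\<zeta> \<notin> cell l" for \<zeta> using h_supp that by blast
  have U0: "U \<zeta> \<noteq> 0" if "\<zeta> \<in> cell l" for \<zeta> using U_nz that by blast
  let ?F = "finite_subsets_at_top (period_lattice l)"
  have vol: "cell_volume l > 0" by (rule cell_volume_pos[OF l])
  have [measurable]: "U \<in> borel_measurable borel" by (rule borel_measurable_continuous_onI[OF U])
  have [measurable]: "h \<in> borel_measurable borel" using L2_measurable[OF h] by simp
  have U_cell: "continuous_on (cell l) U" using U continuous_on_subset by blast
  have h1: "integrable lborel h"
    by (rule L2_bounded_support_integrable[OF h bounded_subset[OF cell_bounded[of l]]]) (use h0 in auto)
  obtain C where C: "C \<ge> 0" "\<And>\<zeta>. \<zeta> \<in> cell l \<Longrightarrow> cmod (1 / U \<zeta>) \<le> C"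
    using quotient_bounded_on_compact[OF cell_compact _ U_cell U0, of "\<lambda>_. 1"] by auto
  obtain B where B: "B \<ge> 0" "\<And>\<zeta>. \<zeta> \<in> cell l \<Longrightarrow> cmod (U \<zeta> / 1) \<le> B"
    using quotient_bounded_on_compact[OF cell_compact U_cell, of "\<lambda>_. 1"] by auto
  have m_supp: "bounded {\<zeta>. m \<zeta> \<noteq> 0}"
    by (rule bounded_subset[OF cell_bounded[of l]]) (auto simp: m_def split: split_indicator_asm)
  show m: "m \<in> L2"
  proof (rule L2_bounded_support[OF _ m_supp, where C="C / cell_volume l"])
    show "m \<in> borel_measurable lborel" unfolding m_def by measurable
    show "cmod (m \<zeta>) \<le> C / cell_volume l" for \<zeta>
      using C(2)[of \<zeta>] C(1) vol
      by (cases "\<zeta> \<in> cell l") (auto simp: m_def norm_divide norm_mult field_simps)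
  qed
  show m1: "integrable lborel m"
    by (rule L2_bounded_support_integrable[OF m m_supp])
  define G where "G \<zeta> = (indicator (cell l) \<zeta> * U \<zeta>) * h \<zeta>" for \<zeta>
  have G: "G \<in> L2"
    unfolding G_def
  proof (rule L2_bounded_mult[OF h, where C=B])
    show "cmod (indicator (cell l) \<zeta> * U \<zeta>) \<le> B" for \<zeta>
      using B by (cases "\<zeta> \<in> cell l") auto
  qed measurable
  have G0: "G \<zeta> = 0" if "\<zeta> \<notin> cell l" for \<zeta> using that by (simp add: G_def)
  have c: "c \<mu> = L2_inner G (cell_exp l \<mu>)" for \<mu>
    unfolding c_def L2_inner_def
  proof (intro Bochner_Integration.integral_cong refl)
    fix \<zeta>
    show "h \<zeta> * U \<zeta> * cis (2 * pi * (\<mu> \<bullet> \<zeta>)) = G \<zeta> * cnj (cell_exp l \<mu> \<zeta>)"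
      using h0[of \<zeta>] by (cases "\<zeta> \<in> cell l") (simp_all add: G_def cell_exp_def cis_cnj)
  qed
  define D where "D S \<zeta> = (\<Sum>\<mu>\<in>S. c \<mu> * cis (- 2 * pi * (\<mu> \<bullet> \<zeta>)) * m \<zeta>) - h \<zeta>" for S \<zeta>
  have D_eq: "D S \<zeta> = (indicator (cell l) \<zeta> / U \<zeta>) * (cell_projection l G S \<zeta> - G \<zeta>)" for S \<zeta>
  proof (cases "\<zeta> \<in> cell l")
    case True
    have "(\<Sum>\<mu>\<in>S. c \<mu> * cis (- 2 * pi * (\<mu> \<bullet> \<zeta>)) * m \<zeta>) = cell_projection l G S \<zeta> / U \<zeta>"
      unfolding cell_projection_def sum_divide_distrib
      by (intro sum.cong refl) (simp add: c m_def cell_exp_def True)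
    moreover have "G \<zeta> / U \<zeta> = h \<zeta>" using U0[OF True] True by (simp add: G_def)
    ultimately show ?thesis using True by (simp add: D_def diff_divide_distrib)
  next
    case False
    then show ?thesis using h0[OF False] by (simp add: D_def m_def)
  qed
  have PG: "(\<lambda>\<zeta>. cell_projection l G S \<zeta> - G \<zeta>) \<in> L2" for S
    by (intro L2_diff cell_projection_L2 G)
  have D_meas: "D S \<in> borel_measurable lborel" for S
    using m h unfolding D_def[abs_def] by (auto dest!: L2_measurable)
  have D_bound: "cmod (D S \<zeta>) \<le> C * cmod (cell_projection l G S \<zeta> - G \<zeta>)" for S \<zeta>
    unfolding D_eq norm_mult
    using C by (intro mult_right_mono) (auto split: split_indicator)
  have D: "D S \<in> L2" for S
    by (rule L2_dominated[OF PG D_meas D_bound])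
  have D_norm: "l2norm (D S) \<le> C * l2norm (\<lambda>\<zeta>. cell_projection l G S \<zeta> - G \<zeta>)" for S
    by (rule l2norm_mono[OF PG D_meas D_bound C(1)])
  have D1: "integrable lborel (D S)" for S
    by (rule L2_bounded_support_integrable[OF D bounded_subset[OF cell_bounded[of l]]])
       (auto simp: D_eq split: split_indicator_asm)
  have lim: "((\<lambda>S. l2norm (D S)) \<longlongrightarrow> 0) ?F"
  proof (rule tendsto_sandwich[OF _ _ tendsto_const])
    show "((\<lambda>S. C * l2norm (\<lambda>\<zeta>. cell_projection l G S \<zeta> - G \<zeta>)) \<longlongrightarrow> 0) ?F"
      using tendsto_mult[OF tendsto_const[of C] fourier_series_L2[OF l G G0]] by simp
  qed (use D_norm in auto)
  have summand: "integrable lborel (\<lambda>\<zeta>. c \<mu> * cis (- 2 * pi * (\<mu> \<bullet> \<zeta>)) * m \<zeta>)" for \<mu>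
    by (rule integrable_bounded_mult[OF m1, where C="cmod (c \<mu>)"]) (auto simp: norm_mult)
  have D_inv: "inv_fourier_integral (D S) z = (\<Sum>\<mu>\<in>S. c \<mu> * inv_fourier_integral m (z - \<mu>)) - inv_fourier_integral h z" for S z
  proof -
    have "inv_fourier_integral (\<lambda>\<zeta>. \<Sum>\<mu>\<in>S. c \<mu> * cis (- 2 * pi * (\<mu> \<bullet> \<zeta>)) * m \<zeta>) z
        = (\<Sum>\<mu>\<in>S. inv_fourier_integral (\<lambda>\<zeta>. c \<mu> * cis (- 2 * pi * (\<mu> \<bullet> \<zeta>)) * m \<zeta>) z)"
      unfolding inv_fourier_integral_eq sum_distrib_right
      by (intro Bochner_Integration.integral_sum inv_fourier_integral_integrand summand)
    then show ?thesis
      unfolding D_def[abs_def] inv_fourier_integral_modulate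
      by (subst inv_fourier_integral_diff[OF Bochner_Integration.integrable_sum[OF summand] h1]) simp
  qed
  have "l2norm (\<lambda>z. (\<Sum>\<mu>\<in>S. c \<mu> * inv_fourier_integral m (z - \<mu>)) - inv_fourier_integral h z) = l2norm (D S)" for S
    using l2norm_inv_fourier_integral[OF D[where S=S] D1[where S=S]] unfolding D_inv[symmetric] by simp
  then show "((\<lambda>S. l2norm (\<lambda>z. (\<Sum>\<mu>\<in>S. c \<mu> * inv_fourier_integral m (z - \<mu>)) - inv_fourier_integral h z)) \<longlongrightarrow> 0) ?F"
    using lim by simp
  define W where "W = l2norm (\<lambda>\<zeta>::'a. indicator (cell l) \<zeta> :: complex)"
  have pt: "cmod ((\<Sum>\<mu>\<in>S. c \<mu> * inv_fourier_integral m (z - \<mu>)) - inv_fourier_integral h z) \<le> l2norm (D S) * W" for S z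
  proof -
    have "cmod (inv_fourier_integral (D S) z) \<le> (LINT \<zeta>|lborel. cmod (D S \<zeta>))"
      unfolding inv_fourier_integral_def by (rule fourier_integral_bound)
    also have "\<dots> = (LINT \<zeta>|lborel. cmod (D S \<zeta>) * cmod (indicator (cell l) \<zeta> :: complex))"
      by (intro Bochner_Integration.integral_cong refl) (auto simp: D_eq split: split_indicator)
    also have "\<dots> \<le> l2norm (D S) * W"
      unfolding W_def by (intro cauchy_schwarz_norm D L2_indicator cell_finite cell_borel)
    finally show ?thesis unfolding D_inv .
  qed
  have lim_W: "((\<lambda>S. l2norm (D S) * W) \<longlongrightarrow> 0) ?F"
    using tendsto_mult[OF lim tendsto_const[of W]] by simp
  show "uniform_limit UNIV (\<lambda>S z. \<Sum>\<mu>\<in>S. c \<mu> * inv_fourier_integral m (z - \<mu>)) (inv_fourier_integral h) ?F"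
  proof (rule uniform_limitI)
    fix e :: real assume "e > 0"
    then have "\<forall>\<^sub>F S in ?F. l2norm (D S) * W < e"
      by (rule order_tendstoD(2)[OF lim_W])
    then show "\<forall>\<^sub>F S in ?F. \<forall>z\<in>UNIV. dist (\<Sum>\<mu>\<in>S. c \<mu> * inv_fourier_integral m (z - \<mu>)) (inv_fourier_integral h z) < e"
    proof eventually_elim
      case (elim S)
      then show ?case using pt[where S=S] by (auto simp: dist_norm intro: le_less_trans)
    qed
  qed
qed

subsection \<open>The lattice in phase space\<close>

text \<open>
  Only the values on basis vectors matter; there \<open>snd z = 0\<close> distinguishes position directions from
  frequency directions.
\<close>

definition lattice_period :: "real \<Rightarrow> real \<Rightarrow> (real^'d) \<times> (real^'d) \<Rightarrow> real" where
  "lattice_period a b z = (if snd z = 0 then a else b)"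

lemma Basis_phase_space:
  "(Basis :: ((real^'d) \<times> (real^'d)) set) = range (\<lambda>j. (axis j 1, 0)) \<union> range (\<lambda>j. (0, axis j 1))"
  unfolding Basis_prod_def Basis_vec_def by auto

lemma ball_Basis_phase_space:
  "(\<forall>b\<in>(Basis :: ((real^'d) \<times> (real^'d)) set). P b) \<longleftrightarrow> (\<forall>j. P (axis j 1, 0)) \<and> (\<forall>j. P (0, axis j 1))"
  unfolding Basis_phase_space by auto

lemma prod_Basis_phase_space:
  "(\<Prod>b\<in>(Basis :: ((real^'d) \<times> (real^'d)) set). f b) = (\<Prod>j\<in>UNIV. f (axis j 1, 0)) * (\<Prod>j\<in>UNIV. f (0, axis j 1))"
proof -
  have "(\<Prod>b\<in>(Basis :: ((real^'d) \<times> (real^'d)) set). f b)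
      = prod f (range (\<lambda>j. (axis j 1, 0))) * prod f (range (\<lambda>j. (0, axis j 1)))"
    unfolding Basis_phase_space by (rule prod.union_disjoint) (auto simp: axis_eq_0_iff)
  also have "prod f (range (\<lambda>j. (axis j 1, 0))) = (\<Prod>j\<in>UNIV. f (axis j 1, 0))"
    by (subst prod.reindex) (auto simp: inj_on_def axis_eq_axis)
  also have "prod f (range (\<lambda>j. (0, axis j 1))) = (\<Prod>j\<in>UNIV. f (0, axis j 1))"
    by (subst prod.reindex) (auto simp: inj_on_def axis_eq_axis)
  finally show ?thesis .
qed

lemma lattice_period_axis [simp]:
  "lattice_period a b (axis j 1, 0) = a" "lattice_period a b (0, axis j 1) = b"
  by (simp_all add: lattice_period_def axis_eq_0_iff)

lemma inner_phase_axis [simp]: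
  "z \<bullet> (axis j 1, 0) = fst z $ j" "z \<bullet> (0, axis j 1) = snd z $ j"
  for z :: "(real^'d) \<times> (real^'d)"
  by (cases z; simp add: inner_axis)+

lemma lattice_period_pos: "a > 0 \<Longrightarrow> b > 0 \<Longrightarrow> \<forall>e\<in>Basis. lattice_period a b e > 0"
  by (simp add: ball_Basis_phase_space)

lemma dual_cell_eq: "dual_cell a b = cell (lattice_period a b)"
  unfolding dual_cell_def cell_def ball_Basis_phase_space
  by (auto simp: abs_le_iff minus_le_iff)

lemma lattice_eq: "lattice a b = period_lattice (lattice_period a b)"
  unfolding lattice_def period_lattice_def ball_Basis_phase_space by auto

lemma sinc_lattice_eq: "sinc_lattice a b z = complex_of_real (sinc_prod (lattice_period a b) z)"
  unfolding sinc_lattice_def sinc_prod_def prod_Basis_phase_space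
  by (simp only: lattice_period_axis inner_phase_axis)

subsection \<open>Supports and multipliers\<close>

text \<open>
  The complement of the essential support is a union of open sets on each of which the function
  vanishes almost everywhere; by Lindelof's theorem countably many of them suffice.
\<close>

lemma AE_zero_outside_ess_support: "AE x in lborel. x \<notin> ess_support f \<longrightarrow> f x = 0"
proof -
  define \<U> where "\<U> = {U. open U \<and> (AE x in lborel. x \<in> U \<longrightarrow> f x = 0)}"
  have "\<And>U. U \<in> \<U> \<Longrightarrow> open U" by (simp add: \<U>_def)
  then obtain \<V> where \<V>: "\<V> \<subseteq> \<U>" "countable \<V>" "\<Union>\<V> = \<Union>\<U>"
    by (rule Lindelof)
  have "AE x in lborel. \<forall>U\<in>\<V>. x \<in> U \<longrightarrow> f x = 0"
    unfolding AE_ball_countable[OF \<V>(2)] using \<V>(1) by (auto simp: \<U>_def)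
  then show ?thesis
  proof eventually_elim
    case (elim x)
    then show ?case using \<V>(3) unfolding ess_support_def \<U>_def by auto
  qed
qed

lemma zero_outside_supp: "\<zeta> \<notin> supp \<phi> \<Longrightarrow> \<phi> \<zeta> = 0"
  using closure_subset[of "support_on UNIV \<phi>"] by (auto simp: supp_def support_on_def)

lemma quotient_symbol_L2:
  fixes g :: "real^'d \<Rightarrow> complex"
  assumes \<phi>: "\<phi> \<in> test_functions" and g: "g \<in> L2"
    and nz: "\<forall>\<zeta>\<in>supp \<phi>. cnj (rotate_U (stft g g) \<zeta>) \<noteq> 0"
  shows "quotient_symbol \<phi> g \<in> L2" "integrable lborel (quotient_symbol \<phi> g)"
proof -
  let ?U = "\<lambda>\<zeta>. cnj (rotate_U (stft g g) \<zeta>)"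
  have "C_k 0 \<phi>" and K: "compact (supp \<phi>)" using \<phi> unfolding test_functions_def by blast+
  then have \<phi>c: "continuous_on UNIV \<phi>" by simp
  have Uc: "continuous_on UNIV ?U" by (intro continuous_on_cnj rotate_stft_continuous g)
  note [measurable] = borel_measurable_continuous_onI[OF \<phi>c] borel_measurable_continuous_onI[OF Uc]
  have [measurable]: "supp \<phi> \<in> sets borel" using K by (simp add: borel_compact)
  obtain C where C: "C \<ge> 0" "\<And>\<zeta>. \<zeta> \<in> supp \<phi> \<Longrightarrow> cmod (\<phi> \<zeta> / ?U \<zeta>) \<le> C"
    using quotient_bounded_on_compact[OF K continuous_on_subset[OF \<phi>c] continuous_on_subset[OF Uc]] nz by blast
  have b: "bounded {\<zeta>. quotient_symbol \<phi> g \<zeta> \<noteq> 0}"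
    by (rule bounded_subset[OF compact_imp_bounded[OF K]]) (auto simp: quotient_symbol_def)
  show q: "quotient_symbol \<phi> g \<in> L2"
  proof (rule L2_bounded_support[OF _ b, where C=C])
    show "quotient_symbol \<phi> g \<in> borel_measurable lborel"
      unfolding quotient_symbol_def[abs_def] by measurable
    show "cmod (quotient_symbol \<phi> g \<zeta>) \<le> C" for \<zeta>
      using C by (auto simp: quotient_symbol_def)
  qed
  show "integrable lborel (quotient_symbol \<phi> g)"
    by (rule L2_bounded_support_integrable[OF q b])
qed

text \<open>
  The product of sincs is the inverse Fourier integral of the normalised indicator of the box, so
  this is an instance of inversion. It is not integrable, and its transform cannot be computed as a
  Fourier integral.
\<close>

lemma fourier_sinc_lattice:
  assumes "a > 0" "b > 0"
  shows "AE \<xi> :: (real^'d) \<times> (real^'d) in lborel. fourier (sinc_lattice a b) \<xi>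
      = (indicator (dual_cell a b) \<xi> :: complex) / cell_volume (lattice_period a b :: (real^'d) \<times> (real^'d) \<Rightarrow> real)"
proof -
  let ?l = "lattice_period a b :: (real^'d) \<times> (real^'d) \<Rightarrow> real"
  let ?h = "\<lambda>\<xi> :: (real^'d) \<times> (real^'d). (1 / complex_of_real (cell_volume ?l)) * indicator (cell ?l) \<xi>"
  have l: "\<forall>e\<in>Basis. ?l e > 0" by (rule lattice_period_pos[OF assms])
  have h: "?h \<in> L2" "integrable lborel ?h"
    by (intro L2_cmult L2_indicator cell_finite cell_borel)
       (intro integrable_mult_right integrable_complex_indicator cell_finite, simp)
  have "inv_fourier_integral ?h = sinc_lattice a b"
  proof
    fix z
    have "inv_fourier_integral ?h z = (1 / complex_of_real (cell_volume ?l)) * inv_fourier_integral (indicator (cell ?l)) z"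
      unfolding inv_fourier_integral_eq by (simp only: mult.assoc integral_mult_right_zero)
    also have "\<dots> = sinc_lattice a b z"
      using less_imp_neq[OF cell_volume_pos[OF l]] by (simp add: cell_inv_fourier[OF l] sinc_lattice_eq)
    finally show "inv_fourier_integral ?h z = sinc_lattice a b z" .
  qed
  then show ?thesis
    using fourier_inversion[OF h] by (simp add: dual_cell_eq)
qed

theorem proposition3p3:
  fixes a b :: real
    and \<sigma> \<phi> K :: "(real^'d) \<times> (real^'d) \<Rightarrow> complex"
    and g :: "real^'d \<Rightarrow> complex"
  assumes "a > 0" and "b > 0"
    and "\<sigma> \<in> L2" and "ess_support (fourier \<sigma>) \<subseteq> dual_cell a b"
    and "g \<in> L2"
    and "\<phi> \<in> test_functions" and "\<forall>\<zeta>\<in>dual_cell a b. \<phi> \<zeta> = 1"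
    and "\<forall>\<zeta>\<in>supp \<phi>. cnj (rotate_U (stft g g) \<zeta>) \<noteq> 0"
    and "K = inv_fourier (quotient_symbol \<phi> g)"
  shows "L2_tendsto
           (\<lambda>S z. \<Sum>\<mu>\<in>S. diag_coeff \<sigma> g \<mu> * translate \<mu> (conv (sinc_lattice a b) K) z)
           \<sigma> (finite_subsets_at_top (lattice a b))
       \<and> (\<exists>\<sigma>\<^sub>c G\<^sub>c. continuous_on UNIV \<sigma>\<^sub>c \<and> (AE z in lborel. \<sigma>\<^sub>c z = \<sigma> z)
            \<and> continuous_on UNIV G\<^sub>c \<and> (AE z in lborel. G\<^sub>c z = conv (sinc_lattice a b) K z)
            \<and> uniform_limit UNIV
                (\<lambda>S z. \<Sum>\<mu>\<in>S. diag_coeff \<sigma> g \<mu> * translate \<mu> G\<^sub>c z)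
                \<sigma>\<^sub>c (finite_subsets_at_top (lattice a b)))"
proof -
  let ?l = "lattice_period a b :: (real^'d) \<times> (real^'d) \<Rightarrow> real"
  let ?Q = "cell ?l" and ?V = "cell_volume ?l" and ?F = "finite_subsets_at_top (lattice a b :: ((real^'d) \<times> (real^'d)) set)"
  let ?U = "\<lambda>\<zeta>. cnj (rotate_U (stft g g) \<zeta>)"
  have l: "\<forall>e\<in>Basis. ?l e > 0" by (rule lattice_period_pos[OF assms(1,2)])
  have \<phi>1: "\<phi> \<zeta> = 1" "\<zeta> \<in> supp \<phi>" "?U \<zeta> \<noteq> 0" if "\<zeta> \<in> ?Q" for \<zeta>
  proof -
    show "\<phi> \<zeta> = 1" using assms(7) that by (simp add: dual_cell_eq)
    then show "\<zeta> \<in> supp \<phi>" using zero_outside_supp[of \<zeta> \<phi>] by fastforce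
    then show "?U \<zeta> \<noteq> 0" using assms(8) by blast
  qed
  then have Unz: "\<forall>\<zeta>\<in>?Q. ?U \<zeta> \<noteq> 0" by blast
  have Uc: "continuous_on UNIV ?U" by (intro continuous_on_cnj rotate_stft_continuous assms)
  define h where "h \<zeta> = indicator ?Q \<zeta> * fourier \<sigma> \<zeta>" for \<zeta>
  have h: "h \<in> L2"
    unfolding h_def
    by (rule L2_bounded_mult[OF fourier_L2[OF assms(3)], where C=1]) (auto simp: borel_measurable_indicator split: split_indicator)
  have h0: "\<forall>\<zeta>. \<zeta> \<notin> ?Q \<longrightarrow> h \<zeta> = 0" by (simp add: h_def)
  have h1: "integrable lborel h"
    by (rule L2_bounded_support_integrable[OF h bounded_subset[OF cell_bounded[of ?l]]]) (use h0 in auto)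
  have "AE \<zeta> in lborel. fourier \<sigma> \<zeta> = fourier (inv_fourier_integral h) \<zeta>"
    using AE_zero_outside_ess_support[of "fourier \<sigma>"] fourier_inversion[OF h h1]
  proof eventually_elim
    case (elim \<zeta>)
    then show ?case using assms(4) by (auto simp: h_def dual_cell_eq split: split_indicator)
  qed
  then have \<sigma>: "AE z in lborel. \<sigma> z = inv_fourier_integral h z"
    by (rule fourier_inj[OF assms(3) inv_fourier_integral_L2[OF h h1]])
  define c where "c \<mu> = (LINT \<zeta>|lborel. h \<zeta> * ?U \<zeta> * cis (2 * pi * (\<mu> \<bullet> \<zeta>)))" for \<mu>
  have coeff: "diag_coeff \<sigma> g \<mu> = c \<mu>" for \<mu>
    unfolding c_def by (rule diag_coeff_integral[OF assms(3) \<sigma> h h1 assms(5)])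
  define m where "m = (\<lambda>\<zeta>. indicator ?Q \<zeta> / (?V * ?U \<zeta>))"
  note kernel = sampling_kernel_L2[OF l h h0 Uc Unz, folded m_def]
  note recon = sampling_L2[OF l h h0 Uc Unz, folded m_def c_def]
    sampling_uniform[OF l h h0 Uc Unz, folded m_def c_def]
  let ?G = "inv_fourier_integral m"
  note q = quotient_symbol_L2[OF assms(6,5,8)]
  have FK: "AE \<xi> in lborel. fourier K \<xi> = quotient_symbol \<phi> g \<xi>"
    unfolding assms(9) by (rule inv_fourier_eq_integral(3)[OF q]) simp
  have Fs: "AE \<xi> in lborel. fourier (sinc_lattice a b) \<xi> = (indicator ?Q \<xi> :: complex) / ?V"
    using fourier_sinc_lattice[OF assms(1,2)] unfolding dual_cell_eq .
  have mult: "AE \<xi> in lborel. fourier K \<xi> * fourier (sinc_lattice a b) \<xi> = m \<xi>"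
    using FK Fs
  proof eventually_elim
    case (elim \<xi>)
    then show ?case
      using \<phi>1[of \<xi>] by (cases "\<xi> \<in> ?Q") (simp_all add: m_def quotient_symbol_def)
  qed
  let ?C = "conv (sinc_lattice a b) K"
  have C: "?C \<in> L2" "AE z in lborel. ?C z = ?G z"
    unfolding conv_def using inv_fourier_eq_integral[OF kernel mult] by auto
  have G: "?G \<in> L2" by (rule inv_fourier_integral_L2[OF kernel])
  \<comment> \<open>Translation preserves the distance \<open>0\<close> between the two representatives.\<close>
  have shift: "AE z in lborel. ?C (z - \<mu>) = ?G (z - \<mu>)" for \<mu>
  proof (rule l2norm_diff_eq_0[OF L2_translate[OF C(1)] L2_translate[OF G]])
    have "l2norm (\<lambda>z. ?C (z - \<mu>) - ?G (z - \<mu>)) = l2norm (\<lambda>z. ?C z - ?G z)"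
      using L2_measurable[OF C(1)] L2_measurable[OF G]
      by (intro l2norm_translate[where f="\<lambda>z. ?C z - ?G z"]) simp
    also have "\<dots> = l2norm (\<lambda>z::(real^'d) \<times> (real^'d). 0)"
      using C(2) by (intro l2norm_AE_cong L2_measurable L2_diff C(1) G) auto
    finally show "l2norm (\<lambda>z. ?C (z - \<mu>) - ?G (z - \<mu>)) = 0" by (simp add: l2norm_def)
  qed
  have sumL2: "(\<lambda>z. \<Sum>\<mu>\<in>S. diag_coeff \<sigma> g \<mu> * translate \<mu> ?C z) \<in> L2" for S
    unfolding translate_def by (intro L2_sum L2_cmult L2_translate C)
  have sumL2': "(\<lambda>z. \<Sum>\<mu>\<in>S. c \<mu> * ?G (z - \<mu>)) \<in> L2" for S
    by (intro L2_sum L2_cmult L2_translate G)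
  have "l2norm (\<lambda>z. (\<Sum>\<mu>\<in>S. diag_coeff \<sigma> g \<mu> * translate \<mu> ?C z) - \<sigma> z)
      = l2norm (\<lambda>z. (\<Sum>\<mu>\<in>S. c \<mu> * ?G (z - \<mu>)) - inv_fourier_integral h z)" for S
  proof (rule l2norm_AE_cong)
    show "AE z in lborel. (\<Sum>\<mu>\<in>S. diag_coeff \<sigma> g \<mu> * translate \<mu> ?C z) - \<sigma> z
        = (\<Sum>\<mu>\<in>S. c \<mu> * ?G (z - \<mu>)) - inv_fourier_integral h z"
    proof (cases "finite S")
      case True
      then have "AE z in lborel. \<forall>\<mu>\<in>S. ?C (z - \<mu>) = ?G (z - \<mu>)"
        by (intro AE_finite_allI shift)
      then show ?thesis
        using \<sigma> by eventually_elim (simp add: coeff translate_def)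
    next
      case False
      then show ?thesis using \<sigma> by simp
    qed
  qed (intro L2_measurable L2_diff sumL2 sumL2' assms inv_fourier_integral_L2 h h1)+
  then have "L2_tendsto (\<lambda>S z. \<Sum>\<mu>\<in>S. diag_coeff \<sigma> g \<mu> * translate \<mu> ?C z) \<sigma> ?F"
    using recon(1) by (subst L2_tendsto_iff[OF sumL2 assms(3)]) (simp add: lattice_eq)
  moreover have "uniform_limit UNIV (\<lambda>S z. \<Sum>\<mu>\<in>S. diag_coeff \<sigma> g \<mu> * translate \<mu> ?G z) (inv_fourier_integral h) ?F"
    using recon(2) by (simp add: coeff translate_def lattice_eq)
  moreover have "continuous_on UNIV (inv_fourier_integral h)" "continuous_on UNIV ?G"
    by (intro inv_fourier_integral_continuous h1 kernel)+
  moreover have "AE z in lborel. inv_fourier_integral h z = \<sigma> z" "AE z in lborel. ?G z = ?C z"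
    using \<sigma> C(2) by (auto elim: AE_mp)
  ultimately show ?thesis by blast
qed

end
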